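(* Let $n\ge 2$ and let $S^{\lambda,\mu}$ be an irreducible representation of $B_{n-1}$, where $\lambda,\mu$ are partitions with $|\lambda|+|\mu|=n-1$. Then: 1. $\mathrm{ind}^{B_n}_{B_{n-1}\times B_1}S^{\lambda,\mu}\boxtimes(\mathbf 1;\mathbf 1)=\bigoplus_{\tau\in\overline{\lambda}}S^{\tau,\mu}$; 2. $\mathrm{ind}^{B_n}_{B_{n-1}\times B_1}S^{\lambda,\mu}\boxtimes(\epsilon;\mathbf 1)=\bigoplus_{\rho\in\overline{\mu}}S^{\lambda,\rho}$; 3. $\mathrm{ind}^{B_n}_{B_{n-1}\times S_1}S^{\lambda,\mu}\boxtimes\mathbf 1=\bigoplus_{\tau\in\overline{\lambda}}S^{\tau,\mu}\oplus\bigoplus_{\rho\in\overline{\mu}}S^{\lambda,\rho}$.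
   Context: All representations are finite-dimensional over $\mathbb{C}$. Let $F=\mathbb{Z}/2$ and $B_m=F\wr S_m=F^m\rtimes S_m$, where $S_m$ permutes the coordinates of $F^m$. $B_{m-k}\times B_k$ is identified with $F\wr(S_{m-k}\times S_k)\leqslant B_m$. $\mathbf 1$ denotes a trivial representation and $\epsilon$ the sign (nontrivial one-dimensional) representation of $F$. For an irreducible representation $D\in\{\mathbf 1,\epsilon\}$ of $F$ and a representation $E$ of $S_m$, $(D;E)$ is the representation of $B_m$ on the space of $E$ in which $(f,\sigma)$ acts as $D(f_1)\cdots D(f_m)$ times the action of $\sigma$. For partitions $\lambda\vdash m-k$, $\mu\vdash k$, with Specht modules $S^\lambda,S^\mu$, set $S^{\lambda,\mu}:=\mathrm{ind}^{B_m}_{B_{m-k}\times B_k}(\mathbf 1;S^\lambda)\boxtimes(\epsilon;S^\mu)$; these are the irreducible representations of $B_m$. $B_1=F$ and $B_{n-1}\times S_1$ is the subgroup $B_{n-1}\times\{\mathrm{id}\}$ of $B_{n-1}\times B_1$. For a partition $\lambda$ of $m$, $\overline{\lambda}$ is the set of partitions of $m+1$ whose Young diagram is obtained from that of $\lambda$ by adding one box. *)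

theory Defs
  imports
    "HOL-Algebra.Sym_Groups"
    "HOL-Algebra.Product_Groups"
    "HOL-Library.Function_Algebras"
    Complex_Main
begin

section \<open>Complex representations\<close>

text \<open>
  Every vector space occurring here is a linear subspace of a space \<open>'x \<Rightarrow> complex\<close> of
  complex-valued functions with the pointwise operations, so that spans, subspaces and linear
  structure are those of the library.
\<close>

definition cscale :: "complex \<Rightarrow> ('x \<Rightarrow> complex) \<Rightarrow> ('x \<Rightarrow> complex)"
  where "cscale c u = (\<lambda>x. c * u x)"

interpretation cfun: vector_space "cscale :: complex \<Rightarrow> ('x \<Rightarrow> complex) \<Rightarrow> ('x \<Rightarrow> complex)"
  by unfold_locales (auto simp: cscale_def fun_eq_iff algebra_simps)

definition linear_between ::
    "('x \<Rightarrow> complex) set \<Rightarrow> ('y \<Rightarrow> complex) set \<Rightarrow> (('x \<Rightarrow> complex) \<Rightarrow> ('y \<Rightarrow> complex)) \<Rightarrow> bool"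
  where "linear_between V W T \<longleftrightarrow>
    T ` V \<subseteq> W \<and>
    (\<forall>u\<in>V. \<forall>v\<in>V. T (u + v) = T u + T v) \<and>
    (\<forall>c. \<forall>u\<in>V. T (cscale c u) = cscale c (T u))"

record ('g, 'x) rep =
  vs :: "('x \<Rightarrow> complex) set"
  act :: "'g \<Rightarrow> ('x \<Rightarrow> complex) \<Rightarrow> ('x \<Rightarrow> complex)"

text \<open>The values of \<^term>\<open>act R g\<close> outside \<^term>\<open>vs R\<close> are irrelevant.\<close>

definition group_rep :: "('g, 'b) monoid_scheme \<Rightarrow> ('g, 'x) rep \<Rightarrow> bool"
  where "group_rep G R \<longleftrightarrow>
    group G \<and>
    cfun.subspace (vs R) \<and> (\<exists>B. finite B \<and> cfun.span B = vs R) \<and>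
    (\<forall>g\<in>carrier G. linear_between (vs R) (vs R) (act R g)) \<and>
    (\<forall>u\<in>vs R. act R \<one>\<^bsub>G\<^esub> u = u) \<and>
    (\<forall>g\<in>carrier G. \<forall>h\<in>carrier G. \<forall>u\<in>vs R. act R (g \<otimes>\<^bsub>G\<^esub> h) u = act R g (act R h u))"

definition rep_iso :: "('g, 'b) monoid_scheme \<Rightarrow> ('g, 'x) rep \<Rightarrow> ('g, 'y) rep \<Rightarrow> bool"
  where "rep_iso G R S \<longleftrightarrow>
    group_rep G R \<and> group_rep G S \<and>
    (\<exists>T. linear_between (vs R) (vs S) T \<and> bij_betw T (vs R) (vs S) \<and>
         (\<forall>g\<in>carrier G. \<forall>u\<in>vs R. T (act R g u) = act S g (T u)))"

definition trivial_rep :: "('g, unit) rep"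
  where "trivial_rep = \<lparr> vs = UNIV, act = (\<lambda>g u. u) \<rparr>"

text \<open>
  A family of functions \<open>u\<^sub>i :: 'x \<Rightarrow> complex\<close> is encoded as one function on \<open>'i \<times> 'x\<close>, with
  value 0 at indices that are not in use.
\<close>

definition direct_sum :: "'i set \<Rightarrow> ('i \<Rightarrow> ('g, 'x) rep) \<Rightarrow> ('g, 'i \<times> 'x) rep"
  where "direct_sum I R =
    \<lparr> vs = {u. (\<forall>i\<in>I. (\<lambda>x. u (i, x)) \<in> vs (R i)) \<and> (\<forall>i x. i \<notin> I \<longrightarrow> u (i, x) = 0)},
      act = (\<lambda>g u (i, x). if i \<in> I then act (R i) g (\<lambda>x'. u (i, x')) x else 0) \<rparr>"

definition rep_plus :: "('g, 'x) rep \<Rightarrow> ('g, 'y) rep \<Rightarrow> ('g, 'x + 'y) rep"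
  where "rep_plus R S =
    \<lparr> vs = {u. u \<circ> Inl \<in> vs R \<and> u \<circ> Inr \<in> vs S},
      act = (\<lambda>g u. case_sum (act R g (u \<circ> Inl)) (act S g (u \<circ> Inr))) \<rparr>"

text \<open>
  The tensor product of two spaces of functions is realised as a space of functions of two
  variables, \<open>u \<otimes> v\<close> being \<open>(x, y) \<mapsto> u x * v y\<close>.  The pair \<open>(g, h)\<close> acts by applying \<open>g\<close> in the
  first variable and \<open>h\<close> in the second; on \<open>u \<otimes> v\<close> this is \<open>g u \<otimes> h v\<close>
  (see \<open>outer_tensor_pure\<close> below).
\<close>

definition pure_tensor :: "('x \<Rightarrow> complex) \<Rightarrow> ('y \<Rightarrow> complex) \<Rightarrow> ('x \<times> 'y \<Rightarrow> complex)"
  where "pure_tensor u v = (\<lambda>(x, y). u x * v y)"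

definition outer_tensor :: "('g, 'x) rep \<Rightarrow> ('h, 'y) rep \<Rightarrow> ('g \<times> 'h, 'x \<times> 'y) rep"
  where "outer_tensor R S =
    \<lparr> vs = cfun.span {pure_tensor u v |u v. u \<in> vs R \<and> v \<in> vs S},
      act = (\<lambda>(g, h) w (x, y). act S h (\<lambda>y'. act R g (\<lambda>x'. w (x', y')) x) y) \<rparr>"

lemma outer_tensor_pure:
  assumes R: "group_rep G R" and S: "group_rep H S"
    and g: "g \<in> carrier G" and h: "h \<in> carrier H" and u: "u \<in> vs R" and v: "v \<in> vs S"
  shows "act (outer_tensor R S) (g, h) (pure_tensor u v) = pure_tensor (act R g u) (act S h v)"
proof -
  have 1: "act R g (\<lambda>x'. u x' * c) = (\<lambda>x. act R g u x * c)" for c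
  proof -
    have "act R g (cscale c u) = cscale c (act R g u)"
      using R g u by (simp add: group_rep_def linear_between_def)
    then show ?thesis by (simp add: cscale_def mult.commute)
  qed
  have 2: "act S h (\<lambda>y'. c * v y') = (\<lambda>y. c * act S h v y)" for c
  proof -
    have "act S h (cscale c v) = cscale c (act S h v)"
      using S h v by (simp add: group_rep_def linear_between_def)
    then show ?thesis by (simp add: cscale_def)
  qed
  show ?thesis by (auto simp: outer_tensor_def pure_tensor_def 1 2)
qed

text \<open>
  The representation of \<open>G\<close> induced from a representation \<open>R\<close> of \<open>H\<close>, where the finite group \<open>H\<close>
  is identified with a subgroup of \<open>G\<close> by an injective homomorphism \<open>\<phi>\<close>: the space of all
  \<open>u : G \<rightarrow> vs R\<close> with \<open>u (\<phi> h g) = h (u g)\<close>, on which \<open>G\<close> acts by right translation.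
  As for direct sums, \<open>u\<close> is encoded as a function on pairs that vanishes off the carrier.
\<close>

definition induced_rep ::
    "('g, 'b) monoid_scheme \<Rightarrow> ('h, 'c) monoid_scheme \<Rightarrow> ('h \<Rightarrow> 'g) \<Rightarrow> ('h, 'x) rep \<Rightarrow> ('g, 'g \<times> 'x) rep"
  where "induced_rep G H \<phi> R =
    \<lparr> vs = {u. (\<forall>g\<in>carrier G. (\<lambda>x. u (g, x)) \<in> vs R) \<and>
               (\<forall>g x. g \<notin> carrier G \<longrightarrow> u (g, x) = 0) \<and>
               (\<forall>h\<in>carrier H. \<forall>g\<in>carrier G.
                  (\<lambda>x. u (\<phi> h \<otimes>\<^bsub>G\<^esub> g, x)) = act R h (\<lambda>x. u (g, x)))},
      act = (\<lambda>a u (g, x). if g \<in> carrier G then u (g \<otimes>\<^bsub>G\<^esub> a, x) else 0) \<rparr>"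


section \<open>Wreath products with symmetric groups\<close>

definition wreath_sym :: "('f, 'b) monoid_scheme \<Rightarrow> nat \<Rightarrow> ((nat \<Rightarrow> 'f) \<times> (nat \<Rightarrow> nat)) monoid"
  where "wreath_sym F m =
    \<lparr> carrier = carrier (product_group {1..m} (\<lambda>_. F)) \<times> carrier (sym_group m),
      mult = (\<lambda>(f, \<sigma>) (g, \<tau>).
        (f \<otimes>\<^bsub>product_group {1..m} (\<lambda>_. F)\<^esub> (\<lambda>i\<in>{1..m}. g (inv' \<sigma> i)), \<sigma> \<otimes>\<^bsub>sym_group m\<^esub> \<tau>)),
      one = (\<one>\<^bsub>product_group {1..m} (\<lambda>_. F)\<^esub>, \<one>\<^bsub>sym_group m\<^esub>) \<rparr>"

text \<open>
  The identification of \<open>(F \<wr> S\<^sub>a) \<times> (F \<wr> S\<^sub>b)\<close> with \<open>F \<wr> (S\<^sub>a \<times> S\<^sub>b) \<le> F \<wr> S\<^sub>a\<^sub>+\<^sub>b\<close>: the first factor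
  uses the coordinates \<open>1, \<dots>, a\<close> and the second one the coordinates \<open>a + 1, \<dots>, a + b\<close>.
\<close>

definition block_emb :: "nat \<Rightarrow> nat \<Rightarrow>
    ((nat \<Rightarrow> 'f) \<times> (nat \<Rightarrow> nat)) \<times> ((nat \<Rightarrow> 'f) \<times> (nat \<Rightarrow> nat)) \<Rightarrow> (nat \<Rightarrow> 'f) \<times> (nat \<Rightarrow> nat)"
  where "block_emb a b = (\<lambda>((f, \<sigma>), (g, \<tau>)).
    (\<lambda>i\<in>{1..a + b}. if i \<le> a then f i else g (i - a),
     \<lambda>i. if i \<le> a then \<sigma> i else if i \<le> a + b then a + \<tau> (i - a) else i))"

text \<open>\<open>(D; E)\<close> for a one-dimensional representation of \<open>F\<close>, given by its character \<open>D\<close>.\<close>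

definition wreath_rep :: "('f \<Rightarrow> complex) \<Rightarrow> nat \<Rightarrow> (nat \<Rightarrow> nat, 'x) rep \<Rightarrow>
    ((nat \<Rightarrow> 'f) \<times> (nat \<Rightarrow> nat), 'x) rep"
  where "wreath_rep D m E =
    \<lparr> vs = vs E, act = (\<lambda>(f, \<sigma>) u. cscale (\<Prod>i = 1..m. D (f i)) (act E \<sigma> u)) \<rparr>"

abbreviation Z2 :: "int monoid"
  where "Z2 \<equiv> integer_mod_group 2"

type_synonym hyperoct = "(nat \<Rightarrow> int) \<times> (nat \<Rightarrow> nat)"

definition B :: "nat \<Rightarrow> hyperoct monoid"
  where "B m = wreath_sym Z2 m"

definition triv_char :: "int \<Rightarrow> complex"
  where "triv_char x = 1"

definition sign_char :: "int \<Rightarrow> complex"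
  where "sign_char x = (if x = 0 then 1 else -1)"


section \<open>Partitions and Specht modules\<close>

definition partitions :: "nat \<Rightarrow> nat list set"
  where "partitions m = {\<nu>. sorted_wrt (\<ge>) \<nu> \<and> 0 \<notin> set \<nu> \<and> sum_list \<nu> = m}"

definition diagram :: "nat list \<Rightarrow> (nat \<times> nat) set"
  where "diagram \<nu> = {(i, j). i < length \<nu> \<and> j < \<nu> ! i}"

definition add_box :: "nat list \<Rightarrow> nat list set"
  where "add_box \<nu> =
    {\<tau> \<in> partitions (sum_list \<nu> + 1). \<exists>c. c \<notin> diagram \<nu> \<and> diagram \<tau> = insert c (diagram \<nu>)}"

text \<open>Only the values of a tableau on the diagram matter.\<close>

definition tableaux :: "nat list \<Rightarrow> (nat \<times> nat \<Rightarrow> nat) set"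
  where "tableaux \<nu> = {t. bij_betw t (diagram \<nu>) {1..sum_list \<nu>}}"

text \<open>
  The tabloid (row equivalence class) of a tableau is encoded by the sequence of the sets of
  entries of its rows.
\<close>

type_synonym tabloid = "nat \<Rightarrow> nat set"

definition tabloid_of :: "nat list \<Rightarrow> (nat \<times> nat \<Rightarrow> nat) \<Rightarrow> tabloid"
  where "tabloid_of \<nu> t = (\<lambda>i. {t (i, j) |j. (i, j) \<in> diagram \<nu>})"

definition column_stabilizer :: "nat list \<Rightarrow> (nat \<times> nat \<Rightarrow> nat) \<Rightarrow> (nat \<Rightarrow> nat) set"
  where "column_stabilizer \<nu> t =
    {\<pi>. \<pi> permutes {1..sum_list \<nu>} \<and>
        (\<forall>j. \<pi> ` {t (i, j) |i. (i, j) \<in> diagram \<nu>} = {t (i, j) |i. (i, j) \<in> diagram \<nu>})}"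

text \<open>
  Elements of the permutation module on tabloids are written as functions on tabloids (their
  coefficients), so that \<open>(\<sigma> u) T = u (\<sigma>\<^sup>-\<^sup>1 T)\<close>.
\<close>

definition polytabloid :: "nat list \<Rightarrow> (nat \<times> nat \<Rightarrow> nat) \<Rightarrow> (tabloid \<Rightarrow> complex)"
  where "polytabloid \<nu> t = (\<Sum>\<pi>\<in>column_stabilizer \<nu> t.
    cscale (of_int (sign \<pi>)) (\<lambda>T. if T = tabloid_of \<nu> (\<pi> \<circ> t) then 1 else 0))"

definition specht :: "nat list \<Rightarrow> (nat \<Rightarrow> nat, tabloid) rep"
  where "specht \<nu> =
    \<lparr> vs = cfun.span (polytabloid \<nu> ` tableaux \<nu>),
      act = (\<lambda>\<sigma> u T. u (\<lambda>i. inv' \<sigma> ` T i)) \<rparr>"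

definition specht2 :: "nat list \<Rightarrow> nat list \<Rightarrow> (hyperoct, hyperoct \<times> tabloid \<times> tabloid) rep"
  where "specht2 \<nu> \<mu> = (let a = sum_list \<nu>; b = sum_list \<mu> in
    induced_rep (B (a + b)) (B a \<times>\<times> B b) (block_emb a b)
      (outer_tensor (wreath_rep triv_char a (specht \<nu>)) (wreath_rep sign_char b (specht \<mu>))))"

end

theory Submission
  imports Defs
begin

text \<open>
  Over the symmetric groups, the branching rule is made explicit: deleting the largest entry from a
  given row, followed by the Gram operator \<open>u \<mapsto> \<Sum>e. \<langle>u, e\<rangle> e\<close> over all polytabloids \<open>e\<close> of shape \<open>\<nu>\<close>,
  is an equivariant map from a Specht module \<open>S\<^sup>\<tau>\<close> to \<open>S\<^sup>\<nu>\<close>, and by Frobenius reciprocity these maps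
  combine to a map from the sum of the \<open>S\<^sup>\<tau>\<close>, with \<open>\<tau>\<close> obtained from \<open>\<nu>\<close> by adding a box, to the
  induced representation of \<open>S\<^sup>\<nu>\<close>.  It is injective by a triangularity argument on rows.  The same
  argument for restriction gives the opposite inequality of dimensions, and the relation
  \<open>DU - UD = 1\<close> in Young's lattice forces all these inequalities to be equalities, so that neither
  irreducibility of Specht modules nor standard tableaux are needed.  The statement for the groups
  \<open>B\<^sub>n\<close> follows by induction in stages.
\<close>

text \<open>Deleting the largest entry from a vector of S^\<tau> gives a vector of the permutation
  module on tabloids of shape \<nu>, in general outside S^\<nu>; classically this is repaired by a
  filtration of the restricted module. The Gram operator avoids the filtration: its values lie in
  S^\<nu>, and it kills exactly the vectors orthogonal to all polytabloids. Injectivity can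
  therefore be tested by pairing with polytabloids, that is, on signed column sums, where
  triangularity is visible. No preimages are ever constructed for the branching map: the subgroup
  B_k x B_1 has k + 1 cosets in B_{k+1}, which bounds the dimension of the induced space by (k + 1)
  dim S^\<nu>, and equality of dimensions gives surjectivity. The branching rule is proved directly
  for B_{k+1}, with one character \<open>D\<close> of Z/2 on both factors B_k and B_1. This covers
  both characters of B_1 in the statement: conjugation by a permutation of the coordinates moves the
  coordinate of B_1 next to the block whose character it shares, \<lambda> for the trivial one and
  \<mu> for the sign.\<close>

lemmas cfun_simps = plus_fun_def zero_fun_def cscale_def

section \<open>Linear algebra in spaces of functions\<close>

text \<open>The finiteness condition inside \<open>group_rep\<close>, named so that it can be
  transported by itself.\<close>

definition fin_dim :: "('x \<Rightarrow> complex) set \<Rightarrow> bool"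
  where "fin_dim V \<longleftrightarrow> cfun.subspace V \<and> (\<exists>B. finite B \<and> cfun.span B = V)"

lemma fin_dimD: "fin_dim V \<Longrightarrow> cfun.subspace V"
  by (simp add: fin_dim_def)

text \<open>Here and below closure rules are put in pointwise form: the maps of this development are
  explicit formulas, in which sums and multiples appear as abstractions rather than as
  \<open>+\<close> and \<open>cscale\<close>.\<close>

lemma subspace_0: "cfun.subspace V \<Longrightarrow> (\<lambda>x. 0) \<in> V"
  using cfun.subspace_0[of V] by (simp add: zero_fun_def)

lemma subspace_add: "cfun.subspace V \<Longrightarrow> u \<in> V \<Longrightarrow> v \<in> V \<Longrightarrow> (\<lambda>x. u x + v x) \<in> V"
  using cfun.subspace_add[of V u v] by (simp add: plus_fun_def)

lemma subspace_scale: "cfun.subspace V \<Longrightarrow> u \<in> V \<Longrightarrow> (\<lambda>x. c * u x) \<in> V"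
  using cfun.subspace_scale[of V u c] by (simp add: cscale_def)

lemma subspace_diff: "cfun.subspace V \<Longrightarrow> u \<in> V \<Longrightarrow> v \<in> V \<Longrightarrow> (\<lambda>x. u x - v x) \<in> V"
  using subspace_add[of V u "\<lambda>x. (-1) * v x"] subspace_scale[of V v "-1"] by simp

lemma subspace_lincomb:
  "cfun.subspace V \<Longrightarrow> u \<in> V \<Longrightarrow> v \<in> V \<Longrightarrow> (\<lambda>x. c * u x + v x) \<in> V"
  by (rule subspace_add[OF _ subspace_scale])

lemma subspace_sum:
  "cfun.subspace V \<Longrightarrow> (\<And>i. i \<in> I \<Longrightarrow> f i \<in> V) \<Longrightarrow> (\<lambda>x. \<Sum>i\<in>I. f i x) \<in> V"
  by (induction I rule: infinite_finite_induct) (auto intro: subspace_0 subspace_add)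

lemma subspaceI:
  assumes "(\<lambda>x. 0) \<in> V" "\<And>u v. u \<in> V \<Longrightarrow> v \<in> V \<Longrightarrow> (\<lambda>x. u x + v x) \<in> V"
    "\<And>u c. u \<in> V \<Longrightarrow> (\<lambda>x. c * u x) \<in> V"
  shows "cfun.subspace V"
  using assms by (auto simp: cfun.subspace_def cfun_simps)

lemma sum_fun_apply: "(\<Sum>i\<in>I. f i) x = (\<Sum>i\<in>I. f i x :: 'a :: comm_monoid_add)"
  by (induction I rule: infinite_finite_induct) auto

text \<open>The set \<open>S\<close> may lie outside \<open>V\<close>: a maximal independent subset
  of \<open>V\<close> is finite by the exchange bound, and it spans \<open>V\<close>.\<close>

lemma fin_dimI:
  assumes "cfun.subspace V" "finite S" "V \<subseteq> cfun.span S"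
  shows "fin_dim V"
proof -
  obtain B where B: "B \<subseteq> V" "cfun.independent B" "V \<subseteq> cfun.span B"
    using cfun.maximal_independent_subset[of V] by auto
  have "finite B"
    using cfun.independent_span_bound[of S B] assms B by blast
  moreover have "cfun.span B = V"
    using B assms(1) cfun.span_minimal by blast
  ultimately show ?thesis
    using assms(1) by (auto simp: fin_dim_def)
qed

lemma span_induct' [consumes 1, case_names zero step]:
  assumes "u \<in> cfun.span S" "P (\<lambda>x. 0)"
    "\<And>c a v. a \<in> S \<Longrightarrow> v \<in> cfun.span S \<Longrightarrow> P v \<Longrightarrow> P (\<lambda>x. c * a x + v x)"
  shows "P u"
proof -
  have "u \<in> cfun.span S \<and> P u"
    using assms(1)
  proof (induction rule: cfun.span_induct_alt)
    case base
    then show ?case using assms(2) cfun.span_zero by (simp add: zero_fun_def)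
  next
    case (step c a v)
    then show ?case
      using assms(3)[of a v c] subspace_add[OF cfun.subspace_span subspace_scale[OF cfun.subspace_span cfun.span_base], of a S v c]
      by (simp add: plus_fun_def cscale_def[of c a])
  qed
  then show ?thesis ..
qed

section \<open>Linear maps between spaces of functions\<close>

lemma linear_betweenI:
  assumes "\<And>u. u \<in> V \<Longrightarrow> T u \<in> W"
    "\<And>u v. u \<in> V \<Longrightarrow> v \<in> V \<Longrightarrow> T (\<lambda>x. u x + v x) = (\<lambda>x. T u x + T v x)"
    "\<And>c u. u \<in> V \<Longrightarrow> T (\<lambda>x. c * u x) = (\<lambda>x. c * T u x)"
  shows "linear_between V W T"
  using assms by (auto simp: linear_between_def cfun_simps)

lemma linear_between_in: "linear_between V W T \<Longrightarrow> u \<in> V \<Longrightarrow> T u \<in> W"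
  by (auto simp: linear_between_def)

lemma linear_between_add:
  "linear_between V W T \<Longrightarrow> u \<in> V \<Longrightarrow> v \<in> V \<Longrightarrow> T (\<lambda>x. u x + v x) = (\<lambda>x. T u x + T v x)"
  by (auto simp: linear_between_def cfun_simps)

lemma linear_between_scale:
  "linear_between V W T \<Longrightarrow> u \<in> V \<Longrightarrow> T (\<lambda>x. c * u x) = (\<lambda>x. c * T u x)"
  by (auto simp: linear_between_def cfun_simps)

lemma linear_between_zero:
  assumes "linear_between V W T" "cfun.subspace V"
  shows "T (\<lambda>x. 0) = (\<lambda>x. 0)"
  using linear_between_scale[OF assms(1) subspace_0[OF assms(2)], of 0] by simp

lemma linear_between_comp:
  "linear_between U V S \<Longrightarrow> linear_between V W T \<Longrightarrow> linear_between U W (\<lambda>u. T (S u))"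
  by (rule linear_betweenI)
    (simp_all add: linear_between_in linear_between_add[of U V S] linear_between_add[of V W T]
      linear_between_scale[of U V S] linear_between_scale[of V W T])

lemma linear_between_inv_into:
  assumes T: "linear_between V W T" "bij_betw T V W" and V: "cfun.subspace V"
  shows "linear_between W V (inv_into V T)"
proof -
  have inv: "inv_into V T (T u) = u" if "u \<in> V" for u
    using T that by (auto simp: bij_betw_def)
  have W: "\<exists>u\<in>V. w = T u" if "w \<in> W" for w
    using T that by (auto simp: bij_betw_def)
  show ?thesis
  proof (rule linear_betweenI)
    fix w assume "w \<in> W"
    then show "inv_into V T w \<in> V" using W inv by metis
  next
    fix w w' assume "w \<in> W" "w' \<in> W"
    then obtain u u' where u: "u \<in> V" "u' \<in> V" "w = T u" "w' = T u'" using W by metis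
    then have "(\<lambda>x. w x + w' x) = T (\<lambda>x. u x + u' x)"
      using linear_between_add[OF T(1)] by simp
    then show "inv_into V T (\<lambda>x. w x + w' x) = (\<lambda>x. inv_into V T w x + inv_into V T w' x)"
      using inv u subspace_add[OF V] by metis
  next
    fix c w assume "w \<in> W"
    then obtain u where u: "u \<in> V" "w = T u" using W by metis
    then have "(\<lambda>x. c * w x) = T (\<lambda>x. c * u x)"
      using linear_between_scale[OF T(1)] by simp
    then show "inv_into V T (\<lambda>x. c * w x) = (\<lambda>x. c * inv_into V T w x)"
      using inv u subspace_scale[OF V] by metis
  qed
qed

lemma linear_between_inj_onI:
  assumes "linear_between V W T" "cfun.subspace V"
    "\<And>u. u \<in> V \<Longrightarrow> T u = (\<lambda>x. 0) \<Longrightarrow> u = (\<lambda>x. 0)"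
  shows "inj_on T V"
proof (rule inj_onI)
  fix u v assume uv: "u \<in> V" "v \<in> V" "T u = T v"
  have "T (\<lambda>x. u x + (-1) * v x) = (\<lambda>x. T u x + (-1) * T v x)"
    using linear_between_add[OF assms(1) uv(1) subspace_scale[OF assms(2) uv(2), of "-1"]]
      linear_between_scale[OF assms(1) uv(2), of "-1"] by simp
  then have "T (\<lambda>x. u x - v x) = (\<lambda>x. 0)" using uv(3) by simp
  then have "(\<lambda>x. u x - v x) = (\<lambda>x. 0)"
    using assms(3) subspace_diff[OF assms(2) uv(1,2)] by blast
  then show "u = v" by (auto simp: fun_eq_iff)
qed

lemma subspace_image:
  assumes T: "linear_between V W T" and V: "cfun.subspace V"
  shows "cfun.subspace (T ` V)"
proof (rule subspaceI)
  show "(\<lambda>x. 0) \<in> T ` V"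
    using linear_between_zero[OF T V] subspace_0[OF V] by (metis imageI)
  show "(\<lambda>x. u x + v x) \<in> T ` V" if uv: "u \<in> T ` V" "v \<in> T ` V" for u v
  proof -
    obtain a b where "a \<in> V" "b \<in> V" "u = T a" "v = T b" using uv by blast
    then show ?thesis
      using linear_between_add[OF T, of a b] subspace_add[OF V, of a b]
      by (auto intro: image_eqI[where x = "\<lambda>x. a x + b x"])
  qed
  show "(\<lambda>x. c * u x) \<in> T ` V" if u: "u \<in> T ` V" for u c
  proof -
    obtain a where "a \<in> V" "u = T a" using u by blast
    then show ?thesis
      using linear_between_scale[OF T, of a c] subspace_scale[OF V, of a c]
      by (auto intro: image_eqI[where x = "\<lambda>x. c * a x"])
  qed
qed

lemma image_span_subset:
  assumes T: "linear_between V W T" and S: "cfun.span S = V" and V: "cfun.subspace V"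
  shows "T ` V \<subseteq> cfun.span (T ` S)"
proof
  fix w assume "w \<in> T ` V"
  then obtain u where u: "u \<in> cfun.span S" "w = T u" using S by blast
  from u(1) have "T u \<in> cfun.span (T ` S)"
  proof (induction rule: span_induct')
    case zero
    then show ?case
      using linear_between_zero[OF T V] subspace_0[OF cfun.subspace_span] by simp
  next
    case (step c a v)
    then have "a \<in> V" "v \<in> V" using S cfun.span_base by auto
    then have "T (\<lambda>x. c * a x + v x) = (\<lambda>x. c * T a x + T v x)"
      using linear_between_add[OF T subspace_scale[OF V]] linear_between_scale[OF T] by simp
    then show ?case
      using subspace_lincomb[OF cfun.subspace_span cfun.span_base[OF imageI[OF step(1)]] step(3)]
      by simp
  qed
  then show "w \<in> cfun.span (T ` S)" using u by simp
qed

lemma fin_dim_image: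
  assumes T: "linear_between V W T" and V: "fin_dim V"
  shows "fin_dim (T ` V)"
proof -
  obtain B where B: "finite B" "cfun.span B = V" and s: "cfun.subspace V"
    using V by (auto simp: fin_dim_def)
  show ?thesis
    using fin_dimI[OF subspace_image[OF T s] finite_imageI[OF B(1)]
        image_span_subset[OF T B(2) s]] .
qed

section \<open>Bases and dimension\<close>

lemma fin_dim_basis:
  assumes "fin_dim V"
  obtains B where "finite B" "cfun.independent B" "cfun.span B = V" "B \<subseteq> V" "card B = cfun.dim V"
proof -
  obtain S where S: "finite S" "cfun.span S = V" and s: "cfun.subspace V"
    using assms by (auto simp: fin_dim_def)
  obtain B where B: "B \<subseteq> V" "cfun.independent B" "V \<subseteq> cfun.span B" "card B = cfun.dim V"
    using cfun.basis_exists[of V] by metis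
  have "finite B" using cfun.independent_span_bound[OF S(1) B(2)] S B by blast
  moreover have "cfun.span B = V" using B s cfun.span_minimal by blast
  ultimately show thesis using B that by blast
qed

lemma linear_between_sum:
  assumes T: "linear_between V W T" and V: "cfun.subspace V" and "\<And>b. b \<in> S \<Longrightarrow> f b \<in> V"
  shows "T (\<lambda>x. \<Sum>b\<in>S. f b x) = (\<lambda>x. \<Sum>b\<in>S. T (f b) x)"
  using assms(3)
proof (induction S rule: infinite_finite_induct)
  case (insert b S)
  then show ?case
    using linear_between_add[OF T, of "f b" "\<lambda>x. \<Sum>b\<in>S. f b x"] subspace_sum[OF V, of S f] by simp
qed (use linear_between_zero[OF T V] in auto)

lemma independentD:
  assumes "cfun.independent S" "finite S" "\<And>x. (\<Sum>v\<in>S. h v * v x) = 0" "v \<in> S"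
  shows "h v = 0"
proof -
  have "(\<Sum>v\<in>S. cscale (h v) v) = 0"
    using assms(3) by (simp add: fun_eq_iff sum_fun_apply cscale_def)
  then show ?thesis
    using assms cfun.dependent_finite[OF assms(2)] by auto
qed

lemma independentI:
  assumes "finite S" "\<And>h v. (\<And>x. (\<Sum>v\<in>S. h v * v x) = 0) \<Longrightarrow> v \<in> S \<Longrightarrow> h v = 0"
  shows "cfun.independent S"
proof
  assume "cfun.dependent S"
  then obtain h v where hv: "v \<in> S" "h v \<noteq> 0" "(\<Sum>v\<in>S. cscale (h v) v) = 0"
    using cfun.dependent_finite[OF assms(1)] by auto
  have "(\<Sum>v\<in>S. h v * v x) = 0" for x
    using fun_cong[OF hv(3), of x] by (simp add: sum_fun_apply cscale_def)
  then show False using assms(2) hv by blast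
qed

lemma independent_image:
  assumes T: "linear_between V W T" and V: "cfun.subspace V" and inj: "inj_on T V"
    and S: "S \<subseteq> V" "cfun.independent S" "finite S"
  shows "cfun.independent (T ` S)"
proof -
  have injB: "inj_on T S" using inj S(1) inj_on_subset by blast
  show ?thesis
  proof (rule independentI[OF finite_imageI[OF S(3)]])
    fix g b assume g: "\<And>x. (\<Sum>v\<in>T ` S. g v * v x) = 0" and b: "b \<in> T ` S"
    have "(\<lambda>x. \<Sum>v\<in>S. g (T v) * T v x) = (\<lambda>x. 0)"
      using g injB by (simp add: sum.reindex o_def)
    moreover have "T (\<lambda>x. \<Sum>v\<in>S. g (T v) * v x) = (\<lambda>x. \<Sum>v\<in>S. g (T v) * T v x)"
      using linear_between_sum[OF T V, of S "\<lambda>b x. g (T b) * b x"] S(1)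
        subspace_scale[OF V] linear_between_scale[OF T]
      by (simp add: subset_iff)
    moreover have "T (\<lambda>x. 0) = (\<lambda>x. 0)" using linear_between_zero[OF T V] .
    moreover have "(\<lambda>x. \<Sum>v\<in>S. g (T v) * v x) \<in> V"
      using S(1) subspace_sum[OF V, of S "\<lambda>v x. g (T v) * v x"] subspace_scale[OF V] by blast
    ultimately have "(\<lambda>x. \<Sum>v\<in>S. g (T v) * v x) = (\<lambda>x. 0)"
      using inj_onD[OF inj _ _ subspace_0[OF V]] by simp
    then show "g b = 0"
      using b independentD[OF S(2,3), of "g \<circ> T"] by (auto simp: fun_eq_iff)
  qed
qed

text \<open>The image of a basis of \<open>V\<close> is independent in \<open>W\<close>; if the
  dimensions allow it, a vector of \<open>W\<close> outside its span would enlarge it beyond the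
  size of a basis of \<open>W\<close>. The second conclusion is the source of surjectivity for the
  branching map.\<close>

lemma dim_le_inj:
  assumes T: "linear_between V W T" and inj: "inj_on T V" and V: "fin_dim V" and W: "fin_dim W"
  shows "cfun.dim V \<le> cfun.dim W"
    and "cfun.dim W \<le> cfun.dim V \<Longrightarrow> T ` V = W"
proof -
  have s: "cfun.subspace V" using V fin_dimD by blast
  obtain B where B: "finite B" "cfun.independent B" "cfun.span B = V" "B \<subseteq> V" "card B = cfun.dim V"
    using fin_dim_basis[OF V] .
  obtain C where C: "finite C" "cfun.independent C" "cfun.span C = W" "C \<subseteq> W" "card C = cfun.dim W"
    using fin_dim_basis[OF W] .
  have ind: "cfun.independent (T ` B)" using independent_image[OF T s inj B(4,2,1)] .
  have TB: "T ` B \<subseteq> W" using T B(4) by (auto simp: linear_between_def)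
  have card: "card (T ` B) = card B" using inj B(4) by (meson card_image inj_on_subset)
  show 1: "cfun.dim V \<le> cfun.dim W"
    using cfun.independent_span_bound[OF C(1) ind] TB C card B by simp
  assume ge: "cfun.dim W \<le> cfun.dim V"
  have "W \<subseteq> cfun.span (T ` B)"
  proof
    fix w assume w: "w \<in> W"
    show "w \<in> cfun.span (T ` B)"
    proof (rule ccontr)
      assume n: "w \<notin> cfun.span (T ` B)"
      then have "cfun.independent (insert w (T ` B))" 
        using ind cfun.independent_insert[of w "T ` B"] cfun.span_base by auto
      then have "card (insert w (T ` B)) \<le> card C"
        using cfun.independent_span_bound[OF C(1)] w TB C(3) by blast
      moreover have "w \<notin> T ` B" using n cfun.span_base by blast
      ultimately show False using B C card ge by simp
    qed
  qed
  moreover have "cfun.span (T ` B) \<subseteq> T ` V"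
    using cfun.span_minimal[OF _ subspace_image[OF T s]] B(4) by blast
  ultimately show "T ` V = W" using T by (auto simp: linear_between_def)
qed

text \<open>The space underlying \<open>direct_sum\<close>, separated from the action. With a
  constant family it also serves as the space of functions on a finite set with values in
  \<open>V\<close>.\<close>

definition fam :: "'i set \<Rightarrow> ('i \<Rightarrow> ('x \<Rightarrow> complex) set) \<Rightarrow> ('i \<times> 'x \<Rightarrow> complex) set"
  where "fam I V = {u. (\<forall>i\<in>I. (\<lambda>x. u (i, x)) \<in> V i) \<and> (\<forall>i x. i \<notin> I \<longrightarrow> u (i, x) = 0)}"

definition single :: "'i \<Rightarrow> ('x \<Rightarrow> complex) \<Rightarrow> ('i \<times> 'x \<Rightarrow> complex)"
  where "single i u = (\<lambda>(j, x). if j = i then u x else 0)"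

lemma subspace_fam:
  assumes "\<And>i. i \<in> I \<Longrightarrow> cfun.subspace (V i)"
  shows "cfun.subspace (fam I V)"
  by (rule subspaceI) (auto simp: fam_def assms intro: subspace_0 subspace_add subspace_scale)

lemma linear_between_single:
  assumes "i \<in> I" "\<And>i. i \<in> I \<Longrightarrow> cfun.subspace (V i)"
  shows "linear_between (V i) (fam I V) (single i)"
proof (rule linear_betweenI)
  show "single i u \<in> fam I V" if "u \<in> V i" for u
  proof -
    have "(\<lambda>x. single i u (j, x)) = (if j = i then u else (\<lambda>x. 0))" for j
      by (auto simp: single_def)
    then show ?thesis
      using that assms by (force simp: fam_def subspace_0 single_def)
  qed
qed (auto simp: single_def fun_eq_iff)

lemma fam_eq_sum_single:
  assumes "finite I" "u \<in> fam I V"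
  shows "u = (\<lambda>z. \<Sum>i\<in>I. single i (\<lambda>x. u (i, x)) z)"
proof
  fix z :: "'a \<times> 'b"
  obtain j x where z: "z = (j, x)" by force
  have "(\<Sum>i\<in>I. single i (\<lambda>x. u (i, x)) z) = (\<Sum>i\<in>I. if j = i then u (j, x) else 0)"
    by (intro sum.cong) (auto simp: single_def z)
  also have "\<dots> = u z" using assms by (auto simp: z fam_def)
  finally show "u z = (\<Sum>i\<in>I. single i (\<lambda>x. u (i, x)) z)" by simp
qed

text \<open>Bases of the members, placed at their indices by \<open>single\<close>, together form a
  basis of the family space.\<close>

lemma
  assumes I: "finite I" and V: "\<And>i. i \<in> I \<Longrightarrow> fin_dim (V i)"
  shows fin_dim_fam: "fin_dim (fam I V)"
    and dim_fam: "cfun.dim (fam I V) = (\<Sum>i\<in>I. cfun.dim (V i))"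
proof -
  have s: "cfun.subspace (V i)" if "i \<in> I" for i using V fin_dimD that by blast
  have "\<forall>i\<in>I. \<exists>B. finite B \<and> cfun.independent B \<and> cfun.span B = V i \<and> B \<subseteq> V i \<and> card B = cfun.dim (V i)"
    using V fin_dim_basis by metis
  then obtain B where B: "\<And>i. i \<in> I \<Longrightarrow> finite (B i)" "\<And>i. i \<in> I \<Longrightarrow> cfun.independent (B i)"
    "\<And>i. i \<in> I \<Longrightarrow> cfun.span (B i) = V i" "\<And>i. i \<in> I \<Longrightarrow> B i \<subseteq> V i"
    "\<And>i. i \<in> I \<Longrightarrow> card (B i) = cfun.dim (V i)"
    by metis
  define S where "S = (\<Union>i\<in>I. single i ` B i)"
  have fS: "finite S" unfolding S_def using I B by auto
  have injs: "single i u = single i v \<Longrightarrow> u = v" for i :: 'a and u v :: "'b \<Rightarrow> complex"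
  proof
    fix x assume eq: "single i u = single i v"
    show "u x = v x" using fun_cong[OF eq, of "(i, x)"] by (simp add: single_def)
  qed
  have sub: "S \<subseteq> fam I V"
    unfolding S_def using linear_between_in[OF linear_between_single[of _ I V]] s B(4) by blast
  have span: "fam I V \<subseteq> cfun.span S"
  proof
    fix u assume u: "u \<in> fam I V"
    have "single i (\<lambda>x. u (i, x)) \<in> cfun.span S" if i: "i \<in> I" for i
    proof -
      have "single i (\<lambda>x. u (i, x)) \<in> single i ` V i" using u i by (auto simp: fam_def)
      then have "single i (\<lambda>x. u (i, x)) \<in> cfun.span (single i ` B i)"
        using image_span_subset[OF linear_between_single[OF i, of V] B(3)[OF i] s[OF i]] s by blast
      moreover have "single i ` B i \<subseteq> S" unfolding S_def using i by blast
      ultimately show ?thesis using cfun.span_mono by blast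
    qed
    then have "(\<lambda>z. \<Sum>i\<in>I. single i (\<lambda>x. u (i, x)) z) \<in> cfun.span S"
      by (rule subspace_sum[OF cfun.subspace_span])
    then show "u \<in> cfun.span S"
      by (simp only: fam_eq_sum_single[OF I u, symmetric])
  qed
  \<comment> \<open>Vectors at different indices can coincide only if both are zero, and zero is
    excluded from an independent set. Hence the union defining \<open>S\<close> is disjoint.\<close>
  have z: "single i b \<noteq> single j b'" if "i \<noteq> j" "i \<in> I" "b \<in> B i" for i j b b'
  proof
    assume eq: "single i b = single j b'"
    have "b x = 0" for x using fun_cong[OF eq, of "(i, x)"] that by (simp add: single_def)
    then have "b = 0" by auto
    then show False using B(2) that cfun.dependent_zero by blast
  qed
  have split: "(\<Sum>v\<in>S. F v) = (\<Sum>i\<in>I. \<Sum>b\<in>B i. F (single i b))" for F :: "('a \<times> 'b \<Rightarrow> complex) \<Rightarrow> 'c :: comm_monoid_add"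
  proof -
    have "(\<Sum>v\<in>S. F v) = (\<Sum>i\<in>I. \<Sum>v\<in>single i ` B i. F v)"
      unfolding S_def
    proof (rule sum.UNION_disjoint[OF I])
      show "\<forall>i\<in>I. \<forall>j\<in>I. i \<noteq> j \<longrightarrow> single i ` B i \<inter> single j ` B j = {}" using z by blast
    qed (use B(1) in auto)
    also have "\<dots> = (\<Sum>i\<in>I. \<Sum>b\<in>B i. F (single i b))"
      by (intro sum.cong refl) (subst sum.reindex, auto intro: inj_onI injs)
    finally show ?thesis .
  qed
  have ind: "cfun.independent S"
  proof (rule independentI[OF fS])
    fix g v assume g: "\<And>x. (\<Sum>v\<in>S. g v * v x) = 0" and "v \<in> S"
    then obtain i b where ib: "i \<in> I" "b \<in> B i" "v = single i b" using S_def by blast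
    \<comment> \<open>Evaluation at the index \<open>i\<close> removes all blocks but one.\<close>
    have "(\<Sum>b\<in>B i. g (single i b) * b x) = 0" for x
    proof -
      have "0 = (\<Sum>j\<in>I. \<Sum>b\<in>B j. g (single j b) * single j b (i, x))"
        using g[of "(i, x)"] unfolding split by simp
      also have "\<dots> = (\<Sum>j\<in>I. if j = i then (\<Sum>b\<in>B i. g (single i b) * b x) else 0)"
        by (auto simp: single_def intro!: sum.cong)
      also have "\<dots> = (\<Sum>b\<in>B i. g (single i b) * b x)" using I ib by simp
      finally show ?thesis by simp
    qed
    then show "g v = 0"
      using independentD[OF B(2)[OF ib(1)] B(1)[OF ib(1)], of "\<lambda>b. g (single i b)"] ib by simp
  qed
  show "fin_dim (fam I V)" using fin_dimI[OF subspace_fam fS span] s by blast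
  have "card S = (\<Sum>v\<in>S. 1)" by simp
  also have "\<dots> = (\<Sum>i\<in>I. cfun.dim (V i))"
    unfolding split using B(5) by simp
  finally show "cfun.dim (fam I V) = (\<Sum>i\<in>I. cfun.dim (V i))"
    using cfun.dim_unique[OF sub span ind] by simp
qed

section \<open>Tensor products\<close>

definition tensor :: "('x \<Rightarrow> complex) set \<Rightarrow> ('y \<Rightarrow> complex) set \<Rightarrow> ('x \<times> 'y \<Rightarrow> complex) set"
  where "tensor U V = cfun.span {pure_tensor u v |u v. u \<in> U \<and> v \<in> V}"

lemma linear_between_scale':
  "linear_between V W T \<Longrightarrow> u \<in> V \<Longrightarrow> T (\<lambda>x. u x * c) = (\<lambda>x. T u x * c)"
  using linear_between_scale[of V W T u c] by (simp add: mult.commute)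

definition map_left ::
    "(('x \<Rightarrow> complex) \<Rightarrow> ('z \<Rightarrow> complex)) \<Rightarrow> ('x \<times> 'y \<Rightarrow> complex) \<Rightarrow> ('z \<times> 'y \<Rightarrow> complex)"
  where "map_left A w = (\<lambda>(x, y). A (\<lambda>x'. w (x', y)) x)"

definition map_right ::
    "(('y \<Rightarrow> complex) \<Rightarrow> ('z \<Rightarrow> complex)) \<Rightarrow> ('x \<times> 'y \<Rightarrow> complex) \<Rightarrow> ('x \<times> 'z \<Rightarrow> complex)"
  where "map_right A w = (\<lambda>(x, y). A (\<lambda>y'. w (x, y')) y)"

lemma outer_tensor_simps:
  "vs (outer_tensor R S) = tensor (vs R) (vs S)"
  "act (outer_tensor R S) (g, h) w = map_right (act S h) (map_left (act R g) w)"
  by (simp_all add: outer_tensor_def tensor_def map_left_def map_right_def)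

lemma subspace_tensor: "cfun.subspace (tensor U V)"
  by (simp add: tensor_def)

lemma pure_tensor_in: "u \<in> U \<Longrightarrow> v \<in> V \<Longrightarrow> pure_tensor u v \<in> tensor U V"
  unfolding tensor_def by (rule cfun.span_base) blast

lemma tensor_induct [consumes 1, case_names zero step]:
  assumes "w \<in> tensor U V" "P (\<lambda>x. 0)"
    "\<And>c u v w. u \<in> U \<Longrightarrow> v \<in> V \<Longrightarrow> w \<in> tensor U V \<Longrightarrow> P w
      \<Longrightarrow> P (\<lambda>x. c * pure_tensor u v x + w x)"
  shows "P w"
  using assms(1) unfolding tensor_def
proof (induction rule: span_induct')
  case (step c a v)
  then show ?case using assms(3) unfolding tensor_def by blast
qed (rule assms(2))

lemma tensor_slices:
  assumes "w \<in> tensor U V" "cfun.subspace U" "cfun.subspace V"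
  shows "(\<lambda>x. w (x, y)) \<in> U" "(\<lambda>y. w (x, y)) \<in> V"
  using assms(1)
proof (induction rule: tensor_induct)
  case (step c u v w)
  { case 1
    show ?case
      using subspace_lincomb[OF assms(2) step(1,4), of "c * v y"]
      by (simp add: pure_tensor_def algebra_simps) }
  { case 2
    show ?case
      using subspace_lincomb[OF assms(3) step(2,5), of "c * u x"]
      by (simp add: pure_tensor_def algebra_simps) }
qed (use assms subspace_0 in auto)

lemma tensor_mono: "U \<subseteq> U' \<Longrightarrow> tensor U V \<subseteq> tensor U' V"
  unfolding tensor_def by (rule cfun.span_mono) blast

text \<open>Gaussian elimination on a finite spanning set of \<open>U\<close>: splitting off one
  pure tensor leaves a function whose slices in the first variable lie in the span of a smaller
  set.\<close>

lemma tensorI: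
  fixes U :: "('x \<Rightarrow> complex) set" and V :: "('y \<Rightarrow> complex) set"
  assumes U: "fin_dim U" and V: "cfun.subspace V"
    and "\<And>y. (\<lambda>x. w (x, y)) \<in> U" "\<And>x. (\<lambda>y. w (x, y)) \<in> V"
  shows "w \<in> tensor U V"
proof -
  have "w \<in> tensor (cfun.span S) V"
    if "finite S" "\<And>y. (\<lambda>x. w (x, y)) \<in> cfun.span S" "\<And>x. (\<lambda>y. w (x, y)) \<in> V"
    for S :: "('x \<Rightarrow> complex) set" and w :: "'x \<times> 'y \<Rightarrow> complex"
    using that
  proof (induction "card S" arbitrary: S w rule: less_induct)
    case less
    show ?case
    proof (cases "\<forall>b\<in>S. b = (\<lambda>x. 0)")
      case True
      have "u = (\<lambda>x. 0)" if "u \<in> cfun.span S" for u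
        using that by (induction rule: span_induct') (use True in auto)
      then have "w = (\<lambda>x. 0)" using less.prems(2) by (fastforce simp: fun_eq_iff)
      then show ?thesis using subspace_0[OF subspace_tensor] by simp
    next
      case False
      then obtain b x0 where b: "b \<in> S" "b x0 \<noteq> 0" by (auto simp: fun_eq_iff)
      \<comment> \<open>Elimination of the coordinate \<open>x0\<close> with pivot \<open>b\<close>:
        \<open>L a\<close> vanishes at \<open>x0\<close>, and \<open>L b\<close> is zero, so that
        \<open>b\<close> drops out of the spanning set.\<close>
      define L where "L a = (\<lambda>x. a x - a x0 / b x0 * b x)" for a :: "'x \<Rightarrow> complex"
      define S' where "S' = L ` (S - {b})"
      have "card S' < card S"
        unfolding S'_def using less.prems(1) b(1)
        by (meson card_Diff1_less card_image_le finite_Diff le_less_trans)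
      have fS': "finite S'" unfolding S'_def using less.prems(1) by simp
      have LS: "L a \<in> cfun.span S'" if "a \<in> cfun.span S" for a
        using that
      proof (induction rule: span_induct')
        case zero
        then show ?case using subspace_0[OF cfun.subspace_span] by (simp add: L_def)
      next
        case (step c a v)
        have "L a \<in> cfun.span S'"
        proof (cases "a = b")
          case True
          then have "L a = (\<lambda>x. 0)" using b by (simp add: L_def)
          then show ?thesis using subspace_0[OF cfun.subspace_span] by simp
        next
          case False
          then have "L a \<in> S'" using step(1) by (simp add: S'_def)
          then show ?thesis by (rule cfun.span_base)
        qed
        moreover have "L (\<lambda>x. c * a x + v x) = (\<lambda>x. c * L a x + L v x)"
          by (simp add: L_def algebra_simps add_divide_distrib)
        ultimately show ?case using subspace_lincomb[OF cfun.subspace_span] step by simp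
      qed
      have S'S: "cfun.span S' \<subseteq> cfun.span S"
      proof (rule cfun.span_minimal)
        have "L a \<in> cfun.span S" if "a \<in> S" for a
          unfolding L_def using that b(1)
          by (intro subspace_diff[OF cfun.subspace_span] subspace_scale[OF cfun.subspace_span]
            cfun.span_base)
        then show "S' \<subseteq> cfun.span S" by (auto simp: S'_def)
      qed simp
      \<comment> \<open>The elimination \<open>L\<close> applied to all slices of \<open>w\<close>
        at once. What is subtracted is the pure tensor of \<open>b\<close> and the slice of
        \<open>w\<close> at \<open>x0\<close>, up to the factor 1 / b(x0).\<close>
      define w' where "w' = (\<lambda>(x, y). w (x, y) - b x / b x0 * w (x0, y))"
      have "w' \<in> tensor (cfun.span S') V"
      proof (rule less.hyps[OF \<open>card S' < card S\<close> fS'])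
        fix y
        have "(\<lambda>x. w' (x, y)) = L (\<lambda>x. w (x, y))" by (simp add: w'_def L_def mult_ac)
        then show "(\<lambda>x. w' (x, y)) \<in> cfun.span S'" using LS[OF less.prems(2)] by simp
      next
        fix x
        show "(\<lambda>y. w' (x, y)) \<in> V"
          using subspace_diff[OF V less.prems(3) subspace_scale[OF V less.prems(3), of "b x / b x0"]]
          by (simp add: w'_def)
      qed
      then have "w' \<in> tensor (cfun.span S) V"
        using tensor_mono[OF S'S] by blast
      moreover have "w = (\<lambda>z. (1 / b x0) * pure_tensor b (\<lambda>y. w (x0, y)) z + w' z)"
        by (auto simp: w'_def pure_tensor_def)
      moreover have "pure_tensor b (\<lambda>y. w (x0, y)) \<in> tensor (cfun.span S) V"
        by (rule pure_tensor_in[OF cfun.span_base[OF b(1)] less.prems(3)])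
      ultimately show ?thesis
        using subspace_lincomb[OF subspace_tensor, of "pure_tensor b (\<lambda>y. w (x0, y))" "cfun.span S" V w' "1 / b x0"]
        by simp
    qed
  qed
  moreover obtain S where "finite S" "cfun.span S = U" using U by (auto simp: fin_dim_def)
  ultimately show ?thesis using assms(3,4) by metis
qed

text \<open>Turns membership in a tensor product into a condition on slices, so that maps on tensor
  products can be given by formulas in the variables instead of on pure tensors.\<close>

lemma tensor_iff:
  assumes "fin_dim U" "cfun.subspace V"
  shows "w \<in> tensor U V \<longleftrightarrow> (\<forall>y. (\<lambda>x. w (x, y)) \<in> U) \<and> (\<forall>x. (\<lambda>y. w (x, y)) \<in> V)"
  using tensorI[OF assms] tensor_slices[OF _ fin_dimD[OF assms(1)] assms(2)] by blast

text \<open>A factor of functions on \<open>unit\<close> is one-dimensional and only changes the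
  index type; this is how the representations of B_1 and S_1 enter.\<close>

lemma tensor_UNIV_unit:
  assumes "cfun.subspace U"
  shows "w \<in> tensor U (UNIV :: (unit \<Rightarrow> complex) set) \<longleftrightarrow> (\<lambda>x. w (x, ())) \<in> U"
proof
  assume "(\<lambda>x. w (x, ())) \<in> U"
  then have "pure_tensor (\<lambda>x. w (x, ())) (\<lambda>_ :: unit. 1) \<in> tensor U UNIV"
    by (intro pure_tensor_in) auto
  moreover have "pure_tensor (\<lambda>x. w (x, ())) (\<lambda>_. 1) = w"
    by (auto simp: pure_tensor_def)
  ultimately show "w \<in> tensor U UNIV" by simp
qed (rule tensor_slices(1)[OF _ assms], auto)

section \<open>Linear maps applied to one tensor factor\<close>

lemma map_left_linear:
  assumes A: "linear_between U U' A" and U: "cfun.subspace U" and V: "cfun.subspace V"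
  shows "linear_between (tensor U V) (tensor U' V) (map_left A)"
proof (rule linear_betweenI)
  note slice = tensor_slices(1)[OF _ U V]
  show add: "map_left A (\<lambda>x. w x + w' x) = (\<lambda>x. map_left A w x + map_left A w' x)"
    if "w \<in> tensor U V" "w' \<in> tensor U V" for w w'
    using linear_between_add[OF A slice[OF that(1)] slice[OF that(2)]]
    by (auto simp: map_left_def)
  show scale: "map_left A (\<lambda>x. c * w x) = (\<lambda>x. c * map_left A w x)" if "w \<in> tensor U V" for c w
    using linear_between_scale[OF A slice[OF that(1)]] by (auto simp: map_left_def)
  show "map_left A w \<in> tensor U' V" if "w \<in> tensor U V" for w
    using that
  proof (induction rule: tensor_induct)
    case zero
    then show ?case
      using linear_between_zero[OF A U] subspace_0[OF subspace_tensor]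
      by (simp add: map_left_def)
  next
    case (step c u v w)
    have "map_left A (pure_tensor u v) = pure_tensor (A u) v"
      using linear_between_scale'[OF A step(1)] by (auto simp: map_left_def pure_tensor_def)
    then have "map_left A (\<lambda>x. c * pure_tensor u v x + w x)
        = (\<lambda>x. c * pure_tensor (A u) v x + map_left A w x)"
      using add[OF subspace_scale[OF subspace_tensor pure_tensor_in[OF step(1,2)]] step(3)]
        scale[OF pure_tensor_in[OF step(1,2)]] by simp
    then show ?case
      using subspace_lincomb[OF subspace_tensor pure_tensor_in step(4)] step linear_between_in[OF A]
      by simp
  qed
qed

text \<open>Reduces statements about the second factor to the first one, and later realises the
  exchange of the factors of an outer tensor product.\<close>

definition flip :: "('x \<times> 'y \<Rightarrow> complex) \<Rightarrow> ('y \<times> 'x \<Rightarrow> complex)"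
  where "flip w = (\<lambda>(y, x). w (x, y))"

lemma flip_flip [simp]: "flip (flip w) = w"
  by (auto simp: flip_def)

lemma flip_tensor: "w \<in> tensor U V \<Longrightarrow> flip w \<in> tensor V U"
proof (induction rule: tensor_induct)
  case zero
  then show ?case using subspace_0[OF subspace_tensor] by (simp add: flip_def)
next
  case (step c u v w)
  have "flip (\<lambda>x. c * pure_tensor u v x + w x) = (\<lambda>x. c * pure_tensor v u x + flip w x)"
    by (auto simp: flip_def pure_tensor_def)
  then show ?case using subspace_lincomb[OF subspace_tensor pure_tensor_in step(4)] step by simp
qed

lemma map_right_eq_flip: "map_right A w = flip (map_left A (flip w))"
  by (auto simp: map_right_def map_left_def flip_def)

lemma map_right_linear:
  assumes A: "linear_between V V' A" and U: "cfun.subspace U" and V: "cfun.subspace V"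
  shows "linear_between (tensor U V) (tensor U V') (map_right A)"
proof -
  have "linear_between (tensor U V) (tensor V U) flip"
    by (rule linear_betweenI) (auto simp: flip_tensor, auto simp: flip_def)
  moreover have "linear_between (tensor V' U) (tensor U V') flip"
    by (rule linear_betweenI) (auto simp: flip_tensor, auto simp: flip_def)
  ultimately show ?thesis
    using linear_between_comp[OF linear_between_comp[OF _ map_left_linear[OF A V U]], of "tensor U V" flip]
    by (simp add: map_right_eq_flip[abs_def])
qed

text \<open>Both orders are linear in \<open>w\<close> and send the pure tensor of \<open>u\<close>
  and \<open>v\<close> to that of \<open>A u\<close> and \<open>C v\<close>. The definition of
  \<open>outer_tensor\<close> fixes one order, hence the need to exchange them.\<close>

lemma map_left_right_commute:
  assumes A: "linear_between U U' A" and C: "linear_between V V' C"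
    and U: "cfun.subspace U" and V: "cfun.subspace V" and U': "cfun.subspace U'" and V': "cfun.subspace V'"
    and w: "w \<in> tensor U V"
  shows "map_left A (map_right C w) = map_right C (map_left A w)"
  using w
proof (induction rule: tensor_induct)
  case zero
  then show ?case
    using linear_between_zero[OF A U] linear_between_zero[OF C V]
    by (simp add: map_left_def map_right_def)
next
  case (step c u v w)
  let ?L = "\<lambda>w. map_left A (map_right C w)" and ?R = "\<lambda>w. map_right C (map_left A w)"
  have L: "linear_between (tensor U V) (tensor U' V') ?L"
    by (rule linear_between_comp[OF map_right_linear[OF C U V] map_left_linear[OF A U V']])
  have R: "linear_between (tensor U V) (tensor U' V') ?R"
    by (rule linear_between_comp[OF map_left_linear[OF A U V] map_right_linear[OF C U' V]])
  have "?L (pure_tensor u v) = pure_tensor (A u) (C v)"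
    using linear_between_scale'[OF A step(1)] linear_between_scale[OF C step(2)]
    by (auto simp: map_left_def map_right_def pure_tensor_def)
  moreover have "?R (pure_tensor u v) = pure_tensor (A u) (C v)"
    using linear_between_scale'[OF A step(1)] linear_between_scale[OF C step(2)]
    by (auto simp: map_left_def map_right_def pure_tensor_def)
  moreover note p = pure_tensor_in[OF step(1,2)]
  ultimately show ?case
    using linear_between_add[OF L subspace_scale[OF subspace_tensor p] step(3)]
      linear_between_add[OF R subspace_scale[OF subspace_tensor p] step(3)]
      linear_between_scale[OF L p] linear_between_scale[OF R p] step(4) by simp
qed

text \<open>Pure tensors of spanning vectors span, by linearity in one factor at a time.\<close>

lemma fin_dim_tensor:
  assumes U: "fin_dim U" and V: "fin_dim V"
  shows "fin_dim (tensor U V)"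
proof -
  obtain S T where S: "finite S" "cfun.span S = U" and T: "finite T" "cfun.span T = V"
    using U V by (auto simp: fin_dim_def)
  let ?Q = "(\<lambda>(u, v). pure_tensor u v) ` (S \<times> T)"
  have left: "pure_tensor u v \<in> cfun.span ?Q" if "u \<in> S" "v \<in> cfun.span T" for u v
    using that(2)
  proof (induction rule: span_induct')
    case zero
    then show ?case using subspace_0[OF cfun.subspace_span] by (simp add: pure_tensor_def)
  next
    case (step c a v)
    have "pure_tensor u (\<lambda>x. c * a x + v x) = (\<lambda>z. c * pure_tensor u a z + pure_tensor u v z)"
      by (auto simp: pure_tensor_def algebra_simps)
    moreover have "pure_tensor u a \<in> cfun.span ?Q"
      using that(1) step(1) by (intro cfun.span_base) auto
    ultimately show ?case using subspace_lincomb[OF cfun.subspace_span _ step(3)] by simp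
  qed
  have "pure_tensor u v \<in> cfun.span ?Q" if "u \<in> cfun.span S" "v \<in> cfun.span T" for u v
    using that(1)
  proof (induction rule: span_induct')
    case zero
    then show ?case using subspace_0[OF cfun.subspace_span] by (simp add: pure_tensor_def)
  next
    case (step c a w)
    have "pure_tensor (\<lambda>x. c * a x + w x) v = (\<lambda>z. c * pure_tensor a v z + pure_tensor w v z)"
      by (auto simp: pure_tensor_def algebra_simps)
    then show ?case using subspace_lincomb[OF cfun.subspace_span left[OF step(1) that(2)] step(3)] by simp
  qed
  then have "tensor U V \<subseteq> cfun.span ?Q"
    unfolding tensor_def using S(2) T(2) by (intro cfun.span_minimal subsetI) (blast, simp)
  then show ?thesis using fin_dimI[OF subspace_tensor finite_imageI[OF finite_cartesian_product[OF S(1) T(1)]]] by blast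
qed

section \<open>Representations and their isomorphisms\<close>

lemma fin_dim_subset:
  assumes "cfun.subspace V" "V \<subseteq> W" "fin_dim W"
  shows "fin_dim V"
  using fin_dimI[OF assms(1)] assms(2,3) by (auto simp: fin_dim_def)

lemma group_rep_iff:
  "group_rep G R \<longleftrightarrow> group G \<and> fin_dim (vs R) \<and>
    (\<forall>g\<in>carrier G. linear_between (vs R) (vs R) (act R g)) \<and>
    (\<forall>u\<in>vs R. act R \<one>\<^bsub>G\<^esub> u = u) \<and>
    (\<forall>g\<in>carrier G. \<forall>h\<in>carrier G. \<forall>u\<in>vs R. act R (g \<otimes>\<^bsub>G\<^esub> h) u = act R g (act R h u))"
  by (auto simp: group_rep_def fin_dim_def)

lemma group_repD:
  assumes "group_rep G R"
  shows "group G" "fin_dim (vs R)" "cfun.subspace (vs R)"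
    "g \<in> carrier G \<Longrightarrow> linear_between (vs R) (vs R) (act R g)"
    "u \<in> vs R \<Longrightarrow> act R \<one>\<^bsub>G\<^esub> u = u"
    "g \<in> carrier G \<Longrightarrow> h \<in> carrier G \<Longrightarrow> u \<in> vs R \<Longrightarrow> act R (g \<otimes>\<^bsub>G\<^esub> h) u = act R g (act R h u)"
    "g \<in> carrier G \<Longrightarrow> u \<in> vs R \<Longrightarrow> act R g u \<in> vs R"
  using assms linear_between_in[of "vs R" "vs R"] by (auto simp: group_rep_iff fin_dimD)

text \<open>Equivalence of representations of two groups whose elements are matched by
  \<open>\<theta>\<close>. Permuting the factors of a product group produces such
  equivalences.\<close>

definition rep_iso_along ::
    "('g, 'b) monoid_scheme \<Rightarrow> ('h, 'c) monoid_scheme \<Rightarrow> ('g \<Rightarrow> 'h) \<Rightarrow> ('g, 'x) rep \<Rightarrow> ('h, 'y) rep \<Rightarrow> bool"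
  where "rep_iso_along G H \<theta> R S \<longleftrightarrow>
    group_rep G R \<and> group_rep H S \<and> \<theta> ` carrier G = carrier H \<and>
    (\<exists>T. linear_between (vs R) (vs S) T \<and> bij_betw T (vs R) (vs S) \<and>
         (\<forall>g\<in>carrier G. \<forall>u\<in>vs R. T (act R g u) = act S (\<theta> g) (T u)))"

lemma rep_iso_eq_along: "rep_iso G R S \<longleftrightarrow> rep_iso_along G G (\<lambda>g. g) R S"
  by (simp add: rep_iso_def rep_iso_along_def)

lemma rep_iso_along_trans:
  assumes "rep_iso_along G H \<theta> R S" "rep_iso_along H K \<eta> S Q"
  shows "rep_iso_along G K (\<lambda>g. \<eta> (\<theta> g)) R Q"
proof -
  obtain T where T: "linear_between (vs R) (vs S) T" "bij_betw T (vs R) (vs S)"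
    "\<And>g u. g \<in> carrier G \<Longrightarrow> u \<in> vs R \<Longrightarrow> T (act R g u) = act S (\<theta> g) (T u)"
    using assms(1) by (auto simp: rep_iso_along_def)
  obtain T' where T': "linear_between (vs S) (vs Q) T'" "bij_betw T' (vs S) (vs Q)"
    "\<And>g u. g \<in> carrier H \<Longrightarrow> u \<in> vs S \<Longrightarrow> T' (act S g u) = act Q (\<eta> g) (T' u)"
    using assms(2) by (auto simp: rep_iso_along_def)
  have "linear_between (vs R) (vs Q) (\<lambda>u. T' (T u))" by (rule linear_between_comp[OF T(1) T'(1)])
  moreover have "bij_betw (\<lambda>u. T' (T u)) (vs R) (vs Q)"
    using bij_betw_trans[OF T(2) T'(2)] by (simp add: o_def)
  moreover have "T' (T (act R g u)) = act Q (\<eta> (\<theta> g)) (T' (T u))" if "g \<in> carrier G" "u \<in> vs R" for g u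
    using T(3)[OF that] T'(3)[of "\<theta> g" "T u"] that linear_between_in[OF T(1)] assms(1)
    by (auto simp: rep_iso_along_def)
  moreover have "(\<lambda>g. \<eta> (\<theta> g)) ` carrier G = carrier K"
    using assms image_image[of \<eta> \<theta> "carrier G"] unfolding rep_iso_along_def by simp
  ultimately show ?thesis
    using assms unfolding rep_iso_along_def by (intro conjI exI[of _ "\<lambda>u. T' (T u)"]) auto
qed

lemma rep_iso_trans [trans]: "rep_iso G R S \<Longrightarrow> rep_iso G S Q \<Longrightarrow> rep_iso G R Q"
  unfolding rep_iso_eq_along by (drule (1) rep_iso_along_trans) simp

lemma rep_iso_sym:
  assumes "rep_iso G R S"
  shows "rep_iso G S R"
proof -
  obtain T where T: "linear_between (vs R) (vs S) T" "bij_betw T (vs R) (vs S)"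
    "\<And>g u. g \<in> carrier G \<Longrightarrow> u \<in> vs R \<Longrightarrow> T (act R g u) = act S g (T u)"
    and R: "group_rep G R" and S: "group_rep G S"
    using assms by (auto simp: rep_iso_def)
  let ?T = "inv_into (vs R) T"
  have "linear_between (vs S) (vs R) ?T"
    by (rule linear_between_inv_into[OF T(1,2) group_repD(3)[OF R]])
  moreover have "bij_betw ?T (vs S) (vs R)" using bij_betw_inv_into[OF T(2)] .
  moreover have "?T (act S g v) = act R g (?T v)" if "g \<in> carrier G" "v \<in> vs S" for g v
  proof -
    obtain u where u: "u \<in> vs R" "v = T u" using T(2) \<open>v \<in> vs S\<close> by (auto simp: bij_betw_def)
    have inv: "?T (T w) = w" if "w \<in> vs R" for w using that T(2) by (simp add: bij_betw_def)
    show ?thesis using T(3)[OF that(1) u(1)] u inv group_repD(7)[OF R that(1) u(1)] by metis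
  qed
  ultimately show ?thesis using R S unfolding rep_iso_def by blast
qed

text \<open>Transport of structure: on \<open>vs S\<close> the action of \<open>g\<close> is the
  action on \<open>vs R\<close> conjugated by \<open>T\<close>, so the axioms for \<open>S\<close>
  follow from those for \<open>R\<close>. Only the source of an isomorphism has to be checked to be
  a representation.\<close>

lemma rep_isoI:
  assumes R: "group_rep G R" and T: "linear_between (vs R) (vs S) T" "bij_betw T (vs R) (vs S)"
    and eq: "\<And>g u. g \<in> carrier G \<Longrightarrow> u \<in> vs R \<Longrightarrow> T (act R g u) = act S g (T u)"
  shows "rep_iso G R S"
proof -
  let ?T = "inv_into (vs R) T"
  have im: "T ` vs R = vs S" using T(2) by (simp add: bij_betw_def)
  have T': "linear_between (vs S) (vs R) ?T"
    by (rule linear_between_inv_into[OF T group_repD(3)[OF R]])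
  have TT': "T (?T v) = v" "?T v \<in> vs R" if "v \<in> vs S" for v
    using that T(2) bij_betw_inv_into_right bij_betw_apply[OF bij_betw_inv_into] by metis+
  have act: "act S g v = T (act R g (?T v))" if "g \<in> carrier G" "v \<in> vs S" for g v
    using eq[OF that(1) TT'(2)[OF that(2)]] TT'(1)[OF that(2)] by simp
  have "group_rep G S"
    unfolding group_rep_iff
  proof (intro conjI ballI)
    show "group G" using group_repD(1)[OF R] .
    show "fin_dim (vs S)" using fin_dim_image[OF T(1) group_repD(2)[OF R]] im by simp
    show "linear_between (vs S) (vs S) (act S g)" if g: "g \<in> carrier G" for g
    proof -
      have "linear_between (vs S) (vs S) (\<lambda>v. T (act R g (?T v)))"
        by (intro linear_between_comp[OF _ T(1)] linear_between_comp[OF T'] group_repD(4)[OF R g])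
      then show ?thesis
        using act[OF g] group_repD(3)[OF R] subspace_image[OF T(1) group_repD(3)[OF R]]
        by (auto simp: linear_between_def im cfun.subspace_def)
    qed
    show "act S \<one>\<^bsub>G\<^esub> v = v" if "v \<in> vs S" for v
      using act[OF _ that] TT'[OF that] group_repD(1,5)[OF R] by (simp add: group.is_monoid)
    show "act S (g \<otimes>\<^bsub>G\<^esub> h) v = act S g (act S h v)"
      if g: "g \<in> carrier G" and h: "h \<in> carrier G" and v: "v \<in> vs S" for g h v
    proof -
      have "act S (g \<otimes>\<^bsub>G\<^esub> h) v = T (act R g (act R h (?T v)))"
        using act[OF _ v] g h group_repD(6)[OF R g h TT'(2)[OF v]] group_repD(1)[OF R]
        by (simp add: group.is_monoid monoid.m_closed)
      also have "\<dots> = act S g (T (act R h (?T v)))"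
        using eq[OF g group_repD(7)[OF R h TT'(2)[OF v]]] .
      finally show ?thesis using act[OF h v] by simp
    qed
  qed
  then show ?thesis using assms unfolding rep_iso_def by blast
qed

lemma rep_iso_refl: "group_rep G R \<Longrightarrow> rep_iso G R R"
  by (rule rep_isoI[where T = "\<lambda>u. u"]) (auto intro!: linear_betweenI simp: bij_betw_def)

subsection \<open>Direct sums and outer tensor products\<close>

lemma direct_sum_simps:
  "vs (direct_sum I R) = fam I (\<lambda>i. vs (R i))"
  "act (direct_sum I R) g u (i, x) = (if i \<in> I then act (R i) g (\<lambda>x'. u (i, x')) x else 0)"
  by (simp_all add: direct_sum_def fam_def)

lemma group_rep_direct_sum:
  assumes G: "group G" and I: "finite I" and R: "\<And>i. i \<in> I \<Longrightarrow> group_rep G (R i)"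
  shows "group_rep G (direct_sum I R)"
  unfolding group_rep_iff
proof (intro conjI ballI)
  have slice: "(\<lambda>x. u (i, x)) \<in> vs (R i)" if "u \<in> vs (direct_sum I R)" "i \<in> I" for u i
    using that by (auto simp: direct_sum_simps fam_def)
  show "fin_dim (vs (direct_sum I R))"
    using fin_dim_fam[OF I, of "\<lambda>i. vs (R i)"] group_repD(2)[OF R] by (simp add: direct_sum_simps)
  show "linear_between (vs (direct_sum I R)) (vs (direct_sum I R)) (act (direct_sum I R) g)"
    if g: "g \<in> carrier G" for g
  proof (rule linear_betweenI)
    fix u v c assume u: "u \<in> vs (direct_sum I R)" and v: "v \<in> vs (direct_sum I R)"
    show "act (direct_sum I R) g u \<in> vs (direct_sum I R)"
      using group_repD(7)[OF R g slice[OF u]]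
      by (auto simp: direct_sum_simps fam_def cong: if_cong)
    show "act (direct_sum I R) g (\<lambda>x. u x + v x) =
        (\<lambda>x. act (direct_sum I R) g u x + act (direct_sum I R) g v x)"
      using linear_between_add[OF group_repD(4)[OF R g] slice[OF u] slice[OF v]]
      by (auto simp: direct_sum_simps)
    show "act (direct_sum I R) g (\<lambda>x. c * u x) = (\<lambda>x. c * act (direct_sum I R) g u x)"
      using linear_between_scale[OF group_repD(4)[OF R g] slice[OF u]]
      by (auto simp: direct_sum_simps)
  qed
  show "act (direct_sum I R) \<one>\<^bsub>G\<^esub> u = u" if "u \<in> vs (direct_sum I R)" for u
    using group_repD(5)[OF R slice[OF that]] that by (auto simp: direct_sum_simps fam_def)
  show "act (direct_sum I R) (g \<otimes>\<^bsub>G\<^esub> h) u = act (direct_sum I R) g (act (direct_sum I R) h u)"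
    if "g \<in> carrier G" "h \<in> carrier G" "u \<in> vs (direct_sum I R)" for g h u
    using group_repD(6)[OF R that(1,2) slice[OF that(3)]] by (auto simp: direct_sum_simps)
qed (rule G)

lemma rep_iso_direct_sum:
  assumes G: "group G" and I: "finite I" and iso: "\<And>i. i \<in> I \<Longrightarrow> rep_iso G (R i) (S i)"
  shows "rep_iso G (direct_sum I R) (direct_sum I S)"
proof -
  have "\<forall>i\<in>I. \<exists>T. linear_between (vs (R i)) (vs (S i)) T \<and> bij_betw T (vs (R i)) (vs (S i)) \<and>
      (\<forall>g\<in>carrier G. \<forall>u\<in>vs (R i). T (act (R i) g u) = act (S i) g (T u))"
    using iso by (auto simp: rep_iso_def)
  then obtain T where T: "\<And>i. i \<in> I \<Longrightarrow> linear_between (vs (R i)) (vs (S i)) (T i)"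
    "\<And>i. i \<in> I \<Longrightarrow> bij_betw (T i) (vs (R i)) (vs (S i))"
    "\<And>i g u. i \<in> I \<Longrightarrow> g \<in> carrier G \<Longrightarrow> u \<in> vs (R i) \<Longrightarrow> T i (act (R i) g u) = act (S i) g (T i u)"
    by metis
  have R: "group_rep G (R i)" if "i \<in> I" for i using iso[OF that] by (simp add: rep_iso_def)
  have slice: "(\<lambda>x. u (i, x)) \<in> vs (R i)" if "u \<in> vs (direct_sum I R)" "i \<in> I" for u i
    using that by (auto simp: direct_sum_simps fam_def)
  have slice': "(\<lambda>x. u (i, x)) \<in> vs (S i)" if "u \<in> vs (direct_sum I S)" "i \<in> I" for u i
    using that by (auto simp: direct_sum_simps fam_def)
  let ?F = "\<lambda>u (i, x). if i \<in> I then T i (\<lambda>x'. u (i, x')) x else 0"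
  let ?F' = "\<lambda>u (i, x). if i \<in> I then inv_into (vs (R i)) (T i) (\<lambda>x'. u (i, x')) x else 0"
  have inv: "inv_into (vs (R i)) (T i) v \<in> vs (R i)" "T i (inv_into (vs (R i)) (T i) v) = v"
    if "i \<in> I" "v \<in> vs (S i)" for i v
    using T(2)[OF that(1)] that(2) bij_betw_inv_into_right bij_betw_apply[OF bij_betw_inv_into]
    by metis+
  have inv': "inv_into (vs (R i)) (T i) (T i v) = v" if "i \<in> I" "v \<in> vs (R i)" for i v
    using T(2)[OF that(1)] that(2) by (auto simp: bij_betw_def)
  have F: "?F u \<in> vs (direct_sum I S)" if "u \<in> vs (direct_sum I R)" for u
    using linear_between_in[OF T(1) slice[OF that]] by (auto simp: direct_sum_simps fam_def)
  have F': "?F' u \<in> vs (direct_sum I R)" if "u \<in> vs (direct_sum I S)" for u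
    using inv(1)[OF _ slice'[OF that]] by (auto simp: direct_sum_simps fam_def)
  show ?thesis
  proof (rule rep_isoI[where T = ?F])
    show "group_rep G (direct_sum I R)" using group_rep_direct_sum[OF G I R] .
    show "linear_between (vs (direct_sum I R)) (vs (direct_sum I S)) ?F"
    proof (rule linear_betweenI)
      fix u v c assume u: "u \<in> vs (direct_sum I R)" and v: "v \<in> vs (direct_sum I R)"
      show "?F u \<in> vs (direct_sum I S)" using F[OF u] .
      show "?F (\<lambda>x. u x + v x) = (\<lambda>x. ?F u x + ?F v x)"
        using linear_between_add[OF T(1) slice[OF u] slice[OF v]] by auto
      show "?F (\<lambda>x. c * u x) = (\<lambda>x. c * ?F u x)"
        using linear_between_scale[OF T(1) slice[OF u]] by auto
    qed
    show "bij_betw ?F (vs (direct_sum I R)) (vs (direct_sum I S))"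
    proof (rule bij_betw_byWitness[where f' = ?F'])
      show "\<forall>u\<in>vs (direct_sum I R). ?F' (?F u) = u"
        using inv'[OF _ slice] by (fastforce simp: direct_sum_simps fam_def)
      show "\<forall>u\<in>vs (direct_sum I S). ?F (?F' u) = u"
        using inv(2)[OF _ slice'] by (fastforce simp: direct_sum_simps fam_def)
    qed (use F F' in blast)+
    show "?F (act (direct_sum I R) g u) = act (direct_sum I S) g (?F u)"
      if "g \<in> carrier G" "u \<in> vs (direct_sum I R)" for g u
      using T(3)[OF _ that(1) slice[OF that(2)]] by (auto simp: direct_sum_simps)
  qed
qed

lemma rep_plus_simps:
  "vs (rep_plus R S) = {u. u \<circ> Inl \<in> vs R \<and> u \<circ> Inr \<in> vs S}"
  "act (rep_plus R S) g u = case_sum (act R g (u \<circ> Inl)) (act S g (u \<circ> Inr))"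
  by (simp_all add: rep_plus_def)

lemma case_sum_comp [simp]: "case_sum f g \<circ> Inl = f" "case_sum f g \<circ> Inr = g"
  by auto

lemma case_sum_Inl_Inr [simp]: "case_sum (u \<circ> Inl) (u \<circ> Inr) = u"
  by (auto simp: fun_eq_iff split: sum.split)

text \<open>In its application the first hypothesis is supplied by an isomorphism that has this sum
  as its target.\<close>

lemma rep_iso_plus:
  assumes "group_rep G (rep_plus R S)" "rep_iso G R R'" "rep_iso G S S'"
  shows "rep_iso G (rep_plus R S) (rep_plus R' S')"
proof -
  obtain T where T: "linear_between (vs R) (vs R') T" "bij_betw T (vs R) (vs R')"
    "\<And>g u. g \<in> carrier G \<Longrightarrow> u \<in> vs R \<Longrightarrow> T (act R g u) = act R' g (T u)"
    using assms(2) by (auto simp: rep_iso_def)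
  obtain Q where Q: "linear_between (vs S) (vs S') Q" "bij_betw Q (vs S) (vs S')"
    "\<And>g u. g \<in> carrier G \<Longrightarrow> u \<in> vs S \<Longrightarrow> Q (act S g u) = act S' g (Q u)"
    using assms(3) by (auto simp: rep_iso_def)
  let ?F = "\<lambda>u. case_sum (T (u \<circ> Inl)) (Q (u \<circ> Inr))"
  let ?F' = "\<lambda>u. case_sum (inv_into (vs R) T (u \<circ> Inl)) (inv_into (vs S) Q (u \<circ> Inr))"
  show ?thesis
  proof (rule rep_isoI[where T = ?F])
    show "linear_between (vs (rep_plus R S)) (vs (rep_plus R' S')) ?F"
    proof (rule linear_betweenI)
      fix u v c assume u: "u \<in> vs (rep_plus R S)" and v: "v \<in> vs (rep_plus R S)"
      then have uv: "u \<circ> Inl \<in> vs R" "u \<circ> Inr \<in> vs S" "v \<circ> Inl \<in> vs R" "v \<circ> Inr \<in> vs S"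
        by (auto simp: rep_plus_simps)
      show "?F u \<in> vs (rep_plus R' S')"
        using linear_between_in[OF T(1) uv(1)] linear_between_in[OF Q(1) uv(2)]
        by (simp add: rep_plus_simps)
      show "?F (\<lambda>x. u x + v x) = (\<lambda>x. ?F u x + ?F v x)"
        using linear_between_add[OF T(1) uv(1,3)] linear_between_add[OF Q(1) uv(2,4)]
        by (auto simp: fun_eq_iff o_def split: sum.split)
      show "?F (\<lambda>x. c * u x) = (\<lambda>x. c * ?F u x)"
        using linear_between_scale[OF T(1) uv(1)] linear_between_scale[OF Q(1) uv(2)]
        by (auto simp: fun_eq_iff o_def split: sum.split)
    qed
    show "bij_betw ?F (vs (rep_plus R S)) (vs (rep_plus R' S'))"
    proof (rule bij_betw_byWitness[where f' = ?F'])
      show "\<forall>u\<in>vs (rep_plus R S). ?F' (?F u) = u"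
        using T(2) Q(2) by (auto simp: rep_plus_simps bij_betw_def)
      show "\<forall>u\<in>vs (rep_plus R' S'). ?F (?F' u) = u"
        using bij_betw_inv_into_right[OF T(2)] bij_betw_inv_into_right[OF Q(2)]
        by (auto simp: rep_plus_simps)
      show "?F ` vs (rep_plus R S) \<subseteq> vs (rep_plus R' S')"
        using bij_betw_apply[OF T(2)] bij_betw_apply[OF Q(2)] by (auto simp: rep_plus_simps)
      show "?F' ` vs (rep_plus R' S') \<subseteq> vs (rep_plus R S)"
        using bij_betw_apply[OF bij_betw_inv_into[OF T(2)]]
          bij_betw_apply[OF bij_betw_inv_into[OF Q(2)]] by (auto simp: rep_plus_simps)
    qed
    show "?F (act (rep_plus R S) g u) = act (rep_plus R' S') g (?F u)"
      if "g \<in> carrier G" "u \<in> vs (rep_plus R S)" for g u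
      using T(3)[OF that(1)] Q(3)[OF that(1)] that(2) by (simp add: rep_plus_simps)
  qed (rule assms(1))
qed

lemma group_rep_outer_tensor:
  assumes R: "group_rep G R" and S: "group_rep H S"
  shows "group_rep (G \<times>\<times> H) (outer_tensor R S)"
proof -
  note R' = group_repD[OF R] and S' = group_repD[OF S]
  note sl = tensor_slices[OF _ R'(3) S'(3)]
  have lin: "linear_between (tensor (vs R) (vs S)) (tensor (vs R) (vs S))
      (act (outer_tensor R S) (g, h))" if "g \<in> carrier G" "h \<in> carrier H" for g h
    unfolding outer_tensor_simps
    by (intro linear_between_comp[OF map_left_linear map_right_linear] R' S' that)
  show ?thesis
    unfolding group_rep_iff
  proof (intro conjI ballI)
    show "group (G \<times>\<times> H)" using R'(1) S'(1) by (rule DirProd_group)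
    show "fin_dim (vs (outer_tensor R S))" 
      using fin_dim_tensor[OF R'(2) S'(2)] by (simp add: outer_tensor_simps)
    show "linear_between (vs (outer_tensor R S)) (vs (outer_tensor R S)) (act (outer_tensor R S) g)"
      if "g \<in> carrier (G \<times>\<times> H)" for g
      using that lin by (cases g) (auto simp: outer_tensor_simps(1))
    show "act (outer_tensor R S) \<one>\<^bsub>G \<times>\<times> H\<^esub> w = w" if w: "w \<in> vs (outer_tensor R S)" for w
      using R'(5)[OF sl(1)] S'(5)[OF sl(2)] w
      by (auto simp: outer_tensor_simps DirProd_def map_left_def map_right_def)
    show "act (outer_tensor R S) (g \<otimes>\<^bsub>G \<times>\<times> H\<^esub> h) w = act (outer_tensor R S) g (act (outer_tensor R S) h w)"
      if g: "g \<in> carrier (G \<times>\<times> H)" and h: "h \<in> carrier (G \<times>\<times> H)" and w: "w \<in> vs (outer_tensor R S)" for g h w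
    proof -
      obtain a b c d where gh: "g = (a, b)" "h = (c, d)" "a \<in> carrier G" "c \<in> carrier G" "b \<in> carrier H" "d \<in> carrier H"
        using g h by auto
      note w = w[unfolded outer_tensor_simps(1)]
      have 1: "map_left (act R (a \<otimes>\<^bsub>G\<^esub> c)) w = map_left (act R a) (map_left (act R c) w)"
        using R'(6)[OF gh(3,4) sl(1)[OF w]] by (auto simp: map_left_def)
      have cw: "map_left (act R c) w \<in> tensor (vs R) (vs S)"
        using linear_between_in[OF map_left_linear[OF R'(4)[OF gh(4)] R'(3) S'(3)] w] .
      have acw: "map_left (act R a) (map_left (act R c) w) \<in> tensor (vs R) (vs S)"
        using linear_between_in[OF map_left_linear[OF R'(4)[OF gh(3)] R'(3) S'(3)] cw] .
      have 2: "map_right (act S (b \<otimes>\<^bsub>H\<^esub> d)) (map_left (act R a) (map_left (act R c) w))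
          = map_right (act S b) (map_right (act S d) (map_left (act R a) (map_left (act R c) w)))"
        using S'(6)[OF gh(5,6) sl(2)[OF acw]] by (auto simp: map_right_def)
      \<comment> \<open>The action of a product (a, b) (c, d) applies both left maps before the
        right ones; composing the two actions applies \<open>d\<close> before \<open>a\<close>. This
        exchange reconciles them.\<close>
      have 3: "map_left (act R a) (map_right (act S d) (map_left (act R c) w)) =
          map_right (act S d) (map_left (act R a) (map_left (act R c) w))"
        by (rule map_left_right_commute[OF R'(4)[OF gh(3)] S'(4)[OF gh(6)] R'(3) S'(3) R'(3) S'(3) cw])
      show ?thesis by (simp add: gh outer_tensor_simps 1 2 3)
    qed
  qed
qed

lemma rep_iso_along_outer_left:
  assumes iso: "rep_iso_along G H \<theta> R R'" and S: "group_rep C S"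
  shows "rep_iso_along (G \<times>\<times> C) (H \<times>\<times> C) (\<lambda>(g, c). (\<theta> g, c)) (outer_tensor R S) (outer_tensor R' S)"
proof -
  obtain T where T: "linear_between (vs R) (vs R') T" "bij_betw T (vs R) (vs R')"
    "\<And>g u. g \<in> carrier G \<Longrightarrow> u \<in> vs R \<Longrightarrow> T (act R g u) = act R' (\<theta> g) (T u)"
    and R: "group_rep G R" and R': "group_rep H R'" and th: "\<theta> ` carrier G = carrier H"
    using iso by (auto simp: rep_iso_along_def)
  note R = R group_repD[OF R] and R' = R' group_repD[OF R'] and S = S group_repD[OF S]
  let ?T' = "inv_into (vs R) T"
  have T': "linear_between (vs R') (vs R) ?T'"
    by (rule linear_between_inv_into[OF T(1,2) R(4)])
  have left: "map_left T w \<in> tensor (vs R') (vs S)" if "w \<in> tensor (vs R) (vs S)" for w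
    using linear_between_in[OF map_left_linear[OF T(1) R(4) S(4)] that] .
  have left': "map_left ?T' w \<in> tensor (vs R) (vs S)" if "w \<in> tensor (vs R') (vs S)" for w
    using linear_between_in[OF map_left_linear[OF T' R'(4) S(4)] that] .
  have 1: "map_left ?T' (map_left T w) = w" if w: "w \<in> tensor (vs R) (vs S)" for w
  proof -
    have "?T' (T u) = u" if "u \<in> vs R" for u using that T(2) by (simp add: bij_betw_def)
    then show ?thesis using tensor_slices(1)[OF w R(4) S(4)] by (auto simp: map_left_def)
  qed
  have 2: "map_left T (map_left ?T' w) = w" if w: "w \<in> tensor (vs R') (vs S)" for w
  proof -
    have "T (?T' u) = u" if "u \<in> vs R'" for u using that T(2) by (simp add: bij_betw_def f_inv_into_f)
    then show ?thesis using tensor_slices(1)[OF w R'(4) S(4)] by (auto simp: map_left_def)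
  qed
  have "bij_betw (map_left T) (tensor (vs R) (vs S)) (tensor (vs R') (vs S))"
    by (rule bij_betw_byWitness[where f' = "map_left ?T'"]) (use 1 2 left left' in auto)
  moreover have "map_left T (act (outer_tensor R S) (g, c) w) = act (outer_tensor R' S) (\<theta> g, c) (map_left T w)"
    if g: "g \<in> carrier G" and c: "c \<in> carrier C" and w: "w \<in> tensor (vs R) (vs S)" for g c w
  proof -
    have gw: "map_left (act R g) w \<in> tensor (vs R) (vs S)"
      using linear_between_in[OF map_left_linear[OF R(5)[OF g] R(4) S(4)] w] .
    have "map_left T (map_left (act R g) w) = map_left (act R' (\<theta> g)) (map_left T w)"
      using T(3)[OF g tensor_slices(1)[OF w R(4) S(4)]] by (auto simp: map_left_def)
    then show ?thesis
      using map_left_right_commute[OF T(1) S(5)[OF c] R(4) S(4) R'(4) S(4) gw]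
      by (simp add: outer_tensor_simps)
  qed
  moreover have "(\<lambda>(g, c). (\<theta> g, c)) ` carrier (G \<times>\<times> C) = carrier (H \<times>\<times> C)"
    by (force simp: th[symmetric] image_iff)
  ultimately show ?thesis
    unfolding rep_iso_along_def
    using group_rep_outer_tensor[OF R(1) S(1)] group_rep_outer_tensor[OF R'(1) S(1)]
      map_left_linear[OF T(1) R(4) S(4)]
    by (auto simp: outer_tensor_simps(1) intro!: exI[of _ "map_left T"])
qed

lemma rep_iso_along_flip:
  assumes R: "group_rep G R" and S: "group_rep H S"
  shows "rep_iso_along (G \<times>\<times> H) (H \<times>\<times> G) (\<lambda>(g, h). (h, g)) (outer_tensor R S) (outer_tensor S R)"
proof -
  note R' = group_repD[OF R] and S' = group_repD[OF S]
  have "bij_betw flip (tensor (vs R) (vs S)) (tensor (vs S) (vs R))"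
    by (rule bij_betw_byWitness[where f' = flip]) (auto simp: flip_tensor)
  moreover have "linear_between (tensor (vs R) (vs S)) (tensor (vs S) (vs R)) flip"
    by (rule linear_betweenI) (auto simp: flip_tensor, auto simp: flip_def)
  moreover have "flip (act (outer_tensor R S) (g, h) w) = act (outer_tensor S R) (h, g) (flip w)"
    if g: "g \<in> carrier G" and h: "h \<in> carrier H" and w: "w \<in> tensor (vs R) (vs S)" for g h w
    using map_left_right_commute[OF R'(4)[OF g] S'(4)[OF h] R'(3) S'(3) R'(3) S'(3) w]
    by (simp add: outer_tensor_simps map_right_eq_flip)
  ultimately show ?thesis
    unfolding rep_iso_along_def
    using group_rep_outer_tensor[OF R S] group_rep_outer_tensor[OF S R]
    by (auto simp: outer_tensor_simps(1) intro!: exI[of _ flip])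
qed

subsection \<open>Induced representations\<close>

lemma induced_rep_act:
  "act (induced_rep G H \<phi> R) a u (g, x) = (if g \<in> carrier G then u (g \<otimes>\<^bsub>G\<^esub> a, x) else 0)"
  by (simp add: induced_rep_def)

lemma induced_repI:
  assumes "\<And>g. g \<in> carrier G \<Longrightarrow> (\<lambda>x. u (g, x)) \<in> vs R"
    "\<And>g x. g \<notin> carrier G \<Longrightarrow> u (g, x) = 0"
    "\<And>h g. h \<in> carrier H \<Longrightarrow> g \<in> carrier G \<Longrightarrow>
      (\<lambda>x. u (\<phi> h \<otimes>\<^bsub>G\<^esub> g, x)) = act R h (\<lambda>x. u (g, x))"
  shows "u \<in> vs (induced_rep G H \<phi> R)"
  using assms by (simp add: induced_rep_def)

lemma induced_repD:
  assumes "u \<in> vs (induced_rep G H \<phi> R)"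
  shows "g \<in> carrier G \<Longrightarrow> (\<lambda>x. u (g, x)) \<in> vs R"
    "g \<notin> carrier G \<Longrightarrow> u (g, x) = 0"
    "h \<in> carrier H \<Longrightarrow> g \<in> carrier G \<Longrightarrow>
      (\<lambda>x. u (\<phi> h \<otimes>\<^bsub>G\<^esub> g, x)) = act R h (\<lambda>x. u (g, x))"
  using assms by (simp_all add: induced_rep_def)

lemma group_rep_induced:
  assumes G: "group G" "finite (carrier G)" and \<phi>: "\<phi> \<in> hom H G" and R: "group_rep H R"
  shows "group_rep G (induced_rep G H \<phi> R)"
proof -
  interpret group G by (rule G)
  note R = group_repD[OF R]
  let ?I = "induced_rep G H \<phi> R"
  have \<phi>G: "\<phi> h \<in> carrier G" if "h \<in> carrier H" for h using \<phi> that by (auto simp: hom_def)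
  have sub: "cfun.subspace (vs ?I)"
  proof (rule subspaceI)
    show "(\<lambda>x. 0) \<in> vs ?I"
      using subspace_0[OF R(3)] linear_between_zero[OF R(4,3)] by (auto intro!: induced_repI)
    show "(\<lambda>x. u x + v x) \<in> vs ?I" if u: "u \<in> vs ?I" and v: "v \<in> vs ?I" for u v
      by (rule induced_repI)
        (simp_all add: subspace_add[OF R(3)] induced_repD(1,2)[OF u] induced_repD(1,2)[OF v]
          fun_cong[OF induced_repD(3)[OF u]] fun_cong[OF induced_repD(3)[OF v]]
          linear_between_add[OF R(4) induced_repD(1)[OF u] induced_repD(1)[OF v]])
    show "(\<lambda>x. c * u x) \<in> vs ?I" if u: "u \<in> vs ?I" for u c
      by (rule induced_repI)
        (simp_all add: subspace_scale[OF R(3)] induced_repD(1,2)[OF u] fun_cong[OF induced_repD(3)[OF u]]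
          linear_between_scale[OF R(4) induced_repD(1)[OF u]])
  qed
  \<comment> \<open>The induced space is a subspace of the space of all functions from the finite
    group to \<open>vs R\<close>.\<close>
  have fd: "fin_dim (vs ?I)"
  proof (rule fin_dim_subset[OF sub])
    show "fin_dim (fam (carrier G) (\<lambda>_. vs R))" by (rule fin_dim_fam[OF G(2) R(2)])
    show "vs ?I \<subseteq> fam (carrier G) (\<lambda>_. vs R)" by (auto simp: fam_def induced_repD)
  qed
  have in_I: "act ?I a u \<in> vs ?I" if a: "a \<in> carrier G" and u: "u \<in> vs ?I" for a u
  proof (rule induced_repI)
    fix h g assume h: "h \<in> carrier H" and g: "g \<in> carrier G"
    show "(\<lambda>x. act ?I a u (\<phi> h \<otimes>\<^bsub>G\<^esub> g, x)) = act R h (\<lambda>x. act ?I a u (g, x))"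
      using induced_repD(3)[OF u h, of "g \<otimes>\<^bsub>G\<^esub> a"] g a \<phi>G[OF h]
      by (simp add: induced_rep_act m_assoc)
  qed (use induced_repD(1)[OF u] a in \<open>auto simp: induced_rep_act\<close>)
  show ?thesis
    unfolding group_rep_iff
  proof (intro conjI ballI)
    show "linear_between (vs ?I) (vs ?I) (act ?I a)" if "a \<in> carrier G" for a
      by (rule linear_betweenI) (rule in_I[OF that], assumption, auto simp: induced_rep_act fun_eq_iff)
    show "act ?I \<one>\<^bsub>G\<^esub> u = u" if "u \<in> vs ?I" for u
      using induced_repD(2)[OF that] by (auto simp: induced_rep_act)
    show "act ?I (a \<otimes>\<^bsub>G\<^esub> b) u = act ?I a (act ?I b u)" if "a \<in> carrier G" "b \<in> carrier G" for a b u
      using that by (auto simp: induced_rep_act m_assoc)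
  qed (rule G fd)+
qed

text \<open>The isomorphism sends \<open>u\<close> to \<open>g \<mapsto> T (u (s\<^sup>-\<^sup>1 g))\<close>.\<close>

lemma rep_iso_induced_conj:
  fixes G :: "('g, 'b) monoid_scheme" and R :: "('h, 'x) rep" and S :: "('k, 'y) rep"
  assumes G: "group G" "finite (carrier G)" and \<phi>: "\<phi> \<in> hom H G"
    and iso: "rep_iso_along H H' \<theta> R S"
    and s: "s \<in> carrier G" and \<phi>': "\<And>h. h \<in> carrier H \<Longrightarrow> \<phi>' (\<theta> h) \<otimes>\<^bsub>G\<^esub> s = s \<otimes>\<^bsub>G\<^esub> \<phi> h"
    and \<phi>'G: "\<And>h. h \<in> carrier H' \<Longrightarrow> \<phi>' h \<in> carrier G"
  shows "rep_iso G (induced_rep G H \<phi> R) (induced_rep G H' \<phi>' S)"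
proof -
  interpret group G by (rule G)
  obtain T where T: "linear_between (vs R) (vs S) T" "bij_betw T (vs R) (vs S)"
    "\<And>h u. h \<in> carrier H \<Longrightarrow> u \<in> vs R \<Longrightarrow> T (act R h u) = act S (\<theta> h) (T u)"
    and R: "group_rep H R" and S: "group_rep H' S" and th: "\<theta> ` carrier H = carrier H'"
    using iso by (auto simp: rep_iso_along_def)
  note R = R group_repD[OF R] and S = S group_repD[OF S]
  have canc: "s \<otimes>\<^bsub>G\<^esub> (inv\<^bsub>G\<^esub> s \<otimes>\<^bsub>G\<^esub> g) = g" if "g \<in> carrier G" for g
    using s that by (simp add: m_assoc[symmetric])
  let ?T' = "inv_into (vs R) T"
  let ?I = "induced_rep G H \<phi> R" and ?J = "induced_rep G H' \<phi>' S"
  have \<phi>G: "\<phi> h \<in> carrier G" if "h \<in> carrier H" for h using \<phi> that by (auto simp: hom_def)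
  have T': "?T' v \<in> vs R" "T (?T' v) = v" if "v \<in> vs S" for v
    using that T(2) bij_betw_inv_into_right bij_betw_apply[OF bij_betw_inv_into] by metis+
  have T'T: "?T' (T u) = u" if "u \<in> vs R" for u
    using that T(2) bij_betw_inv_into_left by metis
  define F where "F u = (\<lambda>(g, y). if g \<in> carrier G then T (\<lambda>x. u (inv\<^bsub>G\<^esub> s \<otimes>\<^bsub>G\<^esub> g, x)) y else 0)"
    for u :: "'g \<times> 'x \<Rightarrow> complex"
  define F' where "F' v = (\<lambda>(g, x). if g \<in> carrier G then ?T' (\<lambda>y. v (s \<otimes>\<^bsub>G\<^esub> g, y)) x else 0)"
    for v :: "'g \<times> 'y \<Rightarrow> complex"
  have F: "F u \<in> vs ?J" if u: "u \<in> vs ?I" for u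
  proof (rule induced_repI)
    \<comment> \<open>Writing g as s (s^-1 g) behind \<open>\<phi>' h\<close> makes the intertwining
      relation applicable; the leading s^-1 then cancels.\<close>
    fix h g assume "h \<in> carrier H'" and g: "g \<in> carrier G"
    then obtain k where k: "k \<in> carrier H" "h = \<theta> k" using th by blast
    have "inv\<^bsub>G\<^esub> s \<otimes>\<^bsub>G\<^esub> (\<phi>' h \<otimes>\<^bsub>G\<^esub> g) = inv\<^bsub>G\<^esub> s \<otimes>\<^bsub>G\<^esub> (\<phi>' h \<otimes>\<^bsub>G\<^esub> s) \<otimes>\<^bsub>G\<^esub> (inv\<^bsub>G\<^esub> s \<otimes>\<^bsub>G\<^esub> g)"
      using s g \<phi>'G[OF \<open>h \<in> carrier H'\<close>] canc by (simp add: m_assoc)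
    also have "\<dots> = \<phi> k \<otimes>\<^bsub>G\<^esub> (inv\<^bsub>G\<^esub> s \<otimes>\<^bsub>G\<^esub> g)"
      using \<phi>'[OF k(1)] k(2) s g \<phi>G[OF k(1)] by (simp add: m_assoc[symmetric])
    finally show "(\<lambda>x. F u (\<phi>' h \<otimes>\<^bsub>G\<^esub> g, x)) = act S h (\<lambda>x. F u (g, x))"
      using T(3)[OF k(1) induced_repD(1)[OF u, of "inv\<^bsub>G\<^esub> s \<otimes>\<^bsub>G\<^esub> g"]] g s k \<phi>'G[OF \<open>h \<in> carrier H'\<close>]
        induced_repD(3)[OF u k(1), of "inv\<^bsub>G\<^esub> s \<otimes>\<^bsub>G\<^esub> g"]
      by (simp add: F_def)
  qed (use linear_between_in[OF T(1) induced_repD(1)[OF u]] s in \<open>auto simp: F_def\<close>)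
  have F': "F' v \<in> vs ?I" if v: "v \<in> vs ?J" for v
  proof (rule induced_repI)
    fix h g assume h: "h \<in> carrier H" and g: "g \<in> carrier G"
    have \<theta>h: "\<theta> h \<in> carrier H'" using th h by blast
    have "s \<otimes>\<^bsub>G\<^esub> (\<phi> h \<otimes>\<^bsub>G\<^esub> g) = \<phi>' (\<theta> h) \<otimes>\<^bsub>G\<^esub> (s \<otimes>\<^bsub>G\<^esub> g)"
      using \<phi>'[OF h] s g \<phi>G[OF h] \<phi>'G[OF \<theta>h] by (simp add: m_assoc[symmetric])
    then have "(\<lambda>y. v (s \<otimes>\<^bsub>G\<^esub> (\<phi> h \<otimes>\<^bsub>G\<^esub> g), y)) = act S (\<theta> h) (\<lambda>y. v (s \<otimes>\<^bsub>G\<^esub> g, y))"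
      using induced_repD(3)[OF v \<theta>h, of "s \<otimes>\<^bsub>G\<^esub> g"] s g by simp
    also have "\<dots> = T (act R h (?T' (\<lambda>y. v (s \<otimes>\<^bsub>G\<^esub> g, y))))"
      using T(3)[OF h T'(1)] T'(2) induced_repD(1)[OF v, of "s \<otimes>\<^bsub>G\<^esub> g"] s g by simp
    finally have "?T' (\<lambda>y. v (s \<otimes>\<^bsub>G\<^esub> (\<phi> h \<otimes>\<^bsub>G\<^esub> g), y)) = act R h (?T' (\<lambda>y. v (s \<otimes>\<^bsub>G\<^esub> g, y)))"
      using T'T[OF R(8)[OF h T'(1)]] induced_repD(1)[OF v, of "s \<otimes>\<^bsub>G\<^esub> g"] s g by simp
    then show "(\<lambda>x. F' v (\<phi> h \<otimes>\<^bsub>G\<^esub> g, x)) = act R h (\<lambda>x. F' v (g, x))"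
      using g \<phi>G[OF h] by (simp add: F'_def)
  qed (use T'(1)[OF induced_repD(1)[OF v]] s in \<open>auto simp: F'_def\<close>)
  have F'F: "F' (F u) = u" if u: "u \<in> vs ?I" for u
  proof
    fix z :: "'g \<times> 'x" obtain g x where z: "z = (g, x)" by force
    show "F' (F u) z = u z"
    proof (cases "g \<in> carrier G")
      case True
      then have "inv\<^bsub>G\<^esub> s \<otimes>\<^bsub>G\<^esub> (s \<otimes>\<^bsub>G\<^esub> g) = g" using s by (simp add: m_assoc[symmetric])
      then show ?thesis using T'T[OF induced_repD(1)[OF u True]] True s by (simp add: z F_def F'_def)
    qed (simp add: z F'_def induced_repD(2)[OF u])
  qed
  have FF': "F (F' v) = v" if v: "v \<in> vs ?J" for v
  proof
    fix z :: "'g \<times> 'y" obtain g x where z: "z = (g, x)" by force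
    show "F (F' v) z = v z"
    proof (cases "g \<in> carrier G")
      case True
      then have "s \<otimes>\<^bsub>G\<^esub> (inv\<^bsub>G\<^esub> s \<otimes>\<^bsub>G\<^esub> g) = g" using s by (simp add: m_assoc[symmetric])
      then show ?thesis using T'(2)[OF induced_repD(1)[OF v True]] True s by (simp add: z F_def F'_def)
    qed (simp add: z F_def induced_repD(2)[OF v])
  qed
  show ?thesis
  proof (rule rep_isoI[where T = F])
    show "group_rep G ?I" by (rule group_rep_induced[OF G \<phi> R(1)])
    show "linear_between (vs ?I) (vs ?J) F"
    proof (rule linear_betweenI)
      fix u v c assume u: "u \<in> vs ?I" and v: "v \<in> vs ?I"
      show "F u \<in> vs ?J" by (rule F[OF u])
      show "F (\<lambda>x. u x + v x) = (\<lambda>x. F u x + F v x)"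
        using linear_between_add[OF T(1) induced_repD(1)[OF u] induced_repD(1)[OF v]] s
        by (auto simp: F_def)
      show "F (\<lambda>x. c * u x) = (\<lambda>x. c * F u x)"
        using linear_between_scale[OF T(1) induced_repD(1)[OF u]] s by (auto simp: F_def)
    qed
    show "bij_betw F (vs ?I) (vs ?J)"
      by (rule bij_betw_byWitness[where f' = F']) (use F F' FF' F'F in auto)
    show "F (act ?I a u) = act ?J a (F u)" if "a \<in> carrier G" for a u
      using that s by (auto simp: F_def induced_rep_act m_assoc)
  qed
qed

text \<open>Conjugation by the unit leaves the embedding alone and changes only the inducing
  representation.\<close>

lemma rep_iso_induced:
  assumes G: "group G" "finite (carrier G)" and \<phi>: "\<phi> \<in> hom H G" and iso: "rep_iso H R S"
  shows "rep_iso G (induced_rep G H \<phi> R) (induced_rep G H \<phi> S)"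
proof -
  interpret group G by (rule G)
  show ?thesis
    using \<phi> by (intro rep_iso_induced_conj[OF G \<phi> iso[unfolded rep_iso_eq_along] one_closed])
      (auto simp: hom_def Pi_iff)
qed

text \<open>Induction in stages: \<open>u\<close> is sent to \<open>g \<mapsto> u (g) (1)\<close>.\<close>

lemma rep_iso_induced_trans:
  fixes G :: "('g, 'b) monoid_scheme" and H :: "('h, 'c) monoid_scheme"
    and R :: "('k, 'x) rep" and S :: "('l, 'y) rep"
  assumes G: "group G" "finite (carrier G)" and H: "group H" "finite (carrier H)"
    and \<phi>: "\<phi> \<in> hom (H \<times>\<times> C) G" and \<psi>: "\<psi> \<in> hom K H" and R: "group_rep K R" and S: "group_rep C S"
  shows "rep_iso G (induced_rep G (H \<times>\<times> C) \<phi> (outer_tensor (induced_rep H K \<psi> R) S))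
    (induced_rep G (K \<times>\<times> C) (\<lambda>(k, c). \<phi> (\<psi> k, c)) (outer_tensor R S))"
proof -
  interpret G: group G by (rule G)
  interpret H: group H by (rule H)
  interpret C: group C by (rule group_repD(1)[OF S])
  interpret K: group K by (rule group_repD(1)[OF R])
  let ?M = "induced_rep H K \<psi> R"
  have M: "group_rep H ?M" by (rule group_rep_induced[OF H \<psi> R])
  note R = R group_repD[OF R] and S = S group_repD[OF S] and M = M group_repD[OF M]
  let ?I = "induced_rep G (H \<times>\<times> C) \<phi> (outer_tensor ?M S)"
  let ?J = "induced_rep G (K \<times>\<times> C) (\<lambda>(k, c). \<phi> (\<psi> k, c)) (outer_tensor R S)"
  have \<psi>H: "\<psi> k \<in> carrier H" if "k \<in> carrier K" for k using \<psi> that by (auto simp: hom_def)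
  have \<phi>G: "\<phi> (h, c) \<in> carrier G" if "h \<in> carrier H" "c \<in> carrier C" for h c
    using \<phi> that by (auto simp: hom_def Pi_iff)
  have \<phi>m: "\<phi> (h, c) \<otimes>\<^bsub>G\<^esub> \<phi> (h', c') = \<phi> (h \<otimes>\<^bsub>H\<^esub> h', c \<otimes>\<^bsub>C\<^esub> c')"
    if "h \<in> carrier H" "c \<in> carrier C" "h' \<in> carrier H" "c' \<in> carrier C" for h c h' c'
    using hom_mult[OF \<phi>, of "(h, c)" "(h', c')"] that by simp
  have \<phi>1: "\<phi> (\<one>\<^bsub>H\<^esub>, \<one>\<^bsub>C\<^esub>) = \<one>\<^bsub>G\<^esub>"
    using hom_one[OF \<phi> DirProd_group[OF H(1) group_repD(1)[OF S(1)]] G(1)] by simp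
  \<comment> \<open>Evaluation at the unit, the canonical map of Frobenius reciprocity; it
    intertwines the actions of \<open>K\<close>.\<close>
  define ev where "ev w = (\<lambda>x. w (\<one>\<^bsub>H\<^esub>, x))" for w :: "'h \<times> 'x \<Rightarrow> complex"
  define F where "F u = (\<lambda>(g, (x, z)). u (g, ((\<one>\<^bsub>H\<^esub>, x), z)))"
    for u :: "'g \<times> (('h \<times> 'x) \<times> 'y) \<Rightarrow> complex"
  \<comment> \<open>The value at \<open>h\<close> is recovered from values at the unit: translating
    u(g) by \<open>h\<close> and evaluating at 1 gives u(g)(h), and by equivariance this is the
    value of u at \<phi>(h, 1) g, evaluated at 1.\<close>
  define F' where "F' w = (\<lambda>(g, ((h, x), z)). if g \<in> carrier G \<and> h \<in> carrier H
      then w (\<phi> (h, \<one>\<^bsub>C\<^esub>) \<otimes>\<^bsub>G\<^esub> g, (x, z)) else 0)"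
    for w :: "'g \<times> ('x \<times> 'y) \<Rightarrow> complex"
  have ev: "linear_between (vs ?M) (vs R) ev"
    by (rule linear_betweenI) (auto simp: ev_def induced_repD(1))
  have F_ev: "(\<lambda>z. F u (g, z)) = map_left ev (\<lambda>z. u (g, z))" for u g
    by (auto simp: F_def map_left_def ev_def)
  have F: "F u \<in> vs ?J" if u: "u \<in> vs ?I" for u
  proof (rule induced_repI)
    note ug = induced_repD(1)[OF u, unfolded outer_tensor_simps(1)]
    show "(\<lambda>z. F u (g, z)) \<in> vs (outer_tensor R S)" if "g \<in> carrier G" for g
      using linear_between_in[OF map_left_linear[OF ev M(4) S(4)] ug[OF that]]
      by (simp add: outer_tensor_simps F_ev)
    show "F u (g, z) = 0" if "g \<notin> carrier G" for g z
      using induced_repD(2)[OF u that] by (cases z) (simp add: F_def)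
    fix kc g assume kc: "kc \<in> carrier (K \<times>\<times> C)" and g: "g \<in> carrier G"
    then obtain k c where k: "kc = (k, c)" "k \<in> carrier K" "c \<in> carrier C" by auto
    have "(\<lambda>z. u (\<phi> (\<psi> k, c) \<otimes>\<^bsub>G\<^esub> g, z)) = act (outer_tensor ?M S) (\<psi> k, c) (\<lambda>z. u (g, z))"
      using induced_repD(3)[OF u _ g, of "(\<psi> k, c)"] k \<psi>H by simp
    then have "(\<lambda>z. F u (\<phi> (\<psi> k, c) \<otimes>\<^bsub>G\<^esub> g, z))
        = map_left ev (map_right (act S c) (map_left (act ?M (\<psi> k)) (\<lambda>z. u (g, z))))"
      by (simp add: F_ev outer_tensor_simps)
    also have "\<dots> = map_right (act S c) (map_left ev (map_left (act ?M (\<psi> k)) (\<lambda>z. u (g, z))))"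
      by (auto simp: map_left_def map_right_def ev_def)
    also have "map_left ev (map_left (act ?M (\<psi> k)) (\<lambda>z. u (g, z)))
        = map_left (act R k) (map_left ev (\<lambda>z. u (g, z)))"
    proof -
      have "ev (act ?M (\<psi> k) w) = act R k (ev w)" if "w \<in> vs ?M" for w
        using induced_repD(3)[OF that k(2) H.one_closed] \<psi>H[OF k(2)]
        by (simp add: ev_def induced_rep_act)
      then show ?thesis
        using tensor_slices(1)[OF ug[OF g] M(4) S(4)] by (auto simp: map_left_def)
    qed
    finally show "(\<lambda>x. F u ((\<lambda>(k, c). \<phi> (\<psi> k, c)) kc \<otimes>\<^bsub>G\<^esub> g, x)) = act (outer_tensor R S) kc (\<lambda>x. F u (g, x))"
      by (simp add: k(1) F_ev outer_tensor_simps)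
  qed
  have right1: "map_right (act S \<one>\<^bsub>C\<^esub>) w = w" if "w \<in> tensor V (vs S)" "cfun.subspace V"
    for w and V :: "('z \<Rightarrow> complex) set"
    using S(6)[OF tensor_slices(2)[OF that S(4)]] by (auto simp: map_right_def)
  have F': "F' w \<in> vs ?I" if w: "w \<in> vs ?J" for w
  proof (rule induced_repI)
    note wg = induced_repD(1)[OF w, unfolded outer_tensor_simps(1)]
    have wk: "(\<lambda>z. w (\<phi> (\<psi> k, c) \<otimes>\<^bsub>G\<^esub> g, z)) = map_right (act S c) (map_left (act R k) (\<lambda>z. w (g, z)))"
      if "k \<in> carrier K" "c \<in> carrier C" "g \<in> carrier G" for k c g
      using induced_repD(3)[OF w _ that(3), of "(k, c)"] that by (simp add: outer_tensor_simps)
    show "(\<lambda>z. F' w (g, z)) \<in> vs (outer_tensor ?M S)" if g: "g \<in> carrier G" for g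
      unfolding outer_tensor_simps
    \<comment> \<open>The preimage comes without a decomposition into pure tensors; its slices are
      what can be checked.\<close>
    proof (rule tensorI[OF M(3) S(4)])
      fix z
      show "(\<lambda>y. F' w (g, (y, z))) \<in> vs ?M"
      proof (rule induced_repI)
        show "(\<lambda>x. F' w (g, ((h, x), z))) \<in> vs R" if "h \<in> carrier H" for h
          using tensor_slices(1)[OF wg R(4) S(4)] that g \<phi>G by (simp add: F'_def)
        fix k h assume k: "k \<in> carrier K" and h: "h \<in> carrier H"
        have "\<phi> (\<psi> k \<otimes>\<^bsub>H\<^esub> h, \<one>\<^bsub>C\<^esub>) \<otimes>\<^bsub>G\<^esub> g = \<phi> (\<psi> k, \<one>\<^bsub>C\<^esub>) \<otimes>\<^bsub>G\<^esub> (\<phi> (h, \<one>\<^bsub>C\<^esub>) \<otimes>\<^bsub>G\<^esub> g)"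
          using \<phi>m[of "\<psi> k" "\<one>\<^bsub>C\<^esub>" h "\<one>\<^bsub>C\<^esub>"] \<psi>H[OF k] h g \<phi>G by (simp add: G.m_assoc[symmetric])
        moreover have "map_left (act R k) (\<lambda>z. w (\<phi> (h, \<one>\<^bsub>C\<^esub>) \<otimes>\<^bsub>G\<^esub> g, z)) \<in> tensor (vs R) (vs S)"
          using linear_between_in[OF map_left_linear[OF R(5)[OF k] R(4) S(4)] wg] h g \<phi>G by simp
        ultimately have "(\<lambda>z. w (\<phi> (\<psi> k \<otimes>\<^bsub>H\<^esub> h, \<one>\<^bsub>C\<^esub>) \<otimes>\<^bsub>G\<^esub> g, z)) = map_left (act R k) (\<lambda>z. w (\<phi> (h, \<one>\<^bsub>C\<^esub>) \<otimes>\<^bsub>G\<^esub> g, z))"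
          using wk[OF k C.one_closed, of "\<phi> (h, \<one>\<^bsub>C\<^esub>) \<otimes>\<^bsub>G\<^esub> g"] right1[OF _ R(4)] h g \<phi>G by simp
        then have "w (\<phi> (\<psi> k \<otimes>\<^bsub>H\<^esub> h, \<one>\<^bsub>C\<^esub>) \<otimes>\<^bsub>G\<^esub> g, (x, z)) = act R k (\<lambda>x. w (\<phi> (h, \<one>\<^bsub>C\<^esub>) \<otimes>\<^bsub>G\<^esub> g, (x, z))) x" for x
          by (auto simp: map_left_def fun_eq_iff)
        then show "(\<lambda>x. F' w (g, ((\<psi> k \<otimes>\<^bsub>H\<^esub> h, x), z))) = act R k (\<lambda>x. F' w (g, ((h, x), z)))"
          using g h \<psi>H[OF k] by (simp add: F'_def)
      qed (simp add: F'_def)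
    next
      fix y
      show "(\<lambda>z. F' w (g, (y, z))) \<in> vs S"
        using tensor_slices(2)[OF wg R(4) S(4)] g \<phi>G subspace_0[OF S(4)]
        by (cases "fst y \<in> carrier H") (auto simp: F'_def case_prod_unfold)
    qed
    show "F' w (g, z) = 0" if "g \<notin> carrier G" for g z
      using that by (auto simp: F'_def split: prod.split)
    fix hc g assume hc: "hc \<in> carrier (H \<times>\<times> C)" and g: "g \<in> carrier G"
    then obtain h' c where h': "hc = (h', c)" "h' \<in> carrier H" "c \<in> carrier C" by auto
    have "F' w (\<phi> hc \<otimes>\<^bsub>G\<^esub> g, ((h, x), z)) = act (outer_tensor ?M S) hc (\<lambda>z. F' w (g, z)) ((h, x), z)" for h x z
    proof (cases "h \<in> carrier H")
      case True
      \<comment> \<open>The factors \<open>H\<close> and \<open>C\<close> commute, so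
        \<open>c\<close> can be moved to the front. It is paired there with the image of the unit of
        \<open>K\<close>, to which the equivariance of \<open>w\<close> applies.\<close>
      have "\<phi> (h, \<one>\<^bsub>C\<^esub>) \<otimes>\<^bsub>G\<^esub> (\<phi> (h', c) \<otimes>\<^bsub>G\<^esub> g) = \<phi> (h \<otimes>\<^bsub>H\<^esub> h', c) \<otimes>\<^bsub>G\<^esub> g"
        using \<phi>m[of h "\<one>\<^bsub>C\<^esub>" h' c] True h' g \<phi>G by (simp add: G.m_assoc[symmetric])
      also have "\<dots> = \<phi> (\<psi> \<one>\<^bsub>K\<^esub>, c) \<otimes>\<^bsub>G\<^esub> (\<phi> (h \<otimes>\<^bsub>H\<^esub> h', \<one>\<^bsub>C\<^esub>) \<otimes>\<^bsub>G\<^esub> g)"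
        using \<phi>m[of "\<one>\<^bsub>H\<^esub>" c "h \<otimes>\<^bsub>H\<^esub> h'" "\<one>\<^bsub>C\<^esub>"] True h' g \<phi>G hom_one[OF \<psi> R(2) H(1)]
        by (simp add: G.m_assoc[symmetric])
      finally have e: "\<phi> (h, \<one>\<^bsub>C\<^esub>) \<otimes>\<^bsub>G\<^esub> (\<phi> (h', c) \<otimes>\<^bsub>G\<^esub> g) = \<phi> (\<psi> \<one>\<^bsub>K\<^esub>, c) \<otimes>\<^bsub>G\<^esub> (\<phi> (h \<otimes>\<^bsub>H\<^esub> h', \<one>\<^bsub>C\<^esub>) \<otimes>\<^bsub>G\<^esub> g)" .
      let ?q = "\<phi> (h \<otimes>\<^bsub>H\<^esub> h', \<one>\<^bsub>C\<^esub>) \<otimes>\<^bsub>G\<^esub> g"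
      have q: "?q \<in> carrier G" using True h' g \<phi>G by simp
      have "map_left (act R \<one>\<^bsub>K\<^esub>) (\<lambda>z. w (?q, z)) = (\<lambda>z. w (?q, z))"
        using R(6)[OF tensor_slices(1)[OF wg[OF q] R(4) S(4)]] by (auto simp: map_left_def)
      then have "F' w (\<phi> hc \<otimes>\<^bsub>G\<^esub> g, ((h, x), z)) = map_right (act S c) (\<lambda>z. w (?q, z)) (x, z)"
        using fun_cong[OF wk[OF K.one_closed h'(3) q], of "(x, z)"] True g h' \<phi>G
        by (simp add: F'_def e)
      also have "\<dots> = act (outer_tensor ?M S) hc (\<lambda>z. F' w (g, z)) ((h, x), z)"
        using True g h' \<phi>G
        by (simp add: outer_tensor_simps map_right_def map_left_def F'_def induced_rep_act)
      finally show ?thesis .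
    next
      case False
      then show ?thesis
        using linear_between_zero[OF S(5)[OF h'(3)] S(4)]
        by (simp add: h'(1) outer_tensor_simps map_right_def map_left_def F'_def induced_rep_act)
    qed
    then show "(\<lambda>z. F' w (\<phi> hc \<otimes>\<^bsub>G\<^esub> g, z)) = act (outer_tensor ?M S) hc (\<lambda>z. F' w (g, z))"
      by (auto simp: fun_eq_iff)
  qed
  have FF': "F (F' w) = w" if w: "w \<in> vs ?J" for w
    using induced_repD(2)[OF w] by (auto simp: F_def F'_def \<phi>1)
  have F'F: "F' (F u) = u" if u: "u \<in> vs ?I" for u
  proof -
    note ug = induced_repD(1)[OF u, unfolded outer_tensor_simps(1)]
    have "F' (F u) (g, ((h, x), z)) = u (g, ((h, x), z))" for g h x z
    proof (cases "g \<in> carrier G \<and> h \<in> carrier H")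
      case True
      then have g: "g \<in> carrier G" and h: "h \<in> carrier H" by auto
      have "map_left (act ?M h) (\<lambda>z. u (g, z)) \<in> tensor (vs ?M) (vs S)"
        using linear_between_in[OF map_left_linear[OF M(5)[OF h] M(4) S(4)] ug[OF g]] .
      then have "(\<lambda>z. u (\<phi> (h, \<one>\<^bsub>C\<^esub>) \<otimes>\<^bsub>G\<^esub> g, z)) = map_left (act ?M h) (\<lambda>z. u (g, z))"
        using induced_repD(3)[OF u _ g, of "(h, \<one>\<^bsub>C\<^esub>)"] h right1[OF _ M(4)]
        by (simp add: outer_tensor_simps)
      from fun_cong[OF this, of "((\<one>\<^bsub>H\<^esub>, x), z)"] show ?thesis
        using g h by (simp add: F_def F'_def map_left_def induced_rep_act)
    next
      case False
      moreover have "u (g, ((h, x), z)) = 0" if "g \<in> carrier G"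
        using False induced_repD(2)[OF tensor_slices(1)[OF ug[OF that] M(4) S(4)]] that by simp
      ultimately show ?thesis using induced_repD(2)[OF u] by (auto simp: F'_def)
    qed
    then show ?thesis by (auto simp: fun_eq_iff)
  qed
  show ?thesis
  proof (rule rep_isoI[where T = F])
    show "group_rep G ?I" by (rule group_rep_induced[OF G \<phi> group_rep_outer_tensor[OF M(1) S(1)]])
    show "linear_between (vs ?I) (vs ?J) F"
      by (rule linear_betweenI) (simp add: F, auto simp: F_def)
    show "bij_betw F (vs ?I) (vs ?J)"
      by (rule bij_betw_byWitness[where f' = F']) (use F F' FF' F'F in auto)
    show "F (act ?I a u) = act ?J a (F u)" for a u
      by (auto simp: F_def induced_rep_act)
  qed
qed

text \<open>With families encoded as functions of several variables, the two spaces consist of the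
  same functions up to the order of the variables: the index \<open>i\<close> moves to the
  front.\<close>

lemma rep_iso_induced_direct_sum:
  fixes G :: "('g, 'b) monoid_scheme" and A :: "'i \<Rightarrow> ('h, 'x) rep" and S :: "('l, 'y) rep"
  assumes G: "group G" "finite (carrier G)" and H: "group H" and \<phi>: "\<phi> \<in> hom (H \<times>\<times> C) G"
    and I: "finite I" and A: "\<And>i. i \<in> I \<Longrightarrow> group_rep H (A i)" and S: "group_rep C S"
  shows "rep_iso G (induced_rep G (H \<times>\<times> C) \<phi> (outer_tensor (direct_sum I A) S))
    (direct_sum I (\<lambda>i. induced_rep G (H \<times>\<times> C) \<phi> (outer_tensor (A i) S)))"
proof -
  interpret group G by (rule G)
  have D: "group_rep H (direct_sum I A)" by (rule group_rep_direct_sum[OF H I A])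
  note S = S group_repD[OF S] and D = D group_repD[OF D]
  note AD = group_repD[OF A]
  let ?D = "direct_sum I A"
  let ?I = "induced_rep G (H \<times>\<times> C) \<phi> (outer_tensor ?D S)"
  let ?J = "\<lambda>i. induced_rep G (H \<times>\<times> C) \<phi> (outer_tensor (A i) S)"
  define F where "F u = (\<lambda>(i, (g, (x, c))). u (g, ((i, x), c)))"
    for u :: "'g \<times> (('i \<times> 'x) \<times> 'y) \<Rightarrow> complex"
  define F' where "F' v = (\<lambda>(g, ((i, x), c)). v (i, (g, (x, c))))"
    for v :: "'i \<times> ('g \<times> ('x \<times> 'y)) \<Rightarrow> complex"
  \<comment> \<open>A tensor with a direct sum is a family of tensors, by comparison of
    slices.\<close>
  have T: "w \<in> tensor (vs ?D) (vs S) \<longleftrightarrow> (\<forall>i\<in>I. (\<lambda>(x, c). w ((i, x), c)) \<in> tensor (vs (A i)) (vs S))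
      \<and> (\<forall>i x c. i \<notin> I \<longrightarrow> w ((i, x), c) = 0)" for w
    unfolding tensor_iff[OF D(3) S(4)]
    using subspace_0[OF S(4)]
    by (auto simp: tensor_iff[OF AD(2) S(4)] direct_sum_simps fam_def)
  have act: "(\<lambda>(x, c). act (outer_tensor ?D S) (h, c') w ((i, x), c)) =
      act (outer_tensor (A i) S) (h, c') (\<lambda>(x, c). w ((i, x), c))" if "i \<in> I" for i h c' w
    using that by (auto simp: outer_tensor_simps map_left_def map_right_def direct_sum_simps)
  have act0: "act (outer_tensor ?D S) (h, c') w ((i, x), c) = 0" if "i \<notin> I" "c' \<in> carrier C" for i h c' w x c
    using that linear_between_zero[OF S(5)[OF that(2)] S(4)]
    by (auto simp: outer_tensor_simps map_left_def map_right_def direct_sum_simps)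
  have F: "F u \<in> vs (direct_sum I ?J)" if u: "u \<in> vs ?I" for u
    unfolding direct_sum_simps fam_def
  proof (intro CollectI conjI allI ballI impI)
    note ug = induced_repD(1)[OF u, unfolded outer_tensor_simps(1) T]
    show "(\<lambda>z. F u (i, z)) \<in> vs (?J i)" if i: "i \<in> I" for i
    proof (rule induced_repI)
      show "(\<lambda>z. F u (i, (g, z))) \<in> vs (outer_tensor (A i) S)" if "g \<in> carrier G" for g
        using ug[OF that] i by (simp add: outer_tensor_simps F_def case_prod_unfold)
      show "F u (i, (g, z)) = 0" if "g \<notin> carrier G" for g z
        using induced_repD(2)[OF u that] by (cases z) (simp add: F_def)
      fix hc g assume hc: "hc \<in> carrier (H \<times>\<times> C)" and g: "g \<in> carrier G"
      have "(\<lambda>(x, c). u (\<phi> hc \<otimes>\<^bsub>G\<^esub> g, ((i, x), c))) = act (outer_tensor (A i) S) hc (\<lambda>(x, c). u (g, ((i, x), c)))"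
        using induced_repD(3)[OF u hc g] act[OF i, of "fst hc" "snd hc" "\<lambda>z. u (g, z)"]
        by (simp add: fun_eq_iff)
      then show "(\<lambda>z. F u (i, (\<phi> hc \<otimes>\<^bsub>G\<^esub> g, z))) = act (outer_tensor (A i) S) hc (\<lambda>z. F u (i, (g, z)))"
        by (simp add: F_def case_prod_unfold)
    qed
    show "F u (i, z) = 0" if "i \<notin> I" for i z
    proof -
      obtain g x c where z: "z = (g, (x, c))" by (metis surj_pair)
      show ?thesis using ug[of g] that induced_repD(2)[OF u, of g] by (cases "g \<in> carrier G") (auto simp: F_def z)
    qed
  qed
  have F': "F' v \<in> vs ?I" if v: "v \<in> vs (direct_sum I ?J)" for v
  proof (rule induced_repI)
    have vi: "(\<lambda>z. v (i, z)) \<in> vs (?J i)" if "i \<in> I" for i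
      using v that by (simp add: direct_sum_simps fam_def)
    have v0: "v (i, z) = 0" if "i \<notin> I" for i z
      using v that by (cases z) (simp add: direct_sum_simps fam_def)
    show "(\<lambda>z. F' v (g, z)) \<in> vs (outer_tensor ?D S)" if "g \<in> carrier G" for g
      using induced_repD(1)[OF vi that] v0
      by (auto simp: outer_tensor_simps T F'_def case_prod_unfold)
    show "F' v (g, z) = 0" if "g \<notin> carrier G" for g z
    proof -
      obtain i x c where z: "z = ((i, x), c)" by (metis surj_pair)
      show ?thesis
        using induced_repD(2)[OF vi that] v0[of i] by (cases "i \<in> I") (auto simp: F'_def z)
    qed
    fix hc g assume hc: "hc \<in> carrier (H \<times>\<times> C)" and g: "g \<in> carrier G"
    obtain h c' where hc': "hc = (h, c')" "c' \<in> carrier C" using hc by auto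
    have "F' v (\<phi> hc \<otimes>\<^bsub>G\<^esub> g, ((i, x), c)) = act (outer_tensor ?D S) hc (\<lambda>z. F' v (g, z)) ((i, x), c)" for i x c
    proof (cases "i \<in> I")
      case True
      show ?thesis
        using fun_cong[OF induced_repD(3)[OF vi[OF True] hc g], of "(x, c)"]
          fun_cong[OF act[OF True, of h c' "\<lambda>z. F' v (g, z)"], of "(x, c)"]
        by (simp add: F'_def hc' case_prod_unfold)
    qed (simp add: v0 act0 hc' F'_def)
    then show "(\<lambda>z. F' v (\<phi> hc \<otimes>\<^bsub>G\<^esub> g, z)) = act (outer_tensor ?D S) hc (\<lambda>z. F' v (g, z))"
      by (auto simp: fun_eq_iff)
  qed
  show ?thesis
  proof (rule rep_isoI[where T = F])
    show "group_rep G ?I" by (rule group_rep_induced[OF G \<phi> group_rep_outer_tensor[OF D(1) S(1)]])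
    show "linear_between (vs ?I) (vs (direct_sum I ?J)) F"
      by (rule linear_betweenI) (simp add: F, auto simp: F_def)
    show "bij_betw F (vs ?I) (vs (direct_sum I ?J))"
    proof (rule bij_betw_byWitness[where f' = F'])
      show "\<forall>u\<in>vs ?I. F' (F u) = u" "\<forall>v\<in>vs (direct_sum I ?J). F (F' v) = v"
        by (auto simp: F_def F'_def)
    qed (use F F' in auto)
    show "F (act ?I a u) = act (direct_sum I ?J) a (F u)" if "a \<in> carrier G" "u \<in> vs ?I" for a u
    proof -
      have "act ?I a u \<in> vs ?I"
        using group_repD(7)[OF group_rep_induced[OF G \<phi> group_rep_outer_tensor[OF D(1) S(1)]] that] .
      from F[OF this] have zero: "F (act ?I a u) (i, (g, (x, c))) = 0" if "i \<notin> I" for i g x c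
        using that by (simp add: direct_sum_simps fam_def)
      have "u (g \<otimes>\<^bsub>G\<^esub> a, ((i, x), c)) = 0" if "i \<notin> I" "g \<in> carrier G" for i g x c
        using zero[OF that(1), of g x c] that(2) by (simp add: F_def induced_rep_act)
      then show ?thesis by (auto simp: F_def induced_rep_act direct_sum_simps fun_eq_iff)
    qed
  qed
qed

section \<open>Wreath products\<close>

lemma wreath_simps:
  "carrier (wreath_sym F m) = (\<Pi>\<^sub>E i\<in>{1..m}. carrier F) \<times> {p. p permutes {1..m}}"
  "(f, \<sigma>) \<otimes>\<^bsub>wreath_sym F m\<^esub> (g, \<tau>) =
    (\<lambda>i\<in>{1..m}. f i \<otimes>\<^bsub>F\<^esub> (\<lambda>i\<in>{1..m}. g (inv' \<sigma> i)) i, \<sigma> \<circ> \<tau>)"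
  "\<one>\<^bsub>wreath_sym F m\<^esub> = (\<lambda>i\<in>{1..m}. \<one>\<^bsub>F\<^esub>, id)"
  by (simp_all add: wreath_sym_def sym_group_def)

lemma permutes_le: "p permutes {1..m} \<Longrightarrow> i \<in> {1..m} \<Longrightarrow> p i \<in> {1..m}" for m :: nat
  by (simp only: permutes_in_image)

lemma group_wreath:
  assumes F: "group F"
  shows "group (wreath_sym F m)"
proof -
  interpret F: group F by (rule F)
  show ?thesis
  proof (rule groupI)
    fix x y assume "x \<in> carrier (wreath_sym F m)" "y \<in> carrier (wreath_sym F m)"
    then show "x \<otimes>\<^bsub>wreath_sym F m\<^esub> y \<in> carrier (wreath_sym F m)"
      using permutes_le[OF permutes_inv]
      by (cases x, cases y) (auto simp: wreath_simps PiE_iff intro: permutes_compose)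
  next
    show "\<one>\<^bsub>wreath_sym F m\<^esub> \<in> carrier (wreath_sym F m)"
      by (auto simp: wreath_simps permutes_id)
  next
    fix x y z
    assume "x \<in> carrier (wreath_sym F m)" "y \<in> carrier (wreath_sym F m)" "z \<in> carrier (wreath_sym F m)"
    then show "x \<otimes>\<^bsub>wreath_sym F m\<^esub> y \<otimes>\<^bsub>wreath_sym F m\<^esub> z = x \<otimes>\<^bsub>wreath_sym F m\<^esub> (y \<otimes>\<^bsub>wreath_sym F m\<^esub> z)"
      using permutes_le[OF permutes_inv]
      by (cases x, cases y, cases z)
        (auto simp: wreath_simps PiE_iff fun_eq_iff o_assoc o_inv_distrib permutes_bij F.m_assoc)
  next
    fix x assume "x \<in> carrier (wreath_sym F m)"
    then show "\<one>\<^bsub>wreath_sym F m\<^esub> \<otimes>\<^bsub>wreath_sym F m\<^esub> x = x"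
      by (cases x) (auto simp: wreath_simps PiE_iff fun_eq_iff extensional_def)
  next
    fix x assume x: "x \<in> carrier (wreath_sym F m)"
    obtain f \<sigma> where fs: "x = (f, \<sigma>)" by force
    \<comment> \<open>The twist in the product uses the inverse of the permutation; for
      \<open>?y\<close> on the left this is \<sigma> itself, so the coordinate at i meets f
      (\<sigma> i).\<close>
    let ?y = "(\<lambda>i\<in>{1..m}. inv\<^bsub>F\<^esub> f (\<sigma> i), inv' \<sigma>)"
    have s: "\<sigma> permutes {1..m}" using x by (auto simp: fs wreath_simps)
    have "?y \<in> carrier (wreath_sym F m)"
      using x permutes_le[OF s] permutes_inv[OF s] by (auto simp: fs wreath_simps PiE_iff)
    moreover have "?y \<otimes>\<^bsub>wreath_sym F m\<^esub> x = \<one>\<^bsub>wreath_sym F m\<^esub>"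
      using x permutes_le[OF s] permutes_inv_o(2)[OF s]
      by (auto simp: fs wreath_simps PiE_iff fun_eq_iff permutes_bij inv_inv_eq)
    ultimately show "\<exists>y\<in>carrier (wreath_sym F m). y \<otimes>\<^bsub>wreath_sym F m\<^esub> x = \<one>\<^bsub>wreath_sym F m\<^esub>"
      by blast
  qed
qed

lemma finite_wreath: "finite (carrier F) \<Longrightarrow> finite (carrier (wreath_sym F m))"
  by (auto simp: wreath_simps intro!: finite_PiE finite_permutations)

lemma carrier_Z2: "carrier Z2 = {0, 1}"
  by (auto simp: integer_mod_group_def carrier_integer_mod_group)

lemma group_B [simp]: "group (B m)"
  by (simp add: B_def group_wreath)

lemma finite_B [simp]: "finite (carrier (B m))"
  by (simp add: B_def finite_wreath carrier_Z2)

section \<open>Block permutations and the embedding of a product of two wreath products\<close>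

lemma permutes_if_bij: "bij p \<Longrightarrow> (\<And>i. i \<notin> S \<Longrightarrow> p i = i) \<Longrightarrow> p permutes S"
  by (auto simp: permutes_def bij_iff)

text \<open>The permutation component of \<open>block_emb\<close>. The first branch also covers i =
  0, which a permutation of {1..a} fixes.\<close>

definition block_perm :: "nat \<Rightarrow> nat \<Rightarrow> (nat \<Rightarrow> nat) \<Rightarrow> (nat \<Rightarrow> nat) \<Rightarrow> nat \<Rightarrow> nat"
  where "block_perm a b \<sigma> \<tau> = (\<lambda>i. if i \<le> a then \<sigma> i else if i \<le> a + b then a + \<tau> (i - a) else i)"

lemma block_emb_eq:
  "block_emb a b ((f, \<sigma>), (g, \<tau>)) =
    (\<lambda>i\<in>{1..a + b}. if i \<le> a then f i else g (i - a), block_perm a b \<sigma> \<tau>)"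
  by (simp add: block_emb_def block_perm_def)

lemma permutes_cases:
  fixes a :: nat
  assumes "\<sigma> permutes {1..a}"
  shows "i = 0 \<Longrightarrow> \<sigma> i = 0" "1 \<le> i \<Longrightarrow> i \<le> a \<Longrightarrow> 1 \<le> \<sigma> i \<and> \<sigma> i \<le> a" "i > a \<Longrightarrow> \<sigma> i = i"
  using assms permutes_le[OF assms, of i] permutes_not_in[OF assms, of i] by auto

lemma permutes_le_iff: "\<sigma> permutes {1..a} \<Longrightarrow> \<sigma> i \<le> a \<longleftrightarrow> i \<le> a" for a :: nat
  using permutes_cases[of \<sigma> a i] by (cases "i = 0"; cases "i \<le> a") auto

lemma block_perm_comp:
  assumes "\<sigma> permutes {1..a}" "\<tau> permutes {1..b}" "\<sigma>' permutes {1..a}" "\<tau>' permutes {1..b}"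
  shows "block_perm a b \<sigma> \<tau> \<circ> block_perm a b \<sigma>' \<tau>' = block_perm a b (\<sigma> \<circ> \<sigma>') (\<tau> \<circ> \<tau>')"
proof
  fix i
  consider "i \<le> a" | "a < i" "i \<le> a + b" | "i > a + b" by linarith
  then show "(block_perm a b \<sigma> \<tau> \<circ> block_perm a b \<sigma>' \<tau>') i = block_perm a b (\<sigma> \<circ> \<sigma>') (\<tau> \<circ> \<tau>') i"
  proof cases
    case 2
    then have "1 \<le> i - a" "i - a \<le> b" by auto
    then have "1 \<le> \<tau>' (i - a) \<and> \<tau>' (i - a) \<le> b" using permutes_cases(2)[OF assms(4)] by blast
    then show ?thesis using 2 by (simp add: block_perm_def)
  qed (use permutes_le_iff[OF assms(3)] in \<open>simp_all add: block_perm_def\<close>)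
qed

lemma block_perm_id: "block_perm a b id id = id"
  by (auto simp: block_perm_def)

lemma block_perm_permutes:
  assumes "\<sigma> permutes {1..a}" "\<tau> permutes {1..b}"
  shows "block_perm a b \<sigma> \<tau> permutes {1..a + b}"
proof (rule permutes_if_bij)
  show "bij (block_perm a b \<sigma> \<tau>)"
  proof (rule o_bij)
    show "block_perm a b (inv' \<sigma>) (inv' \<tau>) \<circ> block_perm a b \<sigma> \<tau> = id"
      using assms by (simp add: block_perm_comp permutes_inv permutes_inv_o block_perm_id)
    show "block_perm a b \<sigma> \<tau> \<circ> block_perm a b (inv' \<sigma>) (inv' \<tau>) = id"
      using assms by (simp add: block_perm_comp permutes_inv permutes_inv_o block_perm_id)
  qed
  show "block_perm a b \<sigma> \<tau> i = i" if "i \<notin> {1..a + b}" for i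
    using that permutes_cases(1)[OF assms(1)] by (cases "i = 0") (auto simp: block_perm_def)
qed

lemma block_perm_inv:
  assumes "\<sigma> permutes {1..a}" "\<tau> permutes {1..b}"
  shows "inv' (block_perm a b \<sigma> \<tau>) = block_perm a b (inv' \<sigma>) (inv' \<tau>)"
  using assms
  by (intro inv_unique_comp) (simp_all add: block_perm_comp permutes_inv permutes_inv_o block_perm_id)

lemma block_emb_hom: "block_emb a b \<in> hom (wreath_sym F a \<times>\<times> wreath_sym F b) (wreath_sym F (a + b))"
proof (rule homI)
  fix x assume "x \<in> carrier (wreath_sym F a \<times>\<times> wreath_sym F b)"
  then obtain f \<sigma> g \<tau> where x: "x = ((f, \<sigma>), (g, \<tau>))" "f \<in> (\<Pi>\<^sub>E i\<in>{1..a}. carrier F)"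
    "g \<in> (\<Pi>\<^sub>E i\<in>{1..b}. carrier F)" "\<sigma> permutes {1..a}" "\<tau> permutes {1..b}"
    by (auto simp: wreath_simps)
  have "g (i - a) \<in> carrier F" if "\<not> i \<le> a" "i \<le> a + b" for i
    using that by (intro PiE_mem[OF x(3)]) auto
  then show "block_emb a b x \<in> carrier (wreath_sym F (a + b))"
    using x(2,3) block_perm_permutes[OF x(4,5)]
    by (auto simp: x(1) block_emb_eq wreath_simps PiE_iff)
  fix y assume "y \<in> carrier (wreath_sym F a \<times>\<times> wreath_sym F b)"
  then obtain f' \<sigma>' g' \<tau>' where y: "y = ((f', \<sigma>'), (g', \<tau>'))" "\<sigma>' permutes {1..a}" "\<tau>' permutes {1..b}"
    by (auto simp: wreath_simps)
  let ?G = "wreath_sym F (a + b)"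
  define P where "P = block_perm a b (inv' \<sigma>) (inv' \<tau>)"
  have P: "inv' (block_perm a b \<sigma> \<tau>) = P" by (simp add: P_def block_perm_inv[OF x(4,5)])
  \<comment> \<open>The inverse block permutation respects the two blocks, so the twisted coordinate
    is looked up in the block of \<open>i\<close>.\<close>
  have fst: "fst (block_emb a b (x \<otimes>\<^bsub>wreath_sym F a \<times>\<times> wreath_sym F b\<^esub> y)) i
      = fst (block_emb a b x \<otimes>\<^bsub>?G\<^esub> block_emb a b y) i" for i
  proof (cases "i \<in> {1..a + b}")
    case False
    then show ?thesis by (auto simp: x(1) y(1) block_emb_eq wreath_simps)
  next
    case True
    show ?thesis
    proof (cases "i \<le> a")
      case le: True
      then have "P i = inv' \<sigma> i" "1 \<le> P i" "P i \<le> a" "i \<in> {1..a}"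
        using permutes_cases(2)[OF permutes_inv[OF x(4)], of i] True by (auto simp: P_def block_perm_def)
      then show ?thesis using le by (simp add: x(1) y(1) block_emb_eq wreath_simps P)
    next
      case gt: False
      then have i: "i - a \<in> {1..b}" using True by auto
      moreover have "P i = a + inv' \<tau> (i - a)" "1 \<le> inv' \<tau> (i - a)" "inv' \<tau> (i - a) \<le> b"
        using permutes_cases(2)[OF permutes_inv[OF x(5)], of "i - a"] True gt i by (auto simp: P_def block_perm_def)
      ultimately show ?thesis using True gt by (simp add: x(1) y(1) block_emb_eq wreath_simps P)
    qed
  qed
  have "snd (block_emb a b (x \<otimes>\<^bsub>wreath_sym F a \<times>\<times> wreath_sym F b\<^esub> y))
      = snd (block_emb a b x \<otimes>\<^bsub>?G\<^esub> block_emb a b y)"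
    by (simp add: x(1) y(1) block_emb_eq wreath_simps block_perm_comp[OF x(4,5) y(2,3)])
  then show "block_emb a b (x \<otimes>\<^bsub>wreath_sym F a \<times>\<times> wreath_sym F b\<^esub> y)
      = block_emb a b x \<otimes>\<^bsub>?G\<^esub> block_emb a b y"
    using fst by (simp add: prod_eq_iff fun_eq_iff)
qed

text \<open>Allows three consecutive blocks to be regrouped, so that two neighbouring blocks can be
  exchanged inside a single factor.\<close>

lemma block_emb_assoc:
  assumes "x \<in> carrier (wreath_sym F a)"
  shows "block_emb (a + b) c (block_emb a b (x, y), z) = block_emb a (b + c) (x, block_emb b c (y, z))"
proof -
  obtain f \<sigma> g \<tau> h \<rho> where xyz: "x = (f, \<sigma>)" "y = (g, \<tau>)" "z = (h, \<rho>)" by (metis surj_pair)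
  have "\<sigma> permutes {1..a}" using assms by (auto simp: xyz wreath_simps)
  then show ?thesis
    by (auto simp: xyz block_emb_eq fun_eq_iff block_perm_def)
qed

text \<open>Moves the first \<open>a\<close> points behind the last \<open>b\<close> ones. The case
  i = 0 is treated separately because the permuted points start at 1.\<close>

definition swap_perm :: "nat \<Rightarrow> nat \<Rightarrow> nat \<Rightarrow> nat"
  where "swap_perm a b i = (if i = 0 \<or> i > a + b then i else if i \<le> a then i + b else i - a)"

definition block_swap :: "('f, 'b) monoid_scheme \<Rightarrow> nat \<Rightarrow> nat \<Rightarrow> (nat \<Rightarrow> 'f) \<times> (nat \<Rightarrow> nat)"
  where "block_swap F a b = (\<lambda>i\<in>{1..a + b}. \<one>\<^bsub>F\<^esub>, swap_perm a b)"

lemma swap_perm_comp: "swap_perm b a \<circ> swap_perm a b = id"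
  by (auto simp: swap_perm_def fun_eq_iff)

lemma swap_perm_permutes: "swap_perm a b permutes {1..a + b}"
  using o_bij[OF swap_perm_comp[of b a] swap_perm_comp[of a b]]
  by (intro permutes_if_bij) (auto simp: swap_perm_def)

lemma block_swap_in: "group F \<Longrightarrow> block_swap F a b \<in> carrier (wreath_sym F (a + b))"
  using swap_perm_permutes[of a b] by (auto simp: block_swap_def wreath_simps group.is_monoid)

text \<open>The swap conjugates one block embedding into the other. The relation is kept free of
  inverses, which is the form that \<open>rep_iso_induced_conj\<close> asks for.\<close>

lemma block_emb_swap:
  assumes F: "group F" and x: "x \<in> carrier (wreath_sym F a)" and y: "y \<in> carrier (wreath_sym F b)"
  shows "block_emb b a (y, x) \<otimes>\<^bsub>wreath_sym F (a + b)\<^esub> block_swap F a b =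
    block_swap F a b \<otimes>\<^bsub>wreath_sym F (a + b)\<^esub> block_emb a b (x, y)"
proof -
  interpret F: group F by (rule F)
  obtain f \<sigma> g \<tau> where xy: "x = (f, \<sigma>)" "y = (g, \<tau>)" by (metis surj_pair)
  have p: "\<sigma> permutes {1..a}" "\<tau> permutes {1..b}" and fg: "\<And>i. 1 \<le> i \<Longrightarrow> i \<le> a \<Longrightarrow> f i \<in> carrier F"
    "\<And>i. 1 \<le> i \<Longrightarrow> i \<le> b \<Longrightarrow> g i \<in> carrier F"
    using x y by (auto simp: xy wreath_simps)
  have "block_perm b a \<tau> \<sigma> \<circ> swap_perm a b = swap_perm a b \<circ> block_perm a b \<sigma> \<tau>"
  proof
    fix i
    consider "i = 0" | "1 \<le> i" "i \<le> a" | "a < i" "i \<le> a + b" | "i > a + b" by linarith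
    then show "(block_perm b a \<tau> \<sigma> \<circ> swap_perm a b) i = (swap_perm a b \<circ> block_perm a b \<sigma> \<tau>) i"
    proof cases
      case 3
      then have "1 \<le> i - a" "i - a \<le> b" by auto
      then have "1 \<le> \<tau> (i - a) \<and> \<tau> (i - a) \<le> b" using permutes_cases(2)[OF p(2)] by blast
      then show ?thesis using 3 by (auto simp: block_perm_def swap_perm_def)
    qed (use permutes_cases(2)[OF p(1), of i] permutes_cases(1)[OF p(1)] permutes_cases(1)[OF p(2)]
      in \<open>auto simp: block_perm_def swap_perm_def\<close>)
  qed
  note snd = this
  have swap_inv: "inv' (swap_perm a b) = swap_perm b a"
    by (intro inv_unique_comp swap_perm_comp)
  have fst: "fst (block_emb b a (y, x) \<otimes>\<^bsub>wreath_sym F (a + b)\<^esub> block_swap F a b) i =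
    fst (block_swap F a b \<otimes>\<^bsub>wreath_sym F (a + b)\<^esub> block_emb a b (x, y)) i" for i
  proof (cases "i \<in> {1..a + b}")
    case False
    then show ?thesis by (auto simp: xy block_emb_eq block_swap_def wreath_simps)
  next
    case True
    have "inv' (block_perm b a \<tau> \<sigma>) i \<in> {1..a + b}"
      using permutes_le[OF permutes_inv[OF block_perm_permutes[OF p(2,1)]], of i] True
      by (simp add: add.commute)
    moreover have "swap_perm b a i \<in> {1..a + b}" "swap_perm b a i \<le> a \<longleftrightarrow> \<not> i \<le> b"
      "i \<le> b \<Longrightarrow> swap_perm b a i = i + a" "\<not> i \<le> b \<Longrightarrow> swap_perm b a i = i - b"
      using True by (auto simp: swap_perm_def)
    ultimately show ?thesis
      using True fg(1)[of "i - b"] fg(2)[of i]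
      by (auto simp: xy block_emb_eq block_swap_def wreath_simps swap_inv)
  qed
  have "snd (block_emb b a (y, x) \<otimes>\<^bsub>wreath_sym F (a + b)\<^esub> block_swap F a b) =
    snd (block_swap F a b \<otimes>\<^bsub>wreath_sym F (a + b)\<^esub> block_emb a b (x, y))"
    using snd by (simp add: xy block_emb_eq block_swap_def wreath_simps)
  then show ?thesis using fst by (simp add: prod_eq_iff fun_eq_iff)
qed

section \<open>Tabloids and polytabloids\<close>

lemma partitionsD:
  assumes "\<nu> \<in> partitions m"
  shows "sum_list \<nu> = m" "sorted_wrt (\<ge>) \<nu>" "i < length \<nu> \<Longrightarrow> 0 < \<nu> ! i"
    "i \<le> j \<Longrightarrow> j < length \<nu> \<Longrightarrow> \<nu> ! j \<le> \<nu> ! i"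
proof -
  show "sum_list \<nu> = m" and s: "sorted_wrt (\<ge>) \<nu>" using assms by (auto simp: partitions_def)
  show "0 < \<nu> ! i" if "i < length \<nu>"
    using assms nth_mem[OF that] by (auto simp: partitions_def intro!: gr0I)
  show "\<nu> ! j \<le> \<nu> ! i" if "i \<le> j" "j < length \<nu>"
    using sorted_wrt_nth_less[OF s, of i j] that by (cases "i = j") auto
qed

lemma diagram_eq_Sigma: "diagram \<nu> = (SIGMA i:{..<length \<nu>}. {..<\<nu> ! i})"
  by (auto simp: diagram_def)

lemma finite_diagram [simp]: "finite (diagram \<nu>)"
  by (simp add: diagram_eq_Sigma)

lemma card_diagram: "card (diagram \<nu>) = sum_list \<nu>"
  by (simp add: diagram_eq_Sigma sum_list_sum_nth atLeast0LessThan)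

lemma diagram_down:
  assumes "\<nu> \<in> partitions m" "(i, j) \<in> diagram \<nu>" "i' \<le> i" "j' \<le> j"
  shows "(i', j') \<in> diagram \<nu>"
  using assms partitionsD(4)[OF assms(1), of i' i] by (auto simp: diagram_def)

lemma length_le_sum: "\<nu> \<in> partitions m \<Longrightarrow> length \<nu> \<le> m"
proof -
  assume \<nu>: "\<nu> \<in> partitions m"
  have "(\<Sum>i<length \<nu>. 1) \<le> (\<Sum>i<length \<nu>. \<nu> ! i)"
    using partitionsD(3)[OF \<nu>] by (intro sum_mono) (simp add: Suc_le_eq)
  then show ?thesis
    using partitionsD(1)[OF \<nu>] by (simp add: sum_list_sum_nth atLeast0LessThan)
qed

text \<open>A finite set that contains the tabloids of every shape of size \<open>m\<close>, since a
  shape of size \<open>m\<close> has at most \<open>m\<close> rows. Members need not be tabloids;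
  what matters is that pairings become finite sums and do not depend on the shape.\<close>

definition tabs :: "nat \<Rightarrow> tabloid set"
  where "tabs m = {T. \<forall>i. (i \<in> {..<m} \<longrightarrow> T i \<in> Pow {1..m}) \<and> (i \<notin> {..<m} \<longrightarrow> T i = {})}"

lemma finite_tabs [simp]: "finite (tabs m)"
  unfolding tabs_def by (rule finite_set_of_finite_funs) auto

text \<open>The bilinear form with the indicator functions of \<open>tabs m\<close> as an
  orthonormal family. Conjugation is inserted by hand where positivity is used.\<close>

definition pairing :: "nat \<Rightarrow> (tabloid \<Rightarrow> complex) \<Rightarrow> (tabloid \<Rightarrow> complex) \<Rightarrow> complex"
  where "pairing m u v = (\<Sum>T\<in>tabs m. u T * v T)"

definition perm_act :: "(nat \<Rightarrow> nat) \<Rightarrow> (tabloid \<Rightarrow> complex) \<Rightarrow> (tabloid \<Rightarrow> complex)"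
  where "perm_act \<sigma> u = (\<lambda>T. u (\<lambda>i. inv' \<sigma> ` T i))"

lemma specht_simps:
  "vs (specht \<nu>) = cfun.span (polytabloid \<nu> ` tableaux \<nu>)"
  "act (specht \<nu>) = perm_act"
  by (simp_all add: specht_def perm_act_def fun_eq_iff)

abbreviation sgn_perm :: "(nat \<Rightarrow> nat) \<Rightarrow> complex"
  where "sgn_perm \<pi> \<equiv> of_int (sign \<pi>)"

lemma tableauxD:
  assumes "t \<in> tableaux \<nu>"
  shows "inj_on t (diagram \<nu>)" "t ` diagram \<nu> = {1..sum_list \<nu>}"
    "z \<in> diagram \<nu> \<Longrightarrow> t z \<in> {1..sum_list \<nu>}"
  using assms by (auto simp: tableaux_def bij_betw_def)

lemma tabloid_in_tabs:
  assumes "\<nu> \<in> partitions m" "t \<in> tableaux \<nu>"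
  shows "tabloid_of \<nu> t \<in> tabs m"
  using tableauxD(3)[OF assms(2)] partitionsD(1)[OF assms(1)] length_le_sum[OF assms(1)]
  by (force simp: tabs_def tabloid_of_def diagram_def)

lemma perm_tableaux:
  "\<pi> permutes {1..sum_list \<nu>} \<Longrightarrow> t \<in> tableaux \<nu> \<Longrightarrow> \<pi> \<circ> t \<in> tableaux \<nu>"
  unfolding tableaux_def by (auto intro: bij_betw_trans permutes_imp_bij)

lemma tabloid_of_comp: "tabloid_of \<nu> (\<pi> \<circ> t) = (\<lambda>i. \<pi> ` tabloid_of \<nu> t i)"
  by (auto simp: tabloid_of_def fun_eq_iff)

section \<open>Column stabilizers and polytabloids\<close>

definition col :: "nat list \<Rightarrow> (nat \<times> nat \<Rightarrow> nat) \<Rightarrow> nat \<Rightarrow> nat set"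
  where "col \<nu> t j = {t (i, j) |i. (i, j) \<in> diagram \<nu>}"

lemma col_comp: "col \<nu> (\<pi> \<circ> t) j = \<pi> ` col \<nu> t j"
  by (auto simp: col_def)

lemma column_stabilizer_iff:
  "\<pi> \<in> column_stabilizer \<nu> t \<longleftrightarrow> \<pi> permutes {1..sum_list \<nu>} \<and> (\<forall>j. \<pi> ` col \<nu> t j = col \<nu> t j)"
  by (simp add: column_stabilizer_def col_def)

lemma finite_column_stabilizer [simp]: "finite (column_stabilizer \<nu> t)"
  by (rule finite_subset[OF _ finite_permutations[of "{1..sum_list \<nu>}"]])
    (auto simp: column_stabilizer_iff)

lemma image_o: "(f \<circ> g) ` A = f ` g ` A"
  by (rule image_comp[symmetric])

lemma column_stabilizer_comp:
  "\<pi> \<in> column_stabilizer \<nu> t \<Longrightarrow> \<rho> \<in> column_stabilizer \<nu> t \<Longrightarrow> \<pi> \<circ> \<rho> \<in> column_stabilizer \<nu> t"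
  by (simp only: column_stabilizer_iff permutes_compose image_o simp_thms)

lemma column_stabilizer_inv:
  assumes "\<pi> \<in> column_stabilizer \<nu> t"
  shows "inv' \<pi> \<in> column_stabilizer \<nu> t"
proof -
  have p: "\<pi> permutes {1..sum_list \<nu>}" using assms by (simp add: column_stabilizer_iff)
  have "inv' \<pi> ` col \<nu> t j = col \<nu> t j" for j
  proof -
    have "inv' \<pi> ` col \<nu> t j = inv' \<pi> ` \<pi> ` col \<nu> t j" using assms by (simp add: column_stabilizer_iff)
    also have "\<dots> = col \<nu> t j" by (simp add: image_comp permutes_inv_o[OF p])
    finally show ?thesis .
  qed
  then show ?thesis using permutes_inv[OF p] by (simp add: column_stabilizer_iff)
qed

lemma id_column_stabilizer: "id \<in> column_stabilizer \<nu> t"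
  by (simp add: column_stabilizer_iff permutes_id)

lemma same_column:
  assumes "t \<in> tableaux \<nu>" "\<pi> \<in> column_stabilizer \<nu> t" "(i, j) \<in> diagram \<nu>" "(i', j') \<in> diagram \<nu>"
    "\<pi> (t (i, j)) = t (i', j')"
  shows "j' = j"
proof -
  have "t (i, j) \<in> col \<nu> t j" using assms(3) by (auto simp: col_def)
  then have "t (i', j') \<in> col \<nu> t j" using assms(2,5) by (force simp: column_stabilizer_iff)
  then obtain i'' where "(i'', j) \<in> diagram \<nu>" "t (i', j') = t (i'', j)" by (auto simp: col_def)
  then show ?thesis using tableauxD(1)[OF assms(1)] assms(4) by (auto dest: inj_onD)
qed

lemma polytabloid_apply:
  "polytabloid \<nu> t T = (\<Sum>\<pi>\<in>column_stabilizer \<nu> t. sgn_perm \<pi> * (if T = tabloid_of \<nu> (\<pi> \<circ> t) then 1 else 0))"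
  by (simp add: polytabloid_def sum_fun_apply cscale_def)

text \<open>Pairing against a polytabloid becomes a signed sum of values over column permutations,
  the form in which all later cancellations take place.\<close>

lemma pairing_polytabloid:
  assumes \<nu>: "\<nu> \<in> partitions m" and t: "t \<in> tableaux \<nu>"
  shows "pairing m u (polytabloid \<nu> t)
    = (\<Sum>\<pi>\<in>column_stabilizer \<nu> t. sgn_perm \<pi> * u (tabloid_of \<nu> (\<pi> \<circ> t)))"
proof -
  have "pairing m u (polytabloid \<nu> t) = (\<Sum>T\<in>tabs m. \<Sum>\<pi>\<in>column_stabilizer \<nu> t.
      u T * (sgn_perm \<pi> * (if T = tabloid_of \<nu> (\<pi> \<circ> t) then 1 else 0)))"
    by (simp add: pairing_def polytabloid_apply sum_distrib_left)
  also have "\<dots> = (\<Sum>\<pi>\<in>column_stabilizer \<nu> t. \<Sum>T\<in>tabs m.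
      if T = tabloid_of \<nu> (\<pi> \<circ> t) then sgn_perm \<pi> * u T else 0)"
    by (subst sum.swap) (intro sum.cong; auto)
  also have "\<dots> = (\<Sum>\<pi>\<in>column_stabilizer \<nu> t. sgn_perm \<pi> * u (tabloid_of \<nu> (\<pi> \<circ> t)))"
    using tabloid_in_tabs[OF \<nu> perm_tableaux[OF _ t]]
    by (intro sum.cong refl) (auto simp: column_stabilizer_iff)
  finally show ?thesis .
qed

lemma sign_perm_comp:
  "\<pi> permutes {1..m} \<Longrightarrow> \<rho> permutes {1..m'} \<Longrightarrow> sgn_perm (\<pi> \<circ> \<rho>) = sgn_perm \<pi> * sgn_perm \<rho>"
  by (simp add: sign_compose[OF permutes_imp_permutation[OF finite_atLeastAtMost]
    permutes_imp_permutation[OF finite_atLeastAtMost]])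

lemma sign_perm_conj:
  assumes "\<pi> permutes {1..m}" "\<sigma> permutes {1..m'}"
  shows "sgn_perm (\<sigma> \<circ> \<pi> \<circ> inv' \<sigma>) = sgn_perm \<pi>"
proof -
  have p: "permutation \<pi>" "permutation \<sigma>" "permutation (inv' \<sigma>)"
    using assms permutes_inv[OF assms(2)] by (auto intro: permutes_imp_permutation[OF finite_atLeastAtMost])
  have "sign (\<sigma> \<circ> \<pi> \<circ> inv' \<sigma>) = sign \<sigma> * sign \<pi> * sign \<sigma>"
    using p by (simp add: sign_compose permutation_compose sign_inverse)
  also have "\<dots> = sign \<pi>" by (simp add: sign_def)
  finally show ?thesis by simp
qed

text \<open>The column stabilizer of \<sigma> \<circ> t is the conjugate by \<sigma> of that of t,
  and conjugation preserves signs; the sum is reindexed accordingly.\<close>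

lemma perm_act_polytabloid:
  assumes \<sigma>: "\<sigma> permutes {1..sum_list \<nu>}"
  shows "perm_act \<sigma> (polytabloid \<nu> t) = polytabloid \<nu> (\<sigma> \<circ> t)"
proof
  fix T
  have inv: "inv' \<sigma> \<circ> \<sigma> = id" "\<sigma> \<circ> inv' \<sigma> = id" by (simp_all add: permutes_inv_o[OF \<sigma>])
  have i1: "inv' \<sigma> ` \<sigma> ` A = A" "\<sigma> ` inv' \<sigma> ` A = A" for A
    by (simp_all only: image_comp inv image_id id_apply)
  have bij: "bij_betw (\<lambda>\<pi>. \<sigma> \<circ> \<pi> \<circ> inv' \<sigma>) (column_stabilizer \<nu> t) (column_stabilizer \<nu> (\<sigma> \<circ> t))"
  proof (rule bij_betw_byWitness[where f' = "\<lambda>\<pi>. inv' \<sigma> \<circ> \<pi> \<circ> \<sigma>"])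
    show "\<forall>\<pi>\<in>column_stabilizer \<nu> t. inv' \<sigma> \<circ> (\<sigma> \<circ> \<pi> \<circ> inv' \<sigma>) \<circ> \<sigma> = \<pi>"
      by (simp add: o_assoc inv) (simp add: o_assoc[symmetric] inv)
    show "\<forall>\<pi>\<in>column_stabilizer \<nu> (\<sigma> \<circ> t). \<sigma> \<circ> (inv' \<sigma> \<circ> \<pi> \<circ> \<sigma>) \<circ> inv' \<sigma> = \<pi>"
      by (simp add: o_assoc inv) (simp add: o_assoc[symmetric] inv)
    have p: "\<sigma> \<circ> \<pi> \<circ> inv' \<sigma> permutes {1..sum_list \<nu>}" "inv' \<sigma> \<circ> \<pi> \<circ> \<sigma> permutes {1..sum_list \<nu>}"
      if "\<pi> permutes {1..sum_list \<nu>}" for \<pi>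
      using that \<sigma> permutes_inv[OF \<sigma>] by (blast intro: permutes_compose)+
    show "(\<lambda>\<pi>. \<sigma> \<circ> \<pi> \<circ> inv' \<sigma>) ` column_stabilizer \<nu> t \<subseteq> column_stabilizer \<nu> (\<sigma> \<circ> t)"
      by (clarsimp simp only: column_stabilizer_iff col_comp image_o i1 p simp_thms)
    show "(\<lambda>\<pi>. inv' \<sigma> \<circ> \<pi> \<circ> \<sigma>) ` column_stabilizer \<nu> (\<sigma> \<circ> t) \<subseteq> column_stabilizer \<nu> t"
      by (clarsimp simp only: column_stabilizer_iff col_comp image_o i1 p simp_thms)
  qed
  have "polytabloid \<nu> (\<sigma> \<circ> t) T = (\<Sum>\<pi>\<in>column_stabilizer \<nu> t. sgn_perm (\<sigma> \<circ> \<pi> \<circ> inv' \<sigma>) *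
      (if T = tabloid_of \<nu> (\<sigma> \<circ> \<pi> \<circ> inv' \<sigma> \<circ> (\<sigma> \<circ> t)) then 1 else 0))"
    unfolding polytabloid_apply by (rule sum.reindex_bij_betw[OF bij, symmetric])
  also have "\<dots> = (\<Sum>\<pi>\<in>column_stabilizer \<nu> t. sgn_perm \<pi> *
      (if (\<lambda>i. inv' \<sigma> ` T i) = tabloid_of \<nu> (\<pi> \<circ> t) then 1 else 0))"
  proof (rule sum.cong[OF refl])
    fix \<pi> assume \<pi>: "\<pi> \<in> column_stabilizer \<nu> t"
    have "\<sigma> \<circ> \<pi> \<circ> inv' \<sigma> \<circ> (\<sigma> \<circ> t) = \<sigma> \<circ> (\<pi> \<circ> (inv' \<sigma> \<circ> \<sigma>) \<circ> t)"
      by (simp only: o_assoc)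
    then have e: "\<sigma> \<circ> \<pi> \<circ> inv' \<sigma> \<circ> (\<sigma> \<circ> t) = \<sigma> \<circ> (\<pi> \<circ> t)" by (simp add: inv)
    have "T = tabloid_of \<nu> (\<sigma> \<circ> (\<pi> \<circ> t)) \<longleftrightarrow> (\<lambda>i. inv' \<sigma> ` T i) = tabloid_of \<nu> (\<pi> \<circ> t)"
    proof
      assume "(\<lambda>i. inv' \<sigma> ` T i) = tabloid_of \<nu> (\<pi> \<circ> t)"
      from this[symmetric] show "T = tabloid_of \<nu> (\<sigma> \<circ> (\<pi> \<circ> t))"
        by (simp only: tabloid_of_comp[of \<nu> \<sigma>] i1)
    qed (simp only: tabloid_of_comp[of \<nu> \<sigma>] i1)
    then show "sgn_perm (\<sigma> \<circ> \<pi> \<circ> inv' \<sigma>) * (if T = tabloid_of \<nu> (\<sigma> \<circ> \<pi> \<circ> inv' \<sigma> \<circ> (\<sigma> \<circ> t)) then 1 else 0)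
        = sgn_perm \<pi> * (if (\<lambda>i. inv' \<sigma> ` T i) = tabloid_of \<nu> (\<pi> \<circ> t) then 1 else 0)"
      using \<pi> \<sigma> sign_perm_conj[of \<pi> "sum_list \<nu>" \<sigma>] by (simp only: e) (simp add: column_stabilizer_iff)
  qed
  also have "\<dots> = perm_act \<sigma> (polytabloid \<nu> t) T"
    by (simp add: perm_act_def polytabloid_apply)
  finally show "perm_act \<sigma> (polytabloid \<nu> t) T = polytabloid \<nu> (\<sigma> \<circ> t) T" by simp
qed

text \<open>Tableaux are arbitrary off the diagram, so there are infinitely many of them; only their
  restrictions count, which leaves finitely many polytabloids.\<close>

lemma polytabloid_cong:
  assumes "\<And>z. z \<in> diagram \<nu> \<Longrightarrow> t z = t' z"
  shows "polytabloid \<nu> t = polytabloid \<nu> t'"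
proof -
  have "tabloid_of \<nu> (\<pi> \<circ> t) = tabloid_of \<nu> (\<pi> \<circ> t')" for \<pi>
    unfolding tabloid_of_def by (intro ext Collect_cong ex_cong1) (auto simp: assms)
  moreover have "col \<nu> t = col \<nu> t'"
    unfolding col_def by (intro ext Collect_cong ex_cong1) (auto simp: assms)
  then have "column_stabilizer \<nu> t = column_stabilizer \<nu> t'"
    by (auto simp: column_stabilizer_iff)
  ultimately show ?thesis by (simp add: polytabloid_def)
qed

text \<open>Taken as a set, not as a family indexed by tableaux: it is finite, and permutations act
  on it bijectively.\<close>

definition polytabloids :: "nat list \<Rightarrow> (tabloid \<Rightarrow> complex) set"
  where "polytabloids \<nu> = polytabloid \<nu> ` tableaux \<nu>"

lemma finite_polytabloids [simp]: "finite (polytabloids \<nu>)"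
proof (rule finite_subset)
  show "polytabloids \<nu> \<subseteq> polytabloid \<nu> ` (diagram \<nu> \<rightarrow>\<^sub>E {1..sum_list \<nu>})"
  proof
    fix e assume "e \<in> polytabloids \<nu>"
    then obtain t where t: "t \<in> tableaux \<nu>" "e = polytabloid \<nu> t" by (auto simp: polytabloids_def)
    have "e = polytabloid \<nu> (restrict t (diagram \<nu>))"
      unfolding t(2) by (rule polytabloid_cong) simp
    moreover have "restrict t (diagram \<nu>) \<in> diagram \<nu> \<rightarrow>\<^sub>E {1..sum_list \<nu>}"
      by (intro restrict_PiE_iff[THEN iffD2] ballI tableauxD(3)[OF t(1)])
    ultimately show "e \<in> polytabloid \<nu> ` (diagram \<nu> \<rightarrow>\<^sub>E {1..sum_list \<nu>})"
      by (rule image_eqI)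
  qed
qed (intro finite_imageI finite_PiE; simp)

section \<open>The symmetric group acting on a Specht module\<close>

lemma linear_perm_act: "linear_between UNIV UNIV (perm_act \<sigma>)"
  by (rule linear_betweenI) (auto simp: perm_act_def)

lemma perm_act_polytabloids:
  assumes "\<sigma> permutes {1..sum_list \<nu>}"
  shows "e \<in> polytabloids \<nu> \<Longrightarrow> perm_act \<sigma> e \<in> polytabloids \<nu>"
  using perm_act_polytabloid[OF assms] perm_tableaux[OF assms] by (auto simp: polytabloids_def)

lemma perm_act_comp:
  assumes "bij \<sigma>" "bij \<tau>"
  shows "perm_act (\<sigma> \<circ> \<tau>) u = perm_act \<sigma> (perm_act \<tau> u)"
  using assms by (simp add: perm_act_def o_inv_distrib image_comp)

lemma perm_act_id: "perm_act id u = u"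
  by (simp add: perm_act_def)

lemma fin_dim_specht: "fin_dim (vs (specht \<nu>))"
  using finite_polytabloids[of \<nu>] by (auto simp: fin_dim_def specht_simps polytabloids_def)

lemma perm_act_specht:
  assumes "\<sigma> permutes {1..sum_list \<nu>}" "u \<in> vs (specht \<nu>)"
  shows "perm_act \<sigma> u \<in> vs (specht \<nu>)"
  using assms(2) unfolding specht_simps polytabloids_def[symmetric]
proof (induction rule: span_induct')
  case zero
  then show ?case using subspace_0[OF cfun.subspace_span] by (simp add: perm_act_def)
next
  case (step c a v)
  have "perm_act \<sigma> (\<lambda>x. c * a x + v x) = (\<lambda>x. c * perm_act \<sigma> a x + perm_act \<sigma> v x)"
    by (simp add: perm_act_def)
  then show ?case
    using subspace_lincomb[OF cfun.subspace_span cfun.span_base[OF perm_act_polytabloids[OF assms(1) step(1)]] step(3)]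
    by simp
qed

lemma group_rep_specht:
  assumes "\<nu> \<in> partitions m"
  shows "group_rep (sym_group m) (specht \<nu>)"
  unfolding group_rep_iff
proof (intro conjI ballI)
  note m = partitionsD(1)[OF assms]
  show "linear_between (vs (specht \<nu>)) (vs (specht \<nu>)) (act (specht \<nu>) \<sigma>)"
    if "\<sigma> \<in> carrier (sym_group m)" for \<sigma>
    using perm_act_specht[of \<sigma> \<nu>] that m
    by (intro linear_betweenI) (auto simp: specht_simps(2) sym_group_carrier perm_act_def)
  show "act (specht \<nu>) \<one>\<^bsub>sym_group m\<^esub> u = u" for u
    by (simp add: specht_simps(2) perm_act_def sym_group_one inv_id[unfolded id_def] id_def)
  show "act (specht \<nu>) (\<sigma> \<otimes>\<^bsub>sym_group m\<^esub> \<tau>) u = act (specht \<nu>) \<sigma> (act (specht \<nu>) \<tau> u)"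
    if "\<sigma> \<in> carrier (sym_group m)" "\<tau> \<in> carrier (sym_group m)" for \<sigma> \<tau> u
    using that perm_act_comp[of \<sigma> \<tau> u]
    by (simp add: specht_simps sym_group_mult sym_group_carrier permutes_bij)
qed (rule sym_group_is_group fin_dim_specht)+

subsection \<open>The Gram operator\<close>

text \<open>A sum of rank-one operators, one for each real vector \<open>e\<close>, hence positive
  semidefinite. It takes the place of the orthogonal projection onto the Specht module and needs no
  orthonormal basis.\<close>

definition gram :: "nat list \<Rightarrow> (tabloid \<Rightarrow> complex) \<Rightarrow> (tabloid \<Rightarrow> complex)"
  where "gram \<nu> u = (\<lambda>T. \<Sum>e\<in>polytabloids \<nu>. pairing (sum_list \<nu>) u e * e T)"

lemma pairing_linear:
  "pairing m (\<lambda>T. u T + v T) w = pairing m u w + pairing m v w"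
  "pairing m (\<lambda>T. c * u T) w = c * pairing m u w"
  "pairing m (\<lambda>T. 0) w = 0"
  by (simp_all add: pairing_def sum.distrib algebra_simps sum_distrib_left)

lemma pairing_sum: "pairing m (\<lambda>T. \<Sum>i\<in>I. f i T) w = (\<Sum>i\<in>I. pairing m (f i) w)"
  by (induction I rule: infinite_finite_induct) (simp_all add: pairing_linear)

lemma linear_gram: "linear_between UNIV (vs (specht \<nu>)) (gram \<nu>)"
proof (rule linear_betweenI)
  show "gram \<nu> u \<in> vs (specht \<nu>)" for u
    unfolding gram_def specht_simps polytabloids_def[symmetric]
    by (intro subspace_sum subspace_scale cfun.subspace_span cfun.span_base)
qed (simp_all add: gram_def pairing_linear sum.distrib algebra_simps sum_distrib_left)

lemma cnj_polytabloid: "cnj (polytabloid \<nu> t T) = polytabloid \<nu> t T"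
  by (auto simp: polytabloid_apply intro!: sum.cong)

text \<open>Polytabloids are real-valued, so the bilinear pairing is positive definite on their span.\<close>

lemma pairing_pos_def:
  assumes \<nu>: "\<nu> \<in> partitions m" and v: "v \<in> vs (specht \<nu>)" and 0: "\<And>e. e \<in> polytabloids \<nu> \<Longrightarrow> pairing m v e = 0"
  shows "v = (\<lambda>T. 0)"
proof -
  \<comment> \<open>Orthogonality to the polytabloids extends to conjugates of all vectors of the
    module, in particular of \<open>v\<close>. The pairing sees only values on
    \<open>tabs m\<close>, so vanishing elsewhere is carried along.\<close>
  have "pairing m v (\<lambda>T. cnj (w T)) = 0 \<and> (\<forall>T. T \<notin> tabs m \<longrightarrow> w T = 0)" if "w \<in> vs (specht \<nu>)" for w
    using that unfolding specht_simps polytabloids_def[symmetric]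
  proof (induction rule: span_induct')
    case zero
    then show ?case by (simp add: pairing_def)
  next
    case (step c a w)
    obtain t where t: "t \<in> tableaux \<nu>" "a = polytabloid \<nu> t" using step(1) by (auto simp: polytabloids_def)
    have "pairing m v (\<lambda>T. cnj (c * a T + w T)) = cnj c * pairing m v a + pairing m v (\<lambda>T. cnj (w T))"
      unfolding t(2) by (simp add: pairing_def algebra_simps sum.distrib sum_distrib_left cnj_polytabloid)
    moreover have "a T = 0" if "T \<notin> tabs m" for T
      unfolding t(2) polytabloid_apply
      using tabloid_in_tabs[OF \<nu> perm_tableaux[OF _ t(1)]] that
      by (intro sum.neutral) (auto simp: column_stabilizer_iff)
    ultimately show ?case using step 0 by simp
  qed
  from this[OF v] have s: "(\<Sum>T\<in>tabs m. v T * cnj (v T)) = 0" and out: "\<And>T. T \<notin> tabs m \<Longrightarrow> v T = 0"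
    by (auto simp: pairing_def)
  have "complex_of_real (\<Sum>T\<in>tabs m. (cmod (v T))\<^sup>2) = 0"
    using s by (simp add: complex_norm_square del: of_real_power)
  then have "(\<Sum>T\<in>tabs m. (cmod (v T))\<^sup>2) = 0" using of_real_eq_0_iff by blast
  then have "\<forall>T\<in>tabs m. v T = 0"
    by (subst (asm) sum_nonneg_eq_0_iff) auto
  then show ?thesis using out by auto
qed

text \<open>Pairing \<open>gram \<nu> u\<close> with the conjugate of \<open>u\<close> gives the sum
  of the squared absolute values of the pairings of \<open>u\<close> with the polytabloids, which
  are real.\<close>

lemma gram_eq_0:
  assumes \<nu>: "\<nu> \<in> partitions m" and 0: "gram \<nu> u = (\<lambda>T. 0)" and e: "e \<in> polytabloids \<nu>"
  shows "pairing m u e = 0"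
proof -
  let ?c = "\<lambda>e. pairing m u e"
  have "0 = pairing m (\<lambda>T. cnj (u T)) (gram \<nu> u)" by (simp add: 0 pairing_def)
  also have "\<dots> = (\<Sum>e\<in>polytabloids \<nu>. ?c e * pairing m (\<lambda>T. cnj (u T)) e)"
    unfolding gram_def pairing_def partitionsD(1)[OF \<nu>] sum_distrib_left
    by (subst sum.swap) (simp add: algebra_simps sum_distrib_left)
  also have "\<dots> = (\<Sum>e\<in>polytabloids \<nu>. ?c e * cnj (?c e))"
  proof (rule sum.cong[OF refl])
    fix e assume "e \<in> polytabloids \<nu>"
    then show "?c e * pairing m (\<lambda>T. cnj (u T)) e = ?c e * cnj (?c e)"
      by (auto simp: pairing_def polytabloids_def cnj_polytabloid)
  qed
  also have "\<dots> = complex_of_real (\<Sum>e\<in>polytabloids \<nu>. (cmod (?c e))\<^sup>2)"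
    by (simp add: complex_norm_square del: of_real_power)
  finally have "(\<Sum>e\<in>polytabloids \<nu>. (cmod (?c e))\<^sup>2) = 0" using of_real_eq_0_iff by metis
  then have "\<forall>e\<in>polytabloids \<nu>. ?c e = 0"
    by (subst (asm) sum_nonneg_eq_0_iff) auto
  then show ?thesis using e by blast
qed

lemma pairing_perm_act:
  assumes \<sigma>: "\<sigma> permutes {1..m}"
  shows "pairing m (perm_act \<sigma> u) (perm_act \<sigma> v) = pairing m u v"
proof -
  have i1: "inv' \<sigma> ` \<sigma> ` A = A" "\<sigma> ` inv' \<sigma> ` A = A" for A
    by (simp_all only: image_comp permutes_inv_o[OF \<sigma>] image_id id_apply)
  have im: "(\<lambda>i. \<tau> ` T i) \<in> tabs m" if "\<tau> permutes {1..m}" "T \<in> tabs m" for \<tau> T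
    using that(2) image_mono[of _ "{1..m}" \<tau>] unfolding tabs_def permutes_image[OF that(1)] by simp
  have "bij_betw (\<lambda>T i. inv' \<sigma> ` T i) (tabs m) (tabs m)"
    by (rule bij_betw_byWitness[where f' = "\<lambda>T i. \<sigma> ` T i"])
      (use im[OF \<sigma>] im[OF permutes_inv[OF \<sigma>]] in \<open>auto simp only: i1\<close>)
  then show ?thesis
    unfolding pairing_def perm_act_def by (rule sum.reindex_bij_betw)
qed

text \<open>A permutation preserves the pairing and permutes the polytabloids over which the
  operator sums.\<close>

lemma gram_perm_act:
  assumes \<sigma>: "\<sigma> permutes {1..sum_list \<nu>}"
  shows "gram \<nu> (perm_act \<sigma> u) = perm_act \<sigma> (gram \<nu> u)"
proof
  fix T
  have pp: "perm_act \<sigma> (perm_act (inv' \<sigma>) u) = u" "perm_act (inv' \<sigma>) (perm_act \<sigma> u) = u" for u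
    by (simp_all only: perm_act_comp[OF permutes_bij[OF \<sigma>] permutes_bij[OF permutes_inv[OF \<sigma>]], symmetric]
      perm_act_comp[OF permutes_bij[OF permutes_inv[OF \<sigma>]] permutes_bij[OF \<sigma>], symmetric]
      permutes_inv_o[OF \<sigma>] perm_act_id)
  have "bij_betw (perm_act \<sigma>) (polytabloids \<nu>) (polytabloids \<nu>)"
    by (rule bij_betw_byWitness[where f' = "perm_act (inv' \<sigma>)"])
      (use pp perm_act_polytabloids[OF \<sigma>] perm_act_polytabloids[OF permutes_inv[OF \<sigma>]] in auto)
  from sum.reindex_bij_betw[OF this, of "\<lambda>e. pairing (sum_list \<nu>) (perm_act \<sigma> u) e * e T"]
  show "gram \<nu> (perm_act \<sigma> u) T = perm_act \<sigma> (gram \<nu> u) T"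
    by (simp add: gram_def pairing_perm_act[OF \<sigma>]) (simp add: perm_act_def gram_def)
qed

section \<open>Adding and removing a box\<close>

text \<open>A row exists exactly if its first cell does, because partitions have no zero parts; for
  arbitrary lists such as [1] and [1, 0] the diagram would not suffice.\<close>

lemma diagram_inj:
  assumes "\<nu> \<in> partitions m" "\<nu>' \<in> partitions m'" "diagram \<nu> = diagram \<nu>'"
  shows "\<nu> = \<nu>'"
proof (rule nth_equalityI)
  have len: "i < length \<nu> \<longleftrightarrow> (i, 0) \<in> diagram \<nu>" if "\<nu> \<in> partitions m" for i \<nu> m
    using partitionsD(3)[OF that, of i] by (auto simp: diagram_def)
  have lt: "i < length \<nu> \<longleftrightarrow> i < length \<nu>'" for i
    using len[OF assms(1), of i] len[OF assms(2), of i] assms(3) by simp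
  then show "length \<nu> = length \<nu>'" by (meson linorder_neqE_nat less_irrefl)
  fix i assume i: "i < length \<nu>"
  have "j < \<nu> ! i \<longleftrightarrow> j < \<nu>' ! i" for j
  proof -
    have "j < \<nu> ! i \<longleftrightarrow> (i, j) \<in> diagram \<nu>" using i by (simp add: diagram_def)
    also have "\<dots> \<longleftrightarrow> j < \<nu>' ! i" using i lt[of i] unfolding assms(3) by (simp add: diagram_def)
    finally show ?thesis .
  qed
  then show "\<nu> ! i = \<nu>' ! i" by (meson linorder_neqE_nat less_irrefl)
qed

lemma finite_partitions: "finite (partitions m)"
proof (rule finite_subset)
  show "partitions m \<subseteq> {xs. set xs \<subseteq> {..m} \<and> length xs \<le> m}"
    using length_le_sum member_le_sum_list by (fastforce simp: partitions_def)
qed (rule finite_lists_length_le, simp)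

lemma add_box_partitions: "\<nu> \<in> partitions m \<Longrightarrow> \<tau> \<in> add_box \<nu> \<Longrightarrow> \<tau> \<in> partitions (m + 1)"
  by (auto simp: add_box_def dest: partitionsD(1))

lemma finite_add_box [simp]: "finite (add_box \<nu>)"
  by (rule finite_subset[OF _ finite_partitions[of "sum_list \<nu> + 1"]]) (auto simp: add_box_def)

definition new_cell :: "nat list \<Rightarrow> nat list \<Rightarrow> nat \<times> nat"
  where "new_cell \<nu> \<tau> = (THE c. c \<notin> diagram \<nu> \<and> diagram \<tau> = insert c (diagram \<nu>))"

lemma new_cell:
  assumes "\<tau> \<in> add_box \<nu>"
  shows "new_cell \<nu> \<tau> \<notin> diagram \<nu>" "diagram \<tau> = insert (new_cell \<nu> \<tau>) (diagram \<nu>)"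
proof -
  obtain c where c: "c \<notin> diagram \<nu> \<and> diagram \<tau> = insert c (diagram \<nu>)"
    using assms by (auto simp: add_box_def)
  have "new_cell \<nu> \<tau> \<notin> diagram \<nu> \<and> diagram \<tau> = insert (new_cell \<nu> \<tau>) (diagram \<nu>)"
    unfolding new_cell_def by (rule theI[of _ c]) (use c in auto)
  then show "new_cell \<nu> \<tau> \<notin> diagram \<nu>" "diagram \<tau> = insert (new_cell \<nu> \<tau>) (diagram \<nu>)" by auto
qed

abbreviation new_row :: "nat list \<Rightarrow> nat list \<Rightarrow> nat"
  where "new_row \<nu> \<tau> \<equiv> fst (new_cell \<nu> \<tau>)"

section \<open>The position of an added box\<close>

lemma above_new_cell:
  assumes "\<nu> \<in> partitions m" "\<tau> \<in> add_box \<nu>" "new_cell \<nu> \<tau> = (r, c)" "i < r"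
  shows "(i, c) \<in> diagram \<nu>"
  using diagram_down[OF add_box_partitions[OF assms(1,2)], of r c i c] new_cell[OF assms(2)] assms
  by auto

lemma below_new_cell:
  assumes "\<nu> \<in> partitions m" "\<tau> \<in> add_box \<nu>" "new_cell \<nu> \<tau> = (r, c)" "r < i"
  shows "(i, c) \<notin> diagram \<tau>"
  using diagram_down[OF assms(1), of i c r c] new_cell[OF assms(2)] assms by auto

text \<open>Rows have no gaps: of two boxes added in one row, the one further right would force the
  other into \<nu>. Rows thus order the shapes above \<nu> linearly, which the triangularity
  argument needs.\<close>

lemma new_row_inj:
  assumes \<nu>: "\<nu> \<in> partitions m" and \<tau>: "\<tau> \<in> add_box \<nu>" "\<tau>' \<in> add_box \<nu>" and eq: "new_row \<nu> \<tau> = new_row \<nu> \<tau>'"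
  shows "\<tau> = \<tau>'"
proof -
  obtain r c c' where rc: "new_cell \<nu> \<tau> = (r, c)" "new_cell \<nu> \<tau>' = (r, c')"
    using eq by (metis prod.collapse)
  have "(r, c) \<in> diagram \<nu>" if "new_cell \<nu> \<tau>' = (r, c')" "\<tau>' \<in> add_box \<nu>" "c < c'" for c c' \<tau>'
    using diagram_down[OF add_box_partitions[OF \<nu> that(2)], of r c' r c] new_cell[OF that(2)] that by auto
  then have "c = c'" using rc \<tau> new_cell(1) by (metis linorder_neqE_nat)
  then show ?thesis
    using diagram_inj[OF add_box_partitions[OF \<nu> \<tau>(1)] add_box_partitions[OF \<nu> \<tau>(2)]]
      new_cell(2)[OF \<tau>(1)] new_cell(2)[OF \<tau>(2)] rc by simp
qed

text \<open>The counterpart for removal: if the box removed for \<nu> lay further left than the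
  other one, the latter would remain in \<nu> and keep the former there.\<close>

lemma new_row_inj':
  assumes \<nu>: "\<nu> \<in> partitions m" "\<nu>' \<in> partitions m" and \<tau>: "\<tau> \<in> add_box \<nu>" "\<tau> \<in> add_box \<nu>'"
    and eq: "new_row \<nu> \<tau> = new_row \<nu>' \<tau>"
  shows "\<nu> = \<nu>'"
proof -
  obtain r c c' where rc: "new_cell \<nu> \<tau> = (r, c)" "new_cell \<nu>' \<tau> = (r, c')"
    using eq by (metis prod.collapse)
  have "(r, c) \<in> diagram \<nu>" if "\<nu> \<in> partitions m" "new_cell \<nu> \<tau> = (r, c)" "\<tau> \<in> add_box \<nu>"
      "(r, c') \<in> diagram \<tau>" "c < c'" for c c' \<nu>
    using diagram_down[OF that(1), of r c' r c] new_cell[OF that(3)] that by auto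
  then have "c = c'" using rc \<tau> \<nu> new_cell by (metis insertI1 linorder_neqE_nat)
  moreover have "diagram \<nu> = diagram \<tau> - {new_cell \<nu> \<tau>}" "diagram \<nu>' = diagram \<tau> - {new_cell \<nu>' \<tau>}"
    using new_cell[OF \<tau>(1)] new_cell[OF \<tau>(2)] by auto
  ultimately show ?thesis using diagram_inj[OF \<nu>] rc by simp
qed

lemma col_new_cell:
  assumes "\<tau> \<in> add_box \<nu>" "new_cell \<nu> \<tau> = (r, c)"
  shows "col \<tau> s j = (if j = c then insert (s (r, c)) (col \<nu> s j) else col \<nu> s j)"
  using new_cell(2)[OF assms(1)] assms(2) by (auto simp: col_def)

lemma tabloid_new_cell:
  assumes "\<tau> \<in> add_box \<nu>" "new_cell \<nu> \<tau> = (r, c)"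
  shows "tabloid_of \<tau> s = (tabloid_of \<nu> s)(r := insert (s (r, c)) (tabloid_of \<nu> s r))"
  using new_cell(2)[OF assms(1)] assms(2) by (auto simp: tabloid_of_def fun_eq_iff)

lemma new_entry_notin:
  assumes \<tau>: "\<tau> \<in> add_box \<nu>" and s: "s \<in> tableaux \<tau>" and z: "z \<in> diagram \<nu>"
  shows "s z \<noteq> s (new_cell \<nu> \<tau>)"
proof
  assume "s z = s (new_cell \<nu> \<tau>)"
  then have "z = new_cell \<nu> \<tau>"
    using inj_onD[OF tableauxD(1)[OF s]] new_cell(2)[OF \<tau>] z by blast
  then show False using new_cell(1)[OF \<tau>] z by simp
qed

text \<open>The new entry lies outside the columns of \<nu>, and deleting a fixed point from a
  column does not affect its invariance. The column permutations of \<tau> that fix the new entry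
  are thus those of the part of shape \<nu>.\<close>

lemma stabilizer_fixing_new_entry:
  assumes \<tau>: "\<tau> \<in> add_box \<nu>" and s: "s \<in> tableaux \<tau>"
  shows "\<pi> \<in> column_stabilizer \<tau> s \<and> \<pi> (s (new_cell \<nu> \<tau>)) = s (new_cell \<nu> \<tau>) \<longleftrightarrow>
    \<pi> permutes {1..sum_list \<tau>} \<and> \<pi> (s (new_cell \<nu> \<tau>)) = s (new_cell \<nu> \<tau>) \<and> (\<forall>j. \<pi> ` col \<nu> s j = col \<nu> s j)"
    (is "?L \<longleftrightarrow> ?R")
proof -
  obtain r c where rc: "new_cell \<nu> \<tau> = (r, c)" by force
  let ?x = "s (r, c)"
  have x: "?x \<notin> col \<nu> s j" for j
    using new_entry_notin[OF \<tau> s] by (force simp: col_def rc)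
  have "\<pi> ` col \<tau> s j = col \<tau> s j \<longleftrightarrow> \<pi> ` col \<nu> s j = col \<nu> s j"
    if \<pi>: "\<pi> permutes {1..sum_list \<tau>}" "\<pi> ?x = ?x" for j
  proof (cases "j = c")
    case True
    have "?x \<notin> \<pi> ` col \<nu> s j"
      using x[of j] \<pi>(2) permutes_inj[OF \<pi>(1)] by (metis imageE injD)
    then show ?thesis
      using True x[of j] \<pi>(2) by (simp add: col_new_cell[OF \<tau> rc] insert_ident)
  qed (simp add: col_new_cell[OF \<tau> rc])
  then show ?thesis
    unfolding column_stabilizer_iff rc
    by (cases "\<pi> permutes {1..sum_list \<tau>} \<and> \<pi> ?x = ?x") (simp, blast)
qed

lemma permutes_remove_last:
  "\<pi> permutes {1..k} \<longleftrightarrow> \<pi> permutes {1..k + 1} \<and> \<pi> (k + 1) = k + 1" for k :: nat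
proof
  assume p: "\<pi> permutes {1..k}"
  then show "\<pi> permutes {1..k + 1} \<and> \<pi> (k + 1) = k + 1"
    using permutes_subset[OF p, of "{1..k + 1}"] permutes_not_in[OF p, of "k + 1"] by auto
next
  assume p: "\<pi> permutes {1..k + 1} \<and> \<pi> (k + 1) = k + 1"
  show "\<pi> permutes {1..k}"
    by (rule permutes_superset[of _ "{1..k + 1}"]) (use p le_Suc_eq in auto)
qed

text \<open>On coefficients this deletes \<open>x\<close> from row \<open>r\<close>: the value at a
  tabloid is the coefficient of the tabloid enlarged by \<open>x\<close>. It is used with x = k + 1
  and evaluated on \<open>tabs k\<close>, where no row contains \<open>x\<close> already.\<close>

definition insert_entry :: "nat \<Rightarrow> nat \<Rightarrow> (tabloid \<Rightarrow> complex) \<Rightarrow> (tabloid \<Rightarrow> complex)"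
  where "insert_entry x r u = (\<lambda>T. u (T(r := insert x (T r))))"

text \<open>The reverse passage, which places \<open>x\<close> into row \<open>r\<close>: the result
  is supported on tabloids that have \<open>x\<close> there.\<close>

definition remove_entry :: "nat \<Rightarrow> nat \<Rightarrow> (tabloid \<Rightarrow> complex) \<Rightarrow> (tabloid \<Rightarrow> complex)"
  where "remove_entry x r v = (\<lambda>T. if x \<in> T r then v (T(r := T r - {x})) else 0)"

text \<open>
  Testing against the polytabloids whose largest entry occupies the box removed for \<open>\<nu>\<close> only sees
  the components whose box lies weakly above it.
\<close>

lemma remove_entry_injective:
  assumes \<tau>: "\<tau> \<in> partitions (k + 1)" and I: "I = {\<nu> \<in> partitions k. \<tau> \<in> add_box \<nu>}"
    and v: "\<And>\<nu>. \<nu> \<in> I \<Longrightarrow> v \<nu> \<in> vs (specht \<nu>)"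
    and 0: "\<And>t. t \<in> tableaux \<tau> \<Longrightarrow>
      (\<Sum>\<nu>\<in>I. pairing (k + 1) (remove_entry (k + 1) (new_row \<nu> \<tau>) (v \<nu>)) (polytabloid \<tau> t)) = 0"
    and "\<nu> \<in> I"
  shows "v \<nu> = (\<lambda>T. 0)"
  using \<open>\<nu> \<in> I\<close>
proof (induction "new_row \<nu> \<tau>" arbitrary: \<nu> rule: less_induct)
  case less
  then have \<nu>: "\<nu> \<in> partitions k" and \<tau>\<nu>: "\<tau> \<in> add_box \<nu>" using I by auto
  note sum_\<tau> = partitionsD(1)[OF \<tau>] and sum_\<nu> = partitionsD(1)[OF \<nu>]
  obtain r c where rc: "new_cell \<nu> \<tau> = (r, c)" by force
  note cell = new_cell[OF \<tau>\<nu>, unfolded rc]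
  have fin: "finite I" unfolding I using finite_partitions by auto
  show ?case
  proof (rule pairing_pos_def[OF \<nu> v[OF less.prems]])
    fix e assume "e \<in> polytabloids \<nu>"
    then obtain s where s: "s \<in> tableaux \<nu>" "e = polytabloid \<nu> s" by (auto simp: polytabloids_def)
    \<comment> \<open>The test tableau has its largest entry in the cell that distinguishes \<tau>
      from \<nu>, at the bottom of a column.\<close>
    define t where "t = s((r, c) := k + 1)"
    have ts: "t z = s z" if "z \<in> diagram \<nu>" for z using that cell(1) by (auto simp: t_def)
    have trc: "t (r, c) = k + 1" by (simp add: t_def)
    have bij: "bij_betw t (diagram \<nu>) {1..k}"
      using s(1) ts sum_\<nu> by (auto simp: tableaux_def cong: bij_betw_cong)
    have "bij_betw t (diagram \<tau>) {1..k + 1}"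
      using notIn_Un_bij_betw[OF cell(1) _ bij] trc cell(2)
      by (simp add: atLeastAtMostSuc_conv)
    then have t: "t \<in> tableaux \<tau>" by (simp add: tableaux_def sum_\<tau>)
    let ?p = "\<lambda>\<mu>. \<Sum>\<pi>\<in>column_stabilizer \<tau> t.
        sgn_perm \<pi> * remove_entry (k + 1) (new_row \<mu> \<tau>) (v \<mu>) (tabloid_of \<tau> (\<pi> \<circ> t))"
    \<comment> \<open>The largest entry starts at the bottom of its column, so a column permutation
      can only raise it, and keeps it in row \<open>r\<close> only by fixing it.\<close>
    have row: "i \<le> r \<and> (i = r \<longrightarrow> \<pi> (k + 1) = k + 1)"
      if \<pi>: "\<pi> \<in> column_stabilizer \<tau> t" and i: "k + 1 \<in> tabloid_of \<tau> (\<pi> \<circ> t) i" for \<pi> i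
    proof -
      obtain j where j: "(i, j) \<in> diagram \<tau>" "\<pi> (t (i, j)) = t (r, c)"
        using i by (auto simp: tabloid_of_def trc)
      have "c = j" using same_column[OF t \<pi> j(1) _ j(2)] cell(2) by simp
      then show ?thesis
        using below_new_cell[OF \<nu> \<tau>\<nu> rc, of i] j trc by (metis not_le)
    qed
    have "?p \<mu> = 0" if "\<mu> \<in> I" "\<mu> \<noteq> \<nu>" for \<mu>
    proof -
      have "new_row \<mu> \<tau> \<noteq> new_row \<nu> \<tau>"
        using new_row_inj'[of \<mu> k \<nu> \<tau>] that less.prems I by auto
      then consider "new_row \<mu> \<tau> < new_row \<nu> \<tau>" | "r < new_row \<mu> \<tau>" using rc by fastforce
      then show ?thesis
      proof cases
        case 1
        then show ?thesis using less.hyps[OF 1 that(1)] by (simp add: remove_entry_def)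
      next
        case 2
        have "k + 1 \<notin> tabloid_of \<tau> (\<pi> \<circ> t) (new_row \<mu> \<tau>)" if "\<pi> \<in> column_stabilizer \<tau> t" for \<pi>
          using row[OF that, of "new_row \<mu> \<tau>"] 2 by auto
        then show ?thesis by (intro sum.neutral) (simp add: remove_entry_def)
      qed
    qed
    then have "0 = ?p \<nu>"
      using 0[OF t, unfolded pairing_polytabloid[OF \<tau> t]] sum.remove[OF fin less.prems, of ?p] by simp
    \<comment> \<open>Column permutations that move k + 1 take it out of row \<open>r\<close> and
      contribute zero; the remaining ones form the column stabilizer for \<nu>.\<close>
    also have "\<dots> = (\<Sum>\<pi>\<in>column_stabilizer \<nu> t. sgn_perm \<pi> * v \<nu> (tabloid_of \<nu> (\<pi> \<circ> t)))"
    proof (rule sum.mono_neutral_cong_right)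
      have iff: "\<pi> \<in> column_stabilizer \<nu> t \<longleftrightarrow> \<pi> \<in> column_stabilizer \<tau> t \<and> \<pi> (k + 1) = k + 1" for \<pi>
        using stabilizer_fixing_new_entry[OF \<tau>\<nu> t, of \<pi>] permutes_remove_last[of \<pi> k]
        by (auto simp: column_stabilizer_iff sum_\<tau> sum_\<nu> rc trc)
      show "column_stabilizer \<nu> t \<subseteq> column_stabilizer \<tau> t" using iff by blast
      show "\<forall>\<pi>\<in>column_stabilizer \<tau> t - column_stabilizer \<nu> t.
          sgn_perm \<pi> * remove_entry (k + 1) (new_row \<nu> \<tau>) (v \<nu>) (tabloid_of \<tau> (\<pi> \<circ> t)) = 0"
        using iff row by (auto simp: remove_entry_def rc)
      fix \<pi> assume \<pi>: "\<pi> \<in> column_stabilizer \<nu> t"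
      then have p: "\<pi> permutes {1..k + 1}" "\<pi> (k + 1) = k + 1"
        using permutes_remove_last[of \<pi> k] by (auto simp: column_stabilizer_iff sum_\<nu>)
      have "k + 1 \<notin> tabloid_of \<nu> (\<pi> \<circ> t) r"
      proof
        assume "k + 1 \<in> tabloid_of \<nu> (\<pi> \<circ> t) r"
        then obtain j where j: "(r, j) \<in> diagram \<nu>" "\<pi> (t (r, j)) = \<pi> (k + 1)"
          using p(2) by (auto simp: tabloid_of_def)
        then have "t (r, j) = k + 1" using permutes_inj[OF p(1)] by (simp add: inj_eq)
        then show False using new_entry_notin[OF \<tau>\<nu> t j(1)] trc rc by simp
      qed
      then have "(tabloid_of \<tau> (\<pi> \<circ> t))(r := tabloid_of \<tau> (\<pi> \<circ> t) r - {k + 1}) = tabloid_of \<nu> (\<pi> \<circ> t)"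
        using p(2) by (simp add: tabloid_new_cell[OF \<tau>\<nu> rc] trc)
      then show "sgn_perm \<pi> * remove_entry (k + 1) (new_row \<nu> \<tau>) (v \<nu>) (tabloid_of \<tau> (\<pi> \<circ> t))
          = sgn_perm \<pi> * v \<nu> (tabloid_of \<nu> (\<pi> \<circ> t))"
        using p(2) by (simp add: remove_entry_def rc tabloid_new_cell[OF \<tau>\<nu> rc] trc)
    qed simp
    also have "\<dots> = pairing k (v \<nu>) (polytabloid \<nu> t)"
      using pairing_polytabloid[OF \<nu>, of t "v \<nu>"] bij
      by (simp add: tableaux_def sum_\<nu>)
    also have "polytabloid \<nu> t = e" unfolding s(2) by (rule polytabloid_cong[OF ts])
    finally show "pairing k (v \<nu>) e = 0" by simp
  qed
qed

text \<open>
  The sum of the hypothesis over the column stabilizer of a tableau \<open>s\<close> of shape \<open>\<tau>\<close> kills, by a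
  sign-reversing involution, the components whose box lies strictly above that of \<open>\<tau>\<close>.
\<close>

lemma insert_entry_injective:
  assumes \<nu>: "\<nu> \<in> partitions k"
    and v: "\<And>\<tau>. \<tau> \<in> add_box \<nu> \<Longrightarrow> v \<tau> \<in> vs (specht \<tau>)"
    and 0: "\<And>\<sigma> t. \<sigma> permutes {1..k + 1} \<Longrightarrow> t \<in> tableaux \<nu> \<Longrightarrow>
      (\<Sum>\<tau>\<in>add_box \<nu>. pairing k (insert_entry (k + 1) (new_row \<nu> \<tau>) (perm_act \<sigma> (v \<tau>))) (polytabloid \<nu> t)) = 0"
    and "\<tau> \<in> add_box \<nu>"
  shows "v \<tau> = (\<lambda>T. 0)"
  using \<open>\<tau> \<in> add_box \<nu>\<close>
proof (induction "k + 1 - new_row \<nu> \<tau>" arbitrary: \<tau> rule: less_induct)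
  case less
  note \<tau>\<nu> = less.prems
  have \<tau>: "\<tau> \<in> partitions (k + 1)" by (rule add_box_partitions[OF \<nu> \<tau>\<nu>])
  note sum_\<tau> = partitionsD(1)[OF \<tau>] and sum_\<nu> = partitionsD(1)[OF \<nu>]
  obtain r c where rc: "new_cell \<nu> \<tau> = (r, c)" by force
  note cell = new_cell[OF \<tau>\<nu>, unfolded rc]
  \<comment> \<open>The induction runs from the lowest added box upwards. This bound keeps the
    truncated subtraction in its measure strictly monotone.\<close>
  have row_le: "new_row \<nu> \<tau>' < k + 1" if "\<tau>' \<in> add_box \<nu>" for \<tau>'
  proof -
    have "new_cell \<nu> \<tau>' \<in> diagram \<tau>'" using new_cell(2)[OF that] by simp
    then have "new_row \<nu> \<tau>' < length \<tau>'" by (auto simp: diagram_def)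
    then show ?thesis using length_le_sum[OF add_box_partitions[OF \<nu> that]] by simp
  qed
  show ?case
  proof (rule pairing_pos_def[OF \<tau> v[OF \<tau>\<nu>]])
    fix e assume "e \<in> polytabloids \<tau>"
    then obtain s where s: "s \<in> tableaux \<tau>" "e = polytabloid \<tau> s" by (auto simp: polytabloids_def)
    define x where "x = s (r, c)"
    have x: "x \<in> {1..k + 1}" using tableauxD(3)[OF s(1), of "(r, c)"] cell(2) sum_\<tau> by (simp add: x_def)
    \<comment> \<open>The hypothesis speaks of the entry k + 1, whereas the new box of
      \<open>s\<close> contains an arbitrary \<open>x\<close>; the transposition makes up for the
      difference.\<close>
    let ?\<sigma> = "transpose x (k + 1)"
    have \<sigma>: "?\<sigma> permutes {1..k + 1}" using x by (intro permutes_swap_id) auto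
    have \<sigma>\<sigma>: "?\<sigma> \<circ> ?\<sigma> = id" by simp
    define t where "t = ?\<sigma> \<circ> s"
    have t: "t \<in> tableaux \<nu>"
    proof -
      have s_bij: "bij_betw s (diagram \<tau>) {1..k + 1}" using s(1) by (simp add: tableaux_def sum_\<tau>)
      have "diagram \<nu> = diagram \<tau> - {(r, c)}" using cell by auto
      then have "bij_betw s (diagram \<nu>) ({1..k + 1} - {x})"
        using bij_betw_DiffI[OF s_bij, of "{(r, c)}" "{x}"] cell(2) x
        by (simp add: x_def)
      moreover have "bij_betw ?\<sigma> ({1..k + 1} - {x}) ({1..k + 1} - {k + 1})"
        by (rule bij_betw_DiffI[OF permutes_imp_bij[OF \<sigma>]]) (use x in auto)
      moreover have "{1..k + 1} - {k + 1} = {1..k}" by auto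
      ultimately show ?thesis unfolding t_def tableaux_def sum_\<nu> by (auto intro: bij_betw_trans)
    qed
    \<comment> \<open>The tabloid of the part of shape \<nu>, with the entry of the new cell moved
      into row r'. For r' = r this is the tabloid of shape \<tau>; other rows arise from the other
      summands.\<close>
    define Q where "Q r' q = (tabloid_of \<nu> q)(r' := insert (q (r, c)) (tabloid_of \<nu> q r'))"
      for r' and q :: "nat \<times> nat \<Rightarrow> nat"
    \<comment> \<open>The column permutations of the part of \<open>s\<close> of shape \<nu>;
      conjugation by \<open>?\<sigma>\<close> turns them into the column stabilizer of
      \<open>t\<close>.\<close>
    define D where "D = {\<pi> \<in> column_stabilizer \<tau> s. \<pi> x = x}"
    have D: "\<pi> \<in> D \<longleftrightarrow> \<pi> permutes {1..k + 1} \<and> \<pi> x = x \<and> (\<forall>j. \<pi> ` col \<nu> s j = col \<nu> s j)" for \<pi>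
      using stabilizer_fixing_new_entry[OF \<tau>\<nu> s(1), of \<pi>] by (auto simp: D_def rc x_def sum_\<tau>)
    have bij: "bij_betw (\<lambda>\<pi>. ?\<sigma> \<circ> \<pi> \<circ> ?\<sigma>) D (column_stabilizer \<nu> t)"
    proof (rule bij_betw_byWitness[where f' = "\<lambda>\<pi>. ?\<sigma> \<circ> \<pi> \<circ> ?\<sigma>"])
      have i1: "?\<sigma> ` ?\<sigma> ` A = A" for A by (simp only: image_comp \<sigma>\<sigma> image_id id_apply)
      have p: "?\<sigma> \<circ> \<pi> \<circ> ?\<sigma> permutes {1..k + 1}" if "\<pi> permutes {1..k + 1}" for \<pi>
        using that \<sigma> by (blast intro: permutes_compose)
      have st: "\<pi> \<in> column_stabilizer \<nu> t \<longleftrightarrow> \<pi> permutes {1..k + 1} \<and> \<pi> (k + 1) = k + 1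
          \<and> (\<forall>j. \<pi> ` ?\<sigma> ` col \<nu> s j = ?\<sigma> ` col \<nu> s j)" for \<pi>
        unfolding column_stabilizer_iff sum_\<nu> permutes_remove_last[of \<pi> k] t_def col_comp by blast
      have "?\<sigma> \<circ> (?\<sigma> \<circ> \<pi> \<circ> ?\<sigma>) \<circ> ?\<sigma> = \<pi>" for \<pi> by (auto simp: fun_eq_iff)
      then show "\<forall>\<pi>\<in>D. ?\<sigma> \<circ> (?\<sigma> \<circ> \<pi> \<circ> ?\<sigma>) \<circ> ?\<sigma> = \<pi>"
        "\<forall>\<pi>\<in>column_stabilizer \<nu> t. ?\<sigma> \<circ> (?\<sigma> \<circ> \<pi> \<circ> ?\<sigma>) \<circ> ?\<sigma> = \<pi>" by blast+
      show "(\<lambda>\<pi>. ?\<sigma> \<circ> \<pi> \<circ> ?\<sigma>) ` D \<subseteq> column_stabilizer \<nu> t"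
        by (clarsimp simp only: D st image_o i1 p) simp
      show "(\<lambda>\<pi>. ?\<sigma> \<circ> \<pi> \<circ> ?\<sigma>) ` column_stabilizer \<nu> t \<subseteq> D"
        by (clarsimp simp only: D st image_o i1 p) simp
    qed
    have step: "(\<Sum>\<tau>'\<in>add_box \<nu>. \<Sum>\<pi>\<in>D. sgn_perm \<pi> * v \<tau>' (Q (new_row \<nu> \<tau>') (\<rho> \<circ> \<pi> \<circ> s))) = 0"
      if \<rho>: "\<rho> permutes {1..k + 1}" for \<rho>
    proof -
      \<comment> \<open>The action evaluates at the inverse permutation. Its inverse is \<rho> after
        \<open>?\<sigma>\<close>, and this \<open>?\<sigma>\<close> cancels the one in
        \<open>t\<close>, leaving \<rho> applied to a column permutation of
        \<open>s\<close>.\<close>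
      let ?\<eta> = "?\<sigma> \<circ> inv' \<rho>"
      have "inv' ?\<eta> = inv' (inv' \<rho>) \<circ> inv' ?\<sigma>"
        by (rule o_inv_distrib) (use \<rho> \<sigma> permutes_inv[OF \<rho>] in \<open>auto intro: permutes_bij\<close>)
      then have inv: "inv' ?\<eta> = \<rho> \<circ> ?\<sigma>"
        by (simp add: inv_inv_eq permutes_bij[OF \<rho>])
      have "pairing k (insert_entry (k + 1) r' (perm_act ?\<eta> u)) (polytabloid \<nu> t)
          = (\<Sum>\<pi>\<in>D. sgn_perm \<pi> * u (Q r' (\<rho> \<circ> \<pi> \<circ> s)))" for r' u
      proof -
        have "pairing k (insert_entry (k + 1) r' (perm_act ?\<eta> u)) (polytabloid \<nu> t) =
          (\<Sum>\<pi>\<in>D. sgn_perm (?\<sigma> \<circ> \<pi> \<circ> ?\<sigma>) *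
            insert_entry (k + 1) r' (perm_act ?\<eta> u) (tabloid_of \<nu> (?\<sigma> \<circ> \<pi> \<circ> ?\<sigma> \<circ> t)))"
          unfolding pairing_polytabloid[OF \<nu> t] by (rule sum.reindex_bij_betw[OF bij, symmetric])
        also have "\<dots> = (\<Sum>\<pi>\<in>D. sgn_perm \<pi> * u (Q r' (\<rho> \<circ> \<pi> \<circ> s)))"
        proof (rule sum.cong[OF refl])
          fix \<pi> assume "\<pi> \<in> D"
          then have \<pi>: "\<pi> permutes {1..k + 1}" "\<pi> x = x" by (auto simp: D)
          have sg: "sgn_perm (?\<sigma> \<circ> \<pi> \<circ> ?\<sigma>) = sgn_perm \<pi>"
            using sign_perm_conj[OF \<pi>(1) \<sigma>] by simp
          have e: "?\<sigma> \<circ> \<pi> \<circ> ?\<sigma> \<circ> t = ?\<sigma> \<circ> (\<pi> \<circ> s)" by (auto simp: t_def fun_eq_iff)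
          have upd: "(\<lambda>i. f ` (T(r' := insert y (T r'))) i) = (\<lambda>i. f ` T i)(r' := insert (f y) (f ` T r'))"
            for f :: "nat \<Rightarrow> nat" and T :: tabloid and y by (rule ext) auto
          have "(\<lambda>i. inv' ?\<eta> ` ((tabloid_of \<nu> (?\<sigma> \<circ> (\<pi> \<circ> s)))(r' := insert (k + 1) (tabloid_of \<nu> (?\<sigma> \<circ> (\<pi> \<circ> s)) r'))) i)
              = Q r' (\<rho> \<circ> \<pi> \<circ> s)"
          proof -
            have "\<rho> \<circ> ?\<sigma> \<circ> (?\<sigma> \<circ> (\<pi> \<circ> s)) = \<rho> \<circ> \<pi> \<circ> s" by (auto simp: fun_eq_iff)
            then have rows: "(\<rho> \<circ> ?\<sigma>) ` tabloid_of \<nu> (?\<sigma> \<circ> (\<pi> \<circ> s)) i = tabloid_of \<nu> (\<rho> \<circ> \<pi> \<circ> s) i" for i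
              using fun_cong[OF tabloid_of_comp[of \<nu> "\<rho> \<circ> ?\<sigma>" "?\<sigma> \<circ> (\<pi> \<circ> s)"], of i] by simp
            have "(\<rho> \<circ> ?\<sigma>) (k + 1) = (\<rho> \<circ> \<pi> \<circ> s) (r, c)" using \<pi>(2) by (simp add: x_def)
            then show ?thesis unfolding inv upd rows Q_def by (simp only:)
          qed
          then show "sgn_perm (?\<sigma> \<circ> \<pi> \<circ> ?\<sigma>) *
              insert_entry (k + 1) r' (perm_act ?\<eta> u) (tabloid_of \<nu> (?\<sigma> \<circ> \<pi> \<circ> ?\<sigma> \<circ> t))
            = sgn_perm \<pi> * u (Q r' (\<rho> \<circ> \<pi> \<circ> s))"
            unfolding sg e by (simp add: insert_entry_def perm_act_def)
        qed
        finally show ?thesis .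
      qed
      moreover have "?\<eta> permutes {1..k + 1}" by (intro permutes_compose permutes_inv \<rho> \<sigma>)
      ultimately show ?thesis using 0[OF _ t, of ?\<eta>] by simp
    qed
    let ?C = "column_stabilizer \<tau> s"
    have perm: "\<rho> permutes {1..k + 1}" if "\<rho> \<in> ?C" for \<rho>
      using that by (simp add: column_stabilizer_iff sum_\<tau>)
    define A where "A \<tau>' = (\<Sum>\<rho>\<in>?C. sgn_perm \<rho> * v \<tau>' (Q (new_row \<nu> \<tau>') (\<rho> \<circ> s)))" for \<tau>'
    \<comment> \<open>Right translation by \<pi> permutes the column stabilizer of \<open>s\<close>
      and multiplies signs, so \<pi> is absorbed.\<close>
    have A_shift: "(\<Sum>\<rho>\<in>?C. sgn_perm \<rho> * (sgn_perm \<pi> * v \<tau>' (Q (new_row \<nu> \<tau>') (\<rho> \<circ> \<pi> \<circ> s)))) = A \<tau>'"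
      if "\<pi> \<in> ?C" for \<pi> \<tau>'
    proof -
      have inv: "\<pi> \<circ> inv' \<pi> = id" "inv' \<pi> \<circ> \<pi> = id" using permutes_inv_o[OF perm[OF that]] by auto
      have bij: "bij_betw (\<lambda>\<rho>. \<rho> \<circ> \<pi>) ?C ?C"
      proof (rule bij_betw_byWitness[where f' = "\<lambda>\<rho>. \<rho> \<circ> inv' \<pi>"])
        show "\<forall>\<rho>\<in>?C. \<rho> \<circ> \<pi> \<circ> inv' \<pi> = \<rho>" "\<forall>\<rho>\<in>?C. \<rho> \<circ> inv' \<pi> \<circ> \<pi> = \<rho>"
          by (simp_all only: o_assoc[symmetric] inv comp_id) simp_all
      qed (auto intro: column_stabilizer_comp column_stabilizer_inv that)
      have "(\<Sum>\<rho>\<in>?C. sgn_perm \<rho> * (sgn_perm \<pi> * v \<tau>' (Q (new_row \<nu> \<tau>') (\<rho> \<circ> \<pi> \<circ> s))))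
          = (\<Sum>\<rho>\<in>?C. sgn_perm (\<rho> \<circ> \<pi>) * v \<tau>' (Q (new_row \<nu> \<tau>') (\<rho> \<circ> \<pi> \<circ> s)))"
        using sign_perm_comp[OF perm perm[OF that]] by (intro sum.cong[OF refl]) simp
      also have "\<dots> = A \<tau>'"
        unfolding A_def
        by (rule sum.reindex_bij_betw[OF bij, of "\<lambda>\<rho>. sgn_perm \<rho> * v \<tau>' (Q (new_row \<nu> \<tau>') (\<rho> \<circ> s))"])
      finally show ?thesis .
    qed
    \<comment> \<open>Every \<pi> in \<open>D\<close> contributes the same sum, hence the factor; it
      is nonzero because \<open>D\<close> contains the identity.\<close>
    have "of_nat (card D) * (\<Sum>\<tau>'\<in>add_box \<nu>. A \<tau>') = (\<Sum>\<rho>\<in>?C. sgn_perm \<rho> *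
        (\<Sum>\<tau>'\<in>add_box \<nu>. \<Sum>\<pi>\<in>D. sgn_perm \<pi> * v \<tau>' (Q (new_row \<nu> \<tau>') (\<rho> \<circ> \<pi> \<circ> s))))"
    proof -
      have "(\<Sum>\<rho>\<in>?C. sgn_perm \<rho> *
          (\<Sum>\<tau>'\<in>add_box \<nu>. \<Sum>\<pi>\<in>D. sgn_perm \<pi> * v \<tau>' (Q (new_row \<nu> \<tau>') (\<rho> \<circ> \<pi> \<circ> s))))
        = (\<Sum>\<tau>'\<in>add_box \<nu>. \<Sum>\<pi>\<in>D. \<Sum>\<rho>\<in>?C. sgn_perm \<rho> * (sgn_perm \<pi> * v \<tau>' (Q (new_row \<nu> \<tau>') (\<rho> \<circ> \<pi> \<circ> s))))"
        unfolding sum_distrib_left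
        by (subst sum.swap) (intro sum.cong[OF refl] sum.swap)
      also have "\<dots> = (\<Sum>\<tau>'\<in>add_box \<nu>. \<Sum>\<pi>\<in>D. A \<tau>')"
        using A_shift by (intro sum.cong refl) (auto simp: D_def)
      finally show ?thesis by (simp add: sum_distrib_left)
    qed
    also have "\<dots> = 0" using step[OF perm] by (intro sum.neutral) simp
    finally have "of_nat (card D) * (\<Sum>\<tau>'\<in>add_box \<nu>. A \<tau>') = 0" .
    moreover have "card D \<noteq> 0"
    proof -
      have "finite D" "id \<in> D" using id_column_stabilizer[of \<tau> s] by (auto simp: D_def)
      then show ?thesis by auto
    qed
    ultimately have sumA: "(\<Sum>\<tau>'\<in>add_box \<nu>. A \<tau>') = 0" by simp
    have "A \<tau>' = 0" if \<tau>': "\<tau>' \<in> add_box \<nu>" "\<tau>' \<noteq> \<tau>" for \<tau>'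
    proof -
      have "new_row \<nu> \<tau>' \<noteq> new_row \<nu> \<tau>" using new_row_inj[OF \<nu> \<tau>'(1) \<tau>\<nu>] \<tau>'(2) by auto
      then consider "new_row \<nu> \<tau>' > new_row \<nu> \<tau>" | "new_row \<nu> \<tau>' < r" using rc by fastforce
      then show ?thesis
      proof cases
        case 1
        then have "k + 1 - new_row \<nu> \<tau>' < k + 1 - new_row \<nu> \<tau>" using row_le[OF \<tau>'(1)] by simp
        then show ?thesis using less.hyps[OF _ \<tau>'(1)] by (simp add: A_def)
      next
        case 2
        let ?r = "new_row \<nu> \<tau>'"
        have z: "(?r, c) \<in> diagram \<nu>" by (rule above_new_cell[OF \<nu> \<tau>\<nu> rc 2])
        \<comment> \<open>The entry in row \<open>?r\<close> of the column of the new box; the cell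
          exists because that row lies above the new box.\<close>
        define y where "y = s (?r, c)"
        let ?\<omega> = "transpose x y"
        have xy: "x \<noteq> y" using new_entry_notin[OF \<tau>\<nu> s(1) z] rc by (auto simp: x_def y_def)
        have y: "y \<in> {1..k + 1}" using tableauxD(3)[OF s(1), of "(?r, c)"] z cell(2) sum_\<tau> by (simp add: y_def)
        have \<omega>p: "?\<omega> permutes {1..k + 1}" using x y by (intro permutes_swap_id) auto
        have \<omega>: "?\<omega> \<in> ?C"
        proof -
          have "x \<in> col \<tau> s j \<longleftrightarrow> j = c" "y \<in> col \<tau> s j \<longleftrightarrow> j = c" for j
            using tableauxD(1)[OF s(1)] cell(2) z by (auto simp: col_def x_def y_def dest: inj_onD)
          then have "?\<omega> ` col \<tau> s j = col \<tau> s j" for j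
            by (cases "j = c") (auto simp: transpose_image_eq)
          then show ?thesis using \<omega>p by (simp add: column_stabilizer_iff sum_\<tau>)
        qed
        \<comment> \<open>In \<open>Q\<close> both \<open>x\<close> and \<open>y\<close> are sent to
          row \<open>?r\<close>, so exchanging them leaves the tabloid alone, while the sign of the
          column permutation changes.\<close>
        have Q\<omega>: "Q ?r (\<rho> \<circ> ?\<omega> \<circ> s) = Q ?r (\<rho> \<circ> s)" for \<rho>
        proof -
          have sw: "?\<omega> (s z') = s z'" if "z' \<in> diagram \<nu>" "z' \<noteq> (?r, c)" for z'
          proof -
            have "s z' \<noteq> x" using new_entry_notin[OF \<tau>\<nu> s(1) that(1)] rc by (simp add: x_def)
            moreover have "s z' \<noteq> y" using tableauxD(1)[OF s(1)] cell(2) z that by (auto simp: y_def dest: inj_onD)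
            ultimately show ?thesis by simp
          qed
          have "tabloid_of \<nu> (\<rho> \<circ> ?\<omega> \<circ> s) i = tabloid_of \<nu> (\<rho> \<circ> s) i" if "i \<noteq> ?r" for i
            unfolding tabloid_of_def by (intro Collect_cong ex_cong1) (use sw that in auto)
          moreover have "insert (\<rho> (?\<omega> x)) (tabloid_of \<nu> (\<rho> \<circ> ?\<omega> \<circ> s) ?r) = insert (\<rho> x) (tabloid_of \<nu> (\<rho> \<circ> s) ?r)"
          proof -
            define U where "U = {s (?r, j) |j. (?r, j) \<in> diagram \<nu> \<and> j \<noteq> c}"
            have row: "tabloid_of \<nu> (f \<circ> s) ?r = insert (f y) (f ` U)" for f
              using z by (auto simp: tabloid_of_def U_def y_def)
            have "?\<omega> ` U = U" unfolding U_def using sw by (force simp: image_iff)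
            then have "(\<rho> \<circ> ?\<omega>) ` U = \<rho> ` U" by (simp only: image_o)
            then have "tabloid_of \<nu> (\<rho> \<circ> ?\<omega> \<circ> s) ?r = insert (\<rho> x) (\<rho> ` U)"
              unfolding row[of "\<rho> \<circ> ?\<omega>"] by simp
            then show ?thesis using row[of \<rho>] by auto
          qed
          ultimately show ?thesis by (auto simp: Q_def x_def[symmetric] fun_eq_iff)
        qed
        have "A \<tau>' = (\<Sum>\<rho>\<in>?C. sgn_perm \<rho> * (sgn_perm ?\<omega> * v \<tau>' (Q ?r (\<rho> \<circ> ?\<omega> \<circ> s))))"
          using A_shift[OF \<omega>] by simp
        also have "\<dots> = - A \<tau>'"
          unfolding Q\<omega> using xy by (simp add: A_def sign_swap_id sum_negf)
        finally show ?thesis by simp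
      qed
    qed
    then have "(\<Sum>\<tau>'\<in>add_box \<nu>. A \<tau>') = A \<tau>"
      using \<tau>\<nu> by (simp add: sum.remove[of _ \<tau>])
    \<comment> \<open>For \<tau> itself the new entry goes to its own row, so \<open>A\<close> is
      the full column sum.\<close>
    moreover have "A \<tau> = pairing (k + 1) (v \<tau>) e"
      unfolding s(2) pairing_polytabloid[OF \<tau> s(1)] A_def
      by (simp add: tabloid_new_cell[OF \<tau>\<nu> rc] Q_def rc)
    ultimately show "pairing (k + 1) (v \<tau>) e = 0" using sumA by simp
  qed
qed

subsection \<open>The differential structure of Young's lattice\<close>

text \<open>Finite order ideals of cells. Unions and intersections are immediate here, and
  \<open>partition_of_young\<close> leads back to lists.\<close>

definition young :: "(nat \<times> nat) set \<Rightarrow> bool"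
  where "young D \<longleftrightarrow> finite D \<and> (\<forall>i j i' j'. (i, j) \<in> D \<longrightarrow> i' \<le> i \<longrightarrow> j' \<le> j \<longrightarrow> (i', j') \<in> D)"

lemma young_diagram: "\<nu> \<in> partitions m \<Longrightarrow> young (diagram \<nu>)"
  using diagram_down unfolding young_def by (metis finite_diagram)

lemma young_Int: "young D \<Longrightarrow> young E \<Longrightarrow> young (D \<inter> E)"
  unfolding young_def by blast

lemma young_Un: "young D \<Longrightarrow> young E \<Longrightarrow> young (D \<union> E)"
  unfolding young_def by blast

lemma downset_nat:
  fixes A :: "nat set"
  assumes "finite A" "\<And>x y. x \<in> A \<Longrightarrow> y \<le> x \<Longrightarrow> y \<in> A"
  shows "A = {..<card A}"
proof (cases "A = {}")
  case False
  have "A = {..Max A}" using assms False Max_in by (auto intro: Max_ge)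
  then have "card A = Suc (Max A)" by (metis card_atMost)
  then show ?thesis using \<open>A = {..Max A}\<close> by (simp add: lessThan_Suc_atMost)
qed simp

lemma partition_of_young:
  assumes D: "young D"
  obtains \<nu> where "\<nu> \<in> partitions (card D)" "diagram \<nu> = D"
proof -
  define l where "l = card {i. (i, 0) \<in> D}"
  define L where "L i = card {j. (i, j) \<in> D}" for i
  have fin: "finite {i. (i, 0) \<in> D}" "finite {j. (i, j) \<in> D}" for i
    using D finite_vimageI[of D "\<lambda>i. (i, 0)"] finite_vimageI[of D "Pair i"]
    by (auto simp: young_def vimage_def inj_on_def)
  have rows: "(i, j) \<in> D \<longleftrightarrow> j < L i" for i j
    using downset_nat[OF fin(2)[of i]] D unfolding L_def young_def by blast
  have first: "(i, 0) \<in> D \<longleftrightarrow> i < l" for i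
    using downset_nat[OF fin(1)] D unfolding l_def young_def by blast
  have L0: "0 < L i \<longleftrightarrow> i < l" for i using rows[of i 0] first by simp
  have anti: "L j \<le> L i" if "i \<le> j" for i j
  proof (rule ccontr)
    assume "\<not> L j \<le> L i"
    then have "(j, L i) \<in> D" using rows by simp
    then have "(i, L i) \<in> D" using D that unfolding young_def by blast
    then show False using rows by simp
  qed
  define \<nu> where "\<nu> = map L [0..<l]"
  have "(i, j) \<in> diagram \<nu> \<longleftrightarrow> (i, j) \<in> D" for i j
    using rows[of i j] L0[of i] by (auto simp: diagram_def \<nu>_def)
  then have diag: "diagram \<nu> = D" by auto
  have "sorted_wrt (\<ge>) \<nu>"
    unfolding \<nu>_def by (auto simp: sorted_wrt_iff_nth_less intro: anti)
  moreover have "L i \<noteq> 0" if "i < l" for i using L0[of i] that by simp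
  then have "0 \<notin> set \<nu>" by (fastforce simp: \<nu>_def)
  moreover have "sum_list \<nu> = card D" using card_diagram[of \<nu>] diag by simp
  ultimately show thesis using that[of \<nu>] diag by (simp add: partitions_def)
qed

lemma add_boxI:
  assumes "\<nu> \<in> partitions k" "\<tau> \<in> partitions m" "c \<notin> diagram \<nu>" "diagram \<tau> = insert c (diagram \<nu>)"
  shows "\<tau> \<in> add_box \<nu>"
proof -
  have "sum_list \<tau> = sum_list \<nu> + 1"
    using card_diagram[of \<tau>] card_diagram[of \<nu>] assms(3,4) by simp
  then show ?thesis using assms partitionsD(1)[OF assms(2)] by (cases c) (auto simp: add_box_def)
qed

lemma new_cell_eq:
  assumes "c \<notin> diagram \<nu>" "diagram \<tau> = insert c (diagram \<nu>)"
  shows "new_cell \<nu> \<tau> = c"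
  unfolding new_cell_def by (rule the_equality) (use assms in blast)+

text \<open>The first clause makes \<nu> a partition, which \<open>add_box\<close> does not enforce
  for its argument: a list with trailing zeros would have the same diagram.\<close>

definition remove_box :: "nat list \<Rightarrow> nat list set"
  where "remove_box \<tau> = {\<nu>. \<nu> \<in> partitions (sum_list \<nu>) \<and> \<tau> \<in> add_box \<nu>}"

lemma remove_box_partitions:
  assumes "\<tau> \<in> partitions m" "\<nu> \<in> remove_box \<tau>"
  shows "\<nu> \<in> partitions (m - 1)" "m \<noteq> 0"
proof -
  have "\<tau> \<in> partitions (sum_list \<nu> + 1)" using assms(2) by (auto simp: remove_box_def add_box_def)
  then have "m = sum_list \<nu> + 1" using assms(1) by (simp add: partitions_def)
  then show "\<nu> \<in> partitions (m - 1)" "m \<noteq> 0" using assms(2) by (auto simp: remove_box_def)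
qed

lemma remove_box_eq:
  "\<tau> \<in> partitions (k + 1) \<Longrightarrow> remove_box \<tau> = {\<nu> \<in> partitions k. \<tau> \<in> add_box \<nu>}"
  using remove_box_partitions(1)[of \<tau> "k + 1"]
  by (auto simp: remove_box_def dest: partitionsD(1))

lemma finite_remove_box: "\<tau> \<in> partitions m \<Longrightarrow> finite (remove_box \<tau>)"
  by (rule finite_subset[OF _ finite_partitions[of "m - 1"]]) (auto dest: remove_box_partitions(1))

text \<open>With row lengths \<open>L\<close> padded by zeros, a box can be removed from row r
  exactly if row r + 1 is shorter, and a box can be added to row 0 and to each row following such an
  r. This is the diagonal part of the commutation relation.\<close>

lemma card_add_box:
  assumes \<nu>: "\<nu> \<in> partitions k"
  shows "card (add_box \<nu>) = card (remove_box \<nu>) + 1"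
proof -
  define L where "L i = (if i < length \<nu> then \<nu> ! i else 0)" for i
  have D: "(i, j) \<in> diagram \<nu> \<longleftrightarrow> j < L i" for i j by (auto simp: diagram_def L_def)
  define S where "S = {r. L (Suc r) < L r}"
  have "S \<subseteq> {..<length \<nu>}" by (auto simp: S_def L_def)
  then have finS: "finite S" by (rule finite_subset) simp
  have "bij_betw (new_row \<nu>) (add_box \<nu>) (insert 0 (Suc ` S))"
    unfolding bij_betw_def
  proof (intro conjI equalityI subsetI)
    show "inj_on (new_row \<nu>) (add_box \<nu>)" using new_row_inj[OF \<nu>] by (rule inj_onI)
    fix r assume "r \<in> new_row \<nu> ` add_box \<nu>"
    then obtain \<tau> where "\<tau> \<in> add_box \<nu>" "r = new_row \<nu> \<tau>" by blast
    moreover obtain c where "c = snd (new_cell \<nu> \<tau>)" by blast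
    ultimately have \<tau>: "\<tau> \<in> add_box \<nu>" "new_cell \<nu> \<tau> = (r, c)" by simp_all
    show "r \<in> insert 0 (Suc ` S)"
    proof (cases r)
      case (Suc q)
      have "(q, c) \<in> diagram \<nu>" using above_new_cell[OF \<nu> \<tau>] Suc by simp
      then show ?thesis using new_cell(1)[OF \<tau>(1)] \<tau>(2) Suc D by (auto simp: S_def)
    qed simp
  next
    fix r assume r: "r \<in> insert 0 (Suc ` S)"
    \<comment> \<open>If there is a row above row r, it is strictly longer, so the cell behind the
      end of row r completes an order ideal.\<close>
    have "young (insert (r, L r) (diagram \<nu>))"
      unfolding young_def
    proof (intro conjI allI impI)
      fix i j i' j' assume ij: "(i, j) \<in> insert (r, L r) (diagram \<nu>)" "i' \<le> i" "j' \<le> j"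
      show "(i', j') \<in> insert (r, L r) (diagram \<nu>)"
      proof (cases "(i, j) \<in> diagram \<nu>")
        case True
        then show ?thesis using diagram_down[OF \<nu> _ ij(2,3)] by simp
      next
        case False
        then have e: "i = r" "j = L r" using ij by auto
        consider "i' = r" | q where "r = Suc q" "i' \<le> q" using ij(2) e by (cases r) (auto simp: le_Suc_eq)
        then show ?thesis
        proof cases
          case 1
          then show ?thesis using ij(3) e D[of r j'] by auto
        next
          case 2
          then have "(q, L r) \<in> diagram \<nu>" using r D by (auto simp: S_def)
          then show ?thesis using diagram_down[OF \<nu>, of q "L r" i' j'] 2 ij(3) e by simp
        qed
      qed
    qed simp
    then obtain \<tau> m where \<tau>: "\<tau> \<in> partitions m" "diagram \<tau> = insert (r, L r) (diagram \<nu>)"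
      using partition_of_young by metis
    have nin: "(r, L r) \<notin> diagram \<nu>" using D by simp
    have a: "\<tau> \<in> add_box \<nu>" by (rule add_boxI[OF \<nu> \<tau>(1) nin \<tau>(2)])
    have "new_cell \<nu> \<tau> = (r, L r)" by (rule new_cell_eq[OF nin \<tau>(2)])
    then show "r \<in> new_row \<nu> ` add_box \<nu>" using a by force
  qed
  then have 1: "card (add_box \<nu>) = card S + 1"
    using finS by (simp add: bij_betw_same_card card_image)
  have "bij_betw (\<lambda>\<kappa>. new_row \<kappa> \<nu>) (remove_box \<nu>) S"
    unfolding bij_betw_def
  proof (intro conjI equalityI subsetI)
    show "inj_on (\<lambda>\<kappa>. new_row \<kappa> \<nu>) (remove_box \<nu>)"
    proof (rule inj_onI)
      fix x y assume "x \<in> remove_box \<nu>" "y \<in> remove_box \<nu>" "new_row x \<nu> = new_row y \<nu>"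
      then show "x = y"
        using new_row_inj'[of x "k - 1" y \<nu>] remove_box_partitions(1)[OF \<nu>] by (simp add: remove_box_def)
    qed
    fix r assume "r \<in> (\<lambda>\<kappa>. new_row \<kappa> \<nu>) ` remove_box \<nu>"
    then obtain \<kappa> where "\<kappa> \<in> remove_box \<nu>" "r = new_row \<kappa> \<nu>" by blast
    moreover obtain c where "c = snd (new_cell \<kappa> \<nu>)" by blast
    ultimately have \<kappa>: "\<kappa> \<in> partitions (sum_list \<kappa>)" "\<nu> \<in> add_box \<kappa>" "new_cell \<kappa> \<nu> = (r, c)"
      by (simp_all add: remove_box_def)
    then show "r \<in> S"
      using below_new_cell[OF \<kappa>, of "Suc r"] new_cell(2)[OF \<kappa>(2)] D[of r c] D[of "Suc r" c]
      by (auto simp: S_def)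
  next
    fix r assume r: "r \<in> S"
    \<comment> \<open>The last cell of row r; the next row is strictly shorter, so no cell lies
      beneath it.\<close>
    let ?c = "(r, L r - 1)"
    have c: "?c \<in> diagram \<nu>" using r D by (auto simp: S_def)
    have "young (diagram \<nu> - {?c})"
      unfolding young_def
    proof (intro conjI allI impI)
      fix i j i' j' assume ij: "(i, j) \<in> diagram \<nu> - {?c}" "i' \<le> i" "j' \<le> j"
      have "(i', j') \<in> diagram \<nu>" using diagram_down[OF \<nu> _ ij(2,3)] ij(1) by simp
      moreover have "(i', j') \<noteq> ?c"
      proof
        assume e: "(i', j') = ?c"
        show False
        proof (cases "i = r")
          case True
          then show False using e ij D[of r j] r by (auto simp: S_def)
        next
          case False
          then have "(Suc r, j) \<in> diagram \<nu>" using diagram_down[OF \<nu>, of i j "Suc r" j] ij e by simp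
          then show False using e ij r D[of "Suc r" j] by (auto simp: S_def)
        qed
      qed
      ultimately show "(i', j') \<in> diagram \<nu> - {?c}" by simp
    qed simp
    then obtain \<kappa> m where \<kappa>: "\<kappa> \<in> partitions m" "diagram \<kappa> = diagram \<nu> - {?c}"
      using partition_of_young by metis
    have a: "\<nu> \<in> add_box \<kappa>" by (rule add_boxI[OF \<kappa>(1) \<nu>, of ?c]) (use \<kappa> c in auto)
    have "new_cell \<kappa> \<nu> = ?c" by (rule new_cell_eq) (use \<kappa>(2) c in auto)
    then show "r \<in> (\<lambda>\<kappa>. new_row \<kappa> \<nu>) ` remove_box \<nu>"
      using a \<kappa>(1) partitionsD(1)[OF \<kappa>(1)] by (force simp: remove_box_def)
  qed
  then have 2: "card (remove_box \<nu>) = card S" by (rule bij_betw_same_card)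
  show ?thesis using 1 2 by simp
qed

text \<open>Both sets arise from \<open>T\<close> by deleting one element, and the deleted elements
  differ. Together with \<open>two_downs\<close> this is the modularity of Young's lattice, with the
  cells to be added made explicit.\<close>

lemma two_ups:
  assumes "T = insert c A" "T = insert c' A'" "c \<notin> A" "c' \<notin> A'" "A \<noteq> A'"
  shows "T = A \<union> A'" "A = insert c' (A \<inter> A')" "A' = insert c (A \<inter> A')"
    "c' \<notin> A \<inter> A'" "c \<notin> A \<inter> A'"
proof -
  have A: "A = T - {c}" using assms(1,3) by simp
  have A': "A' = T - {c'}" unfolding assms(2) using assms(4) by simp
  have "c \<noteq> c'" using assms(5) A A' by blast
  moreover have "c \<in> T" "c' \<in> T" using assms(1,2) by auto
  ultimately show "T = A \<union> A'" "A = insert c' (A \<inter> A')" "A' = insert c (A \<inter> A')"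
    "c' \<notin> A \<inter> A'" "c \<notin> A \<inter> A'"
    unfolding A A' by auto
qed

lemma two_downs:
  assumes "A = insert c K" "A' = insert c' K" "c \<notin> K" "c' \<notin> K" "A \<noteq> A'"
  shows "K = A \<inter> A'" "A \<union> A' = insert c' A" "A \<union> A' = insert c A'" "c' \<notin> A" "c \<notin> A'"
  using assms by auto

text \<open>The terms with \<mu> different from \<nu> agree on both sides: such a \<mu> is reached
  up and down exactly if it is reached down and up, in one way each, through the union and the
  intersection of the two diagrams. The terms with \<mu> = \<nu> are counted by
  \<open>card_add_box\<close>.\<close>

lemma sum_up_down:
  fixes f :: "nat list \<Rightarrow> nat"
  assumes \<nu>: "\<nu> \<in> partitions k"
  shows "(\<Sum>\<tau>\<in>add_box \<nu>. \<Sum>\<mu>\<in>remove_box \<tau>. f \<mu>)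
    = (\<Sum>\<kappa>\<in>remove_box \<nu>. \<Sum>\<mu>\<in>add_box \<kappa>. f \<mu>) + f \<nu>"
proof -
  have up: "diagram \<tau> = diagram \<nu> \<union> diagram \<mu>"
    if "\<tau> \<in> add_box \<nu>" "\<tau> \<in> add_box \<mu>" "\<mu> \<noteq> \<nu>" "\<mu> \<in> partitions k" for \<tau> \<mu>
  proof -
    have "diagram \<nu> \<noteq> diagram \<mu>" using diagram_inj[OF \<nu> that(4)] that(3) by auto
    then show ?thesis using two_ups[OF new_cell(2)[OF that(1)] new_cell(2)[OF that(2)]
      new_cell(1)[OF that(1)] new_cell(1)[OF that(2)]] by simp
  qed
  have down: "diagram \<kappa> = diagram \<nu> \<inter> diagram \<mu>"
    if "\<nu> \<in> add_box \<kappa>" "\<mu> \<in> add_box \<kappa>" "\<mu> \<noteq> \<nu>" "\<mu> \<in> partitions k" for \<kappa> \<mu>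
  proof -
    have "diagram \<nu> \<noteq> diagram \<mu>" using diagram_inj[OF \<nu> that(4)] that(3) by auto
    then show ?thesis using two_downs[OF new_cell(2)[OF that(1)] new_cell(2)[OF that(2)]
      new_cell(1)[OF that(1)] new_cell(1)[OF that(2)]] by simp
  qed
  have rem: "\<mu> \<in> partitions k" if "\<tau> \<in> add_box \<nu>" "\<mu> \<in> remove_box \<tau>" for \<tau> \<mu>
    using remove_box_partitions(1)[OF add_box_partitions[OF \<nu> that(1)] that(2)] by simp
  have remI: "\<mu> \<in> remove_box \<tau>" if "\<mu> \<in> partitions m" "\<tau> \<in> add_box \<mu>" for \<mu> \<tau> m
    using that partitionsD(1)[OF that(1)] by (simp add: remove_box_def)
  have add: "\<mu> \<in> partitions k" if "\<kappa> \<in> remove_box \<nu>" "\<mu> \<in> add_box \<kappa>" for \<kappa> \<mu>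
    using add_box_partitions[OF remove_box_partitions(1)[OF \<nu> that(1)] that(2)]
      remove_box_partitions(2)[OF \<nu> that(1)] by simp
  have same: "(\<Union>\<tau>\<in>add_box \<nu>. remove_box \<tau> - {\<nu>}) = (\<Union>\<kappa>\<in>remove_box \<nu>. add_box \<kappa> - {\<nu>})" (is "?U = ?V")
  proof (intro equalityI subsetI)
    fix \<mu> assume "\<mu> \<in> ?U"
    then obtain \<tau> where \<tau>: "\<tau> \<in> add_box \<nu>" "\<mu> \<in> remove_box \<tau>" "\<mu> \<noteq> \<nu>" by auto
    have \<mu>: "\<mu> \<in> partitions k" "\<tau> \<in> add_box \<mu>" using rem[OF \<tau>(1,2)] \<tau>(2) by (auto simp: remove_box_def)
    obtain \<kappa> m where \<kappa>: "\<kappa> \<in> partitions m" "diagram \<kappa> = diagram \<nu> \<inter> diagram \<mu>"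
      using partition_of_young[OF young_Int[OF young_diagram[OF \<nu>] young_diagram[OF \<mu>(1)]]] by metis
    have ne: "diagram \<nu> \<noteq> diagram \<mu>" using diagram_inj[OF \<nu> \<mu>(1)] \<tau>(3) by auto
    note u = two_ups[OF new_cell(2)[OF \<tau>(1)] new_cell(2)[OF \<mu>(2)] new_cell(1)[OF \<tau>(1)] new_cell(1)[OF \<mu>(2)] ne]
    have "\<nu> \<in> add_box \<kappa>" by (rule add_boxI[OF \<kappa>(1) \<nu>, of "new_cell \<mu> \<tau>"]) (use \<kappa>(2) u in simp_all)
    moreover have "\<mu> \<in> add_box \<kappa>" by (rule add_boxI[OF \<kappa>(1) \<mu>(1), of "new_cell \<nu> \<tau>"]) (use \<kappa>(2) u in simp_all)
    ultimately show "\<mu> \<in> ?V" using remI[OF \<kappa>(1)] \<tau>(3) by auto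
  next
    fix \<mu> assume "\<mu> \<in> ?V"
    then obtain \<kappa> where \<kappa>: "\<kappa> \<in> remove_box \<nu>" "\<mu> \<in> add_box \<kappa>" "\<mu> \<noteq> \<nu>" by auto
    then have \<nu>\<kappa>: "\<nu> \<in> add_box \<kappa>" by (simp add: remove_box_def)
    have \<mu>: "\<mu> \<in> partitions k" by (rule add[OF \<kappa>(1,2)])
    obtain \<tau> m where \<tau>: "\<tau> \<in> partitions m" "diagram \<tau> = diagram \<nu> \<union> diagram \<mu>"
      using partition_of_young[OF young_Un[OF young_diagram[OF \<nu>] young_diagram[OF \<mu>]]] by metis
    have ne: "diagram \<nu> \<noteq> diagram \<mu>" using diagram_inj[OF \<nu> \<mu>] \<kappa>(3) by auto
    note u = two_downs[OF new_cell(2)[OF \<nu>\<kappa>] new_cell(2)[OF \<kappa>(2)] new_cell(1)[OF \<nu>\<kappa>] new_cell(1)[OF \<kappa>(2)] ne]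
    have "\<tau> \<in> add_box \<nu>" by (rule add_boxI[OF \<nu> \<tau>(1), of "new_cell \<kappa> \<mu>"]) (use \<tau>(2) u in simp_all)
    moreover have "\<tau> \<in> add_box \<mu>" by (rule add_boxI[OF \<mu> \<tau>(1), of "new_cell \<kappa> \<nu>"]) (use \<tau>(2) u in simp_all)
    ultimately show "\<mu> \<in> ?U" using remI[OF \<mu>] \<kappa>(3) by auto
  qed
  have fin: "finite (remove_box \<tau>)" if "\<tau> \<in> add_box \<nu>" for \<tau>
    using finite_remove_box[OF add_box_partitions[OF \<nu> that]] .
  have "(\<Sum>\<tau>\<in>add_box \<nu>. \<Sum>\<mu>\<in>remove_box \<tau>. f \<mu>) = (\<Sum>\<tau>\<in>add_box \<nu>. f \<nu> + (\<Sum>\<mu>\<in>remove_box \<tau> - {\<nu>}. f \<mu>))"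
    using fin remI[OF \<nu>] by (intro sum.cong refl) (simp add: sum.remove)
  also have "\<dots> = card (add_box \<nu>) * f \<nu> + (\<Sum>\<mu>\<in>?U. f \<mu>)"
  proof -
    have "(\<Sum>\<mu>\<in>?U. f \<mu>) = (\<Sum>\<tau>\<in>add_box \<nu>. \<Sum>\<mu>\<in>remove_box \<tau> - {\<nu>}. f \<mu>)"
    proof (rule sum.UNION_disjoint; (intro ballI impI)?)
      fix \<tau> \<tau>' assume t: "\<tau> \<in> add_box \<nu>" "\<tau>' \<in> add_box \<nu>" "\<tau> \<noteq> \<tau>'"
      have "\<tau> = \<tau>'" if "\<mu> \<in> remove_box \<tau>" "\<mu> \<in> remove_box \<tau>'" "\<mu> \<noteq> \<nu>" for \<mu>
        using up[OF t(1) _ that(3) rem[OF t(1) that(1)]] up[OF t(2) _ that(3) rem[OF t(1) that(1)]] that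
          diagram_inj[OF add_box_partitions[OF \<nu> t(1)] add_box_partitions[OF \<nu> t(2)]]
        by (simp add: remove_box_def)
      then show "(remove_box \<tau> - {\<nu>}) \<inter> (remove_box \<tau>' - {\<nu>}) = {}" using t(3) by blast
    qed (use fin in auto)
    then show ?thesis by (simp add: sum.distrib)
  qed
  also have "\<dots> = card (remove_box \<nu>) * f \<nu> + (\<Sum>\<mu>\<in>?V. f \<mu>) + f \<nu>"
    using card_add_box[OF \<nu>] same by simp
  also have "card (remove_box \<nu>) * f \<nu> + (\<Sum>\<mu>\<in>?V. f \<mu>)
      = (\<Sum>\<kappa>\<in>remove_box \<nu>. f \<nu> + (\<Sum>\<mu>\<in>add_box \<kappa> - {\<nu>}. f \<mu>))"
  proof -
    have "(\<Sum>\<mu>\<in>?V. f \<mu>) = (\<Sum>\<kappa>\<in>remove_box \<nu>. \<Sum>\<mu>\<in>add_box \<kappa> - {\<nu>}. f \<mu>)"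
    proof (rule sum.UNION_disjoint; (intro ballI impI)?)
      fix \<kappa> \<kappa>' assume t: "\<kappa> \<in> remove_box \<nu>" "\<kappa>' \<in> remove_box \<nu>" "\<kappa> \<noteq> \<kappa>'"
      have "\<kappa> = \<kappa>'" if "\<mu> \<in> add_box \<kappa>" "\<mu> \<in> add_box \<kappa>'" "\<mu> \<noteq> \<nu>" for \<mu>
        using down[OF _ that(1,3) add[OF t(1) that(1)]] down[OF _ that(2,3) add[OF t(1) that(1)]] t
          diagram_inj[of \<kappa> "sum_list \<kappa>" \<kappa>' "sum_list \<kappa>'"]
        by (simp add: remove_box_def)
      then show "(add_box \<kappa> - {\<nu>}) \<inter> (add_box \<kappa>' - {\<nu>}) = {}" using t(3) by blast
    qed (use finite_remove_box[OF \<nu>] in auto)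
    then show ?thesis by (simp add: sum.distrib)
  qed
  also have "\<dots> = (\<Sum>\<kappa>\<in>remove_box \<nu>. \<Sum>\<mu>\<in>add_box \<kappa>. f \<mu>)"
    by (intro sum.cong refl) (auto simp: remove_box_def sum.remove[of _ \<nu> f])
  finally show ?thesis .
qed

text \<open>The last cell of the last row has nothing to its right or beneath it.\<close>

lemma remove_box_nonempty:
  assumes "\<tau> \<in> partitions (k + 1)"
  obtains \<nu> where "\<nu> \<in> partitions k" "\<tau> \<in> add_box \<nu>"
proof -
  have "\<tau> \<noteq> []" using assms by (auto simp: partitions_def)
  define r where "r = length \<tau> - 1"
  have r: "r < length \<tau>" using \<open>\<tau> \<noteq> []\<close> by (simp add: r_def)
  let ?c = "(r, \<tau> ! r - 1)"
  have c: "?c \<in> diagram \<tau>" using r partitionsD(3)[OF assms r] by (simp add: diagram_def)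
  have "young (diagram \<tau> - {?c})"
    unfolding young_def
  proof (intro conjI allI impI)
    fix i j i' j' assume ij: "(i, j) \<in> diagram \<tau> - {?c}" "i' \<le> i" "j' \<le> j"
    have "(i', j') \<in> diagram \<tau>" using diagram_down[OF assms _ ij(2,3)] ij(1) by simp
    moreover have "(i', j') \<noteq> ?c"
    proof
      assume e: "(i', j') = ?c"
      then have "i = r" using ij by (auto simp: diagram_def r_def)
      then show False using ij e by (auto simp: diagram_def)
    qed
    ultimately show "(i', j') \<in> diagram \<tau> - {?c}" by simp
  qed simp
  then obtain \<nu> m where \<nu>: "\<nu> \<in> partitions m" "diagram \<nu> = diagram \<tau> - {?c}"
    using partition_of_young by metis
  have a: "\<tau> \<in> add_box \<nu>" by (rule add_boxI[OF \<nu>(1) assms, of ?c]) (use \<nu> c in auto)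
  then have "\<nu> \<in> remove_box \<tau>" using \<nu>(1) partitionsD(1)[OF \<nu>(1)] by (simp add: remove_box_def)
  then show thesis using that a remove_box_partitions(1)[OF assms] by fastforce
qed

text \<open>
  Two families of inequalities are forced to be equalities by the commutation relation
  \<open>sum_up_down\<close>.
\<close>

lemma sum_add_box_eq:
  fixes f :: "nat list \<Rightarrow> nat"
  assumes down: "\<And>k \<tau>. \<tau> \<in> partitions (k + 1) \<Longrightarrow> (\<Sum>\<nu>\<in>remove_box \<tau>. f \<nu>) \<le> f \<tau>"
    and up: "\<And>k \<nu>. \<nu> \<in> partitions k \<Longrightarrow> (\<Sum>\<tau>\<in>add_box \<nu>. f \<tau>) \<le> (k + 1) * f \<nu>"
    and \<nu>: "\<nu> \<in> partitions k"
  shows "(\<Sum>\<tau>\<in>add_box \<nu>. f \<tau>) = (k + 1) * f \<nu>"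
proof -
  \<comment> \<open>At a fixed \<nu> the commutation relation gives (k + 1) f(\<nu>) as the double
    sum, which \<open>down\<close> bounds by the sum over \<open>add_box \<nu>\<close>, and
    \<open>up\<close> bounds this by (k + 1) f(\<nu>) again. Both inequalities are therefore
    equalities, the former one termwise.\<close>
  have J: "(\<Sum>\<kappa>\<in>remove_box \<nu>. \<Sum>\<mu>\<in>add_box \<kappa>. f \<mu>) = k * f \<nu> \<Longrightarrow>
      (\<Sum>\<tau>\<in>add_box \<nu>. f \<tau>) = (k + 1) * f \<nu> \<and> (\<forall>\<tau>\<in>add_box \<nu>. f \<tau> = (\<Sum>\<mu>\<in>remove_box \<tau>. f \<mu>))"
    if \<nu>: "\<nu> \<in> partitions k" for k \<nu>
  proof -
    assume J: "(\<Sum>\<kappa>\<in>remove_box \<nu>. \<Sum>\<mu>\<in>add_box \<kappa>. f \<mu>) = k * f \<nu>"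
    have d: "(\<Sum>\<mu>\<in>remove_box \<tau>. f \<mu>) \<le> f \<tau>" if "\<tau> \<in> add_box \<nu>" for \<tau>
      by (rule down[OF add_box_partitions[OF \<nu> that]])
    have "(k + 1) * f \<nu> = (\<Sum>\<tau>\<in>add_box \<nu>. \<Sum>\<mu>\<in>remove_box \<tau>. f \<mu>)"
      using sum_up_down[OF \<nu>, of f] J by simp
    moreover have "\<dots> \<le> (\<Sum>\<tau>\<in>add_box \<nu>. f \<tau>)" by (rule sum_mono[OF d])
    ultimately have e: "(\<Sum>\<tau>\<in>add_box \<nu>. \<Sum>\<mu>\<in>remove_box \<tau>. f \<mu>) = (\<Sum>\<tau>\<in>add_box \<nu>. f \<tau>)"
        "(\<Sum>\<tau>\<in>add_box \<nu>. f \<tau>) = (k + 1) * f \<nu>"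
      using up[OF \<nu>] by auto
    have "f \<tau> = (\<Sum>\<mu>\<in>remove_box \<tau>. f \<mu>)" if t: "\<tau> \<in> add_box \<nu>" for \<tau>
    proof (rule ccontr)
      assume "f \<tau> \<noteq> (\<Sum>\<mu>\<in>remove_box \<tau>. f \<mu>)"
      then have "(\<Sum>\<mu>\<in>remove_box \<tau>. f \<mu>) < f \<tau>" using d[OF t] by simp
      then have "(\<Sum>\<tau>\<in>add_box \<nu>. \<Sum>\<mu>\<in>remove_box \<tau>. f \<mu>) < (\<Sum>\<tau>\<in>add_box \<nu>. f \<tau>)"
        using d t by (intro sum_strict_mono_ex1) auto
      then show False using e by simp
    qed
    then show "(\<Sum>\<tau>\<in>add_box \<nu>. f \<tau>) = (k + 1) * f \<nu> \<and> (\<forall>\<tau>\<in>add_box \<nu>. f \<tau> = (\<Sum>\<mu>\<in>remove_box \<tau>. f \<mu>))"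
      using e by blast
  qed
  \<comment> \<open>The premise of \<open>J\<close> holds at every rank, by induction: both
    equalities one rank below supply it.\<close>
  have "(\<Sum>\<kappa>\<in>remove_box \<nu>. \<Sum>\<mu>\<in>add_box \<kappa>. f \<mu>) = k * f \<nu>" if "\<nu> \<in> partitions k" for k \<nu>
    using that
  proof (induction k arbitrary: \<nu>)
    case 0
    then have "remove_box \<nu> = {}" using remove_box_partitions(2) by blast
    then show ?case by simp
  next
    case (Suc k)
    then have \<nu>: "\<nu> \<in> partitions (k + 1)" by simp
    obtain \<kappa> where \<kappa>: "\<kappa> \<in> partitions k" "\<nu> \<in> add_box \<kappa>" using remove_box_nonempty[OF \<nu>] .
    \<comment> \<open>One shape \<kappa> below \<nu> is enough: the termwise equality at \<kappa>
      expresses f(\<nu>) through all shapes below \<nu>.\<close>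
    have "f \<nu> = (\<Sum>\<mu>\<in>remove_box \<nu>. f \<mu>)" using J[OF \<kappa>(1) Suc.IH[OF \<kappa>(1)]] \<kappa>(2) by blast
    moreover have "(\<Sum>\<mu>\<in>add_box \<mu>. f \<mu>) = (k + 1) * f \<mu>" if "\<mu> \<in> remove_box \<nu>" for \<mu>
    proof -
      have "\<mu> \<in> partitions k" using remove_box_partitions(1)[OF \<nu> that] by simp
      then show ?thesis using J Suc.IH by blast
    qed
    ultimately show ?case by (simp add: sum_distrib_left)
  qed
  then show ?thesis using J[OF \<nu>] \<nu> by blast
qed

section \<open>The branching rule\<close>

definition sdim :: "nat list \<Rightarrow> nat"
  where "sdim \<nu> = cfun.dim (vs (specht \<nu>))"

lemma linear_fun_sum:
  assumes "\<And>i. i \<in> I \<Longrightarrow> linear_between UNIV UNIV (T i)"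
  shows "linear_between UNIV UNIV (\<lambda>(u :: 'i \<times> 'x \<Rightarrow> complex) z. \<Sum>i\<in>I. T i (\<lambda>x. u (i, x)) z)"
proof (rule linear_betweenI)
  show "(\<lambda>z. \<Sum>i\<in>I. T i (\<lambda>x. u (i, x) + v (i, x)) z)
      = (\<lambda>z. (\<Sum>i\<in>I. T i (\<lambda>x. u (i, x)) z) + (\<Sum>i\<in>I. T i (\<lambda>x. v (i, x)) z))" for u v
    by (simp add: linear_between_add[OF assms] sum.distrib)
  show "(\<lambda>z. \<Sum>i\<in>I. T i (\<lambda>x. c * u (i, x)) z) = (\<lambda>z. c * (\<Sum>i\<in>I. T i (\<lambda>x. u (i, x)) z))" for c u
    by (simp add: linear_between_scale[OF assms] sum_distrib_left)
qed simp

lemma linear_between_mono: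
  "linear_between V W T \<Longrightarrow> V' \<subseteq> V \<Longrightarrow> (\<And>u. u \<in> V' \<Longrightarrow> T u \<in> W') \<Longrightarrow> linear_between V' W' T"
  by (rule linear_betweenI) (auto simp: linear_between_add linear_between_scale subset_iff)

lemma fam_eq_0:
  assumes "v \<in> fam I V" "\<And>i. i \<in> I \<Longrightarrow> (\<lambda>x. v (i, x)) = (\<lambda>x. 0)"
  shows "v = (\<lambda>z. 0)"
  using assms by (fastforce simp: fam_def fun_eq_iff)

lemma linear_insert_entry: "linear_between UNIV UNIV (insert_entry x r)"
  by (rule linear_betweenI) (auto simp: insert_entry_def)

lemma linear_remove_entry: "linear_between UNIV UNIV (remove_entry x r)"
  by (rule linear_betweenI) (auto simp: remove_entry_def)

text \<open>Adding the entry k + 1 in the removed box and applying the Gram operator of \<tau> maps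
  the sum of the S^\<nu> into S^\<tau>. A vector in the kernel pairs to zero with all polytabloids
  of \<tau>, which is what \<open>remove_entry_injective\<close> excludes.\<close>

lemma sum_sdim_remove_box:
  assumes \<tau>: "\<tau> \<in> partitions (k + 1)"
  shows "(\<Sum>\<nu>\<in>remove_box \<tau>. sdim \<nu>) \<le> sdim \<tau>"
proof -
  let ?I = "remove_box \<tau>"
  let ?V = "fam ?I (\<lambda>\<nu>. vs (specht \<nu>))"
  define L where "L v = (\<lambda>T. \<Sum>\<nu>\<in>?I. remove_entry (k + 1) (new_row \<nu> \<tau>) (\<lambda>T. v (\<nu>, T)) T)"
    for v :: "nat list \<times> tabloid \<Rightarrow> complex"
  have L: "linear_between UNIV UNIV L"
    unfolding L_def by (rule linear_fun_sum[OF linear_remove_entry])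
  have lin: "linear_between ?V (vs (specht \<tau>)) (\<lambda>v. gram \<tau> (L v))"
    by (rule linear_between_mono[OF linear_between_comp[OF L linear_gram]])
      (auto intro: linear_between_in[OF linear_gram])
  have fin: "finite ?I" by (rule finite_remove_box[OF \<tau>])
  have fd: "fin_dim ?V" by (rule fin_dim_fam[OF fin fin_dim_specht])
  have "inj_on (\<lambda>v. gram \<tau> (L v)) ?V"
  proof (rule linear_between_inj_onI[OF lin fin_dimD[OF fd]])
    fix v assume v: "v \<in> ?V" and 0: "gram \<tau> (L v) = (\<lambda>T. 0)"
    have "(\<lambda>T. v (\<nu>, T)) = (\<lambda>T. 0)" if "\<nu> \<in> ?I" for \<nu>
    proof (rule remove_entry_injective[OF \<tau> remove_box_eq[OF \<tau>], of "\<lambda>\<nu> T. v (\<nu>, T)"])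
      show "(\<lambda>T. v (\<nu>, T)) \<in> vs (specht \<nu>)" if "\<nu> \<in> ?I" for \<nu> using v that by (simp add: fam_def)
      fix t assume "t \<in> tableaux \<tau>"
      then have "pairing (k + 1) (L v) (polytabloid \<tau> t) = 0"
        by (intro gram_eq_0[OF \<tau> 0]) (simp add: polytabloids_def)
      then show "(\<Sum>\<nu>\<in>?I. pairing (k + 1) (remove_entry (k + 1) (new_row \<nu> \<tau>) (\<lambda>T. v (\<nu>, T))) (polytabloid \<tau> t)) = 0"
        by (simp add: L_def pairing_sum)
    qed (rule that)
    then show "v = (\<lambda>z. 0)" by (rule fam_eq_0[OF v])
  qed
  from dim_le_inj(1)[OF lin this fd fin_dim_specht] show ?thesis
    by (simp add: sdim_def dim_fam[OF fin fin_dim_specht])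
qed

lemma insert_entry_perm_act:
  assumes \<sigma>: "\<sigma> permutes {1..k}"
  shows "insert_entry (k + 1) r (perm_act \<sigma> u) = perm_act \<sigma> (insert_entry (k + 1) r u)"
proof
  fix T
  have "inv' \<sigma> (k + 1) = k + 1" using permutes_not_in[OF permutes_inv[OF \<sigma>], of "k + 1"] by simp
  then have "(\<lambda>i. inv' \<sigma> ` (T(r := insert (k + 1) (T r))) i) = (\<lambda>i. inv' \<sigma> ` T i)(r := insert (k + 1) (inv' \<sigma> ` T r))"
    by (intro ext) auto
  then show "insert_entry (k + 1) r (perm_act \<sigma> u) T = perm_act \<sigma> (insert_entry (k + 1) r u) T"
    by (simp only: insert_entry_def perm_act_def)
qed

text \<open>Defined on all functions on tabloids, so that linearity and equivariance under
  permutations of 1, ..., k hold without membership conditions.\<close>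

definition branch :: "nat list \<Rightarrow> nat list \<Rightarrow> (tabloid \<Rightarrow> complex) \<Rightarrow> (tabloid \<Rightarrow> complex)"
  where "branch \<nu> \<tau> u = gram \<nu> (insert_entry (sum_list \<nu> + 1) (new_row \<nu> \<tau>) u)"

lemma linear_branch: "linear_between UNIV (vs (specht \<nu>)) (branch \<nu> \<tau>)"
  unfolding branch_def[abs_def] by (rule linear_between_comp[OF linear_insert_entry linear_gram])

lemma branch_perm_act:
  "\<sigma> permutes {1..sum_list \<nu>} \<Longrightarrow> branch \<nu> \<tau> (perm_act \<sigma> u) = perm_act \<sigma> (branch \<nu> \<tau> u)"
  by (simp only: branch_def insert_entry_perm_act gram_perm_act)

text \<open>The hypothesis for all \<sigma> says that \<open>v\<close> lies in the kernel of the map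
  obtained by Frobenius reciprocity. The Gram operator is linear, so the vanishing of the sum passes
  to the pairings with polytabloids.\<close>

lemma branch_injective:
  assumes \<nu>: "\<nu> \<in> partitions k" and v: "v \<in> fam (add_box \<nu>) (\<lambda>\<tau>. vs (specht \<tau>))"
    and 0: "\<And>\<sigma> T. \<sigma> permutes {1..k + 1} \<Longrightarrow>
      (\<Sum>\<tau>\<in>add_box \<nu>. branch \<nu> \<tau> (perm_act \<sigma> (\<lambda>T. v (\<tau>, T))) T) = 0"
  shows "v = (\<lambda>z. 0)"
proof (rule fam_eq_0[OF v])
  fix \<tau> assume "\<tau> \<in> add_box \<nu>"
  then show "(\<lambda>T. v (\<tau>, T)) = (\<lambda>T. 0)"
  proof (rule insert_entry_injective[OF \<nu>, of "\<lambda>\<tau> T. v (\<tau>, T)", rotated 2])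
    show "(\<lambda>T. v (\<tau>, T)) \<in> vs (specht \<tau>)" if "\<tau> \<in> add_box \<nu>" for \<tau> using v that by (simp add: fam_def)
    fix \<sigma> t assume \<sigma>: "\<sigma> permutes {1..k + 1}" and t: "t \<in> tableaux \<nu>"
    let ?u = "\<lambda>T. \<Sum>\<tau>\<in>add_box \<nu>. insert_entry (k + 1) (new_row \<nu> \<tau>) (perm_act \<sigma> (\<lambda>T. v (\<tau>, T))) T"
    have "gram \<nu> ?u = (\<lambda>T. \<Sum>\<tau>\<in>add_box \<nu>. branch \<nu> \<tau> (perm_act \<sigma> (\<lambda>T. v (\<tau>, T))) T)"
      using linear_between_sum[OF linear_gram, of "add_box \<nu>"] partitionsD(1)[OF \<nu>]
      by (simp add: branch_def)
    then have "gram \<nu> ?u = (\<lambda>T. 0)" using 0[OF \<sigma>] by simp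
    then have "pairing k ?u (polytabloid \<nu> t) = 0"
      using t by (intro gram_eq_0[OF \<nu>]) (simp_all add: polytabloids_def)
    then show "(\<Sum>\<tau>\<in>add_box \<nu>. pairing k (insert_entry (k + 1) (new_row \<nu> \<tau>) (perm_act \<sigma> (\<lambda>T. v (\<tau>, T)))) (polytabloid \<nu> t)) = 0"
      by (simp add: pairing_sum)
  qed
qed

text \<open>Treats \<open>triv_char\<close> and \<open>sign_char\<close> uniformly. Multiplicativity
  is asked for on the carrier, as \<open>sign_char\<close> is not multiplicative for other
  integers.\<close>

definition Z2_char :: "(int \<Rightarrow> complex) \<Rightarrow> bool"
  where "Z2_char D \<longleftrightarrow> D 0 = 1 \<and> (\<forall>x\<in>{0, 1}. \<forall>y\<in>{0, 1}. D (x \<otimes>\<^bsub>Z2\<^esub> y) = D x * D y)"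

lemma Z2_char_triv: "Z2_char triv_char" and Z2_char_sign: "Z2_char sign_char"
  by (auto simp: Z2_char_def triv_char_def sign_char_def mult_integer_mod_group)

lemma B_simps:
  "carrier (B m) = (\<Pi>\<^sub>E i\<in>{1..m}. {0, 1}) \<times> {p. p permutes {1..m}}"
  "\<one>\<^bsub>B m\<^esub> = (\<lambda>i\<in>{1..m}. 0, id)"
  by (simp_all add: B_def wreath_simps carrier_Z2 one_integer_mod_group)

text \<open>The twist by \<sigma> only reorders the factors of a product over all coordinates. Hence
  the product of the values of \<open>D\<close> is a character of the whole wreath product.\<close>

lemma Z2_char_mult:
  assumes D: "Z2_char D" and g: "(f, \<sigma>) \<in> carrier (B m)" and h: "(f', \<sigma>') \<in> carrier (B m)"
  shows "(\<Prod>i=1..m. D (fst ((f, \<sigma>) \<otimes>\<^bsub>B m\<^esub> (f', \<sigma>')) i)) = (\<Prod>i=1..m. D (f i)) * (\<Prod>i=1..m. D (f' i))"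
proof -
  have \<sigma>: "inv' \<sigma> permutes {1..m}" using g by (auto simp: B_simps permutes_inv)
  have "(\<Prod>i=1..m. D (fst ((f, \<sigma>) \<otimes>\<^bsub>B m\<^esub> (f', \<sigma>')) i)) = (\<Prod>i=1..m. D (f i) * D (f' (inv' \<sigma> i)))"
  proof (rule prod.cong[OF refl])
    fix i assume i: "i \<in> {1..m}"
    have "f i \<in> {0, 1}" "f' (inv' \<sigma> i) \<in> {0, 1}"
      using g h i permutes_le[OF \<sigma> i] by (simp_all only: B_simps mem_Times_iff fst_conv PiE_iff)
    then have "D (f i \<otimes>\<^bsub>Z2\<^esub> f' (inv' \<sigma> i)) = D (f i) * D (f' (inv' \<sigma> i))"
      using D unfolding Z2_char_def by blast
    then show "D (fst ((f, \<sigma>) \<otimes>\<^bsub>B m\<^esub> (f', \<sigma>')) i) = D (f i) * D (f' (inv' \<sigma> i))"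
      using i by (simp add: B_def wreath_simps)
  qed
  also have "\<dots> = (\<Prod>i=1..m. D (f i)) * (\<Prod>i=1..m. D (f' i))"
    using prod.permute[OF \<sigma>, of "\<lambda>i. D (f' i)"] by (simp add: prod.distrib o_def)
  finally show ?thesis .
qed

lemma group_rep_wreath:
  assumes D: "Z2_char D" and E: "group_rep (sym_group m) E"
  shows "group_rep (B m) (wreath_rep D m E)"
  unfolding group_rep_iff
proof (intro conjI ballI)
  note E = group_repD[OF E]
  have vs: "vs (wreath_rep D m E) = vs E" by (simp add: wreath_rep_def)
  have act: "act (wreath_rep D m E) (f, \<sigma>) u = (\<lambda>x. (\<Prod>i = 1..m. D (f i)) * act E \<sigma> u x)" for f \<sigma> u
    by (simp add: wreath_rep_def cscale_def)
  show "group (B m)" "fin_dim (vs (wreath_rep D m E))" using E by (simp_all add: vs)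
  show "linear_between (vs (wreath_rep D m E)) (vs (wreath_rep D m E)) (act (wreath_rep D m E) g)"
    if "g \<in> carrier (B m)" for g
  proof -
    obtain f \<sigma> where g: "g = (f, \<sigma>)" "\<sigma> \<in> carrier (sym_group m)"
      using \<open>g \<in> carrier (B m)\<close> by (cases g) (auto simp: B_simps sym_group_carrier)
    show ?thesis
      unfolding g(1) act vs
      by (rule linear_betweenI)
        (simp_all add: act subspace_scale[OF E(3) E(7)[OF g(2)]] linear_between_add[OF E(4)[OF g(2)]]
          linear_between_scale[OF E(4)[OF g(2)]] distrib_left mult.left_commute)
  qed
  show "act (wreath_rep D m E) \<one>\<^bsub>B m\<^esub> u = u" if "u \<in> vs (wreath_rep D m E)" for u
    using E(5)[of u] that D by (simp add: B_simps act vs sym_group_one Z2_char_def)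
  show "act (wreath_rep D m E) (g \<otimes>\<^bsub>B m\<^esub> h) u = act (wreath_rep D m E) g (act (wreath_rep D m E) h u)"
    if g: "g \<in> carrier (B m)" and h: "h \<in> carrier (B m)" and u: "u \<in> vs (wreath_rep D m E)" for g h u
  proof -
    obtain f \<sigma> f' \<sigma>' where gh: "g = (f, \<sigma>)" "h = (f', \<sigma>')" by force
    have s: "\<sigma> \<in> carrier (sym_group m)" "\<sigma>' \<in> carrier (sym_group m)"
      using g h by (auto simp: gh B_simps sym_group_carrier)
    have p: "g \<otimes>\<^bsub>B m\<^esub> h = (fst (g \<otimes>\<^bsub>B m\<^esub> h), \<sigma> \<circ> \<sigma>')" by (simp add: gh B_def wreath_simps)
    have "act E (\<sigma> \<circ> \<sigma>') u = act E \<sigma> (act E \<sigma>' u)"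
      using E(6)[OF s] u by (simp add: vs sym_group_mult)
    then show ?thesis
      using Z2_char_mult[OF D g[unfolded gh] h[unfolded gh]] u
      by (subst p) (simp add: gh act linear_between_scale[OF E(4)[OF s(1)] E(7)[OF s(2)]] vs mult.assoc)
  qed
qed

lemma wreath_rep_simps:
  "vs (wreath_rep D m E) = vs E"
  "act (wreath_rep D m E) (f, \<sigma>) u = (\<lambda>x. (\<Prod>i = 1..m. D (f i)) * act E \<sigma> u x)"
  by (simp_all add: wreath_rep_def cscale_def)

section \<open>The branching rule for one character on both factors\<close>

lemma group_rep_trivial: "group G \<Longrightarrow> group_rep G trivial_rep"
proof -
  assume G: "group G"
  have "(u :: unit \<Rightarrow> complex) \<in> cfun.span {\<lambda>_. 1}" for u
  proof -
    have eq: "cscale (u ()) (\<lambda>_. 1) = u" by (auto simp: cscale_def)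
    have "cscale (u ()) (\<lambda>_ :: unit. 1) \<in> cfun.span {\<lambda>_. 1}"
      by (intro cfun.span_scale cfun.span_base) simp
    then show ?thesis unfolding eq .
  qed
  then have "fin_dim (UNIV :: (unit \<Rightarrow> complex) set)"
    by (intro fin_dimI[where S = "{\<lambda>_. 1}"]) auto
  then show ?thesis
    using G by (auto simp: group_rep_iff trivial_rep_def intro: linear_betweenI)
qed

text \<open>Because \<open>D\<close> appears on both factors, this is (D; E) with E induced from S_k
  to S_{k+1}.\<close>

abbreviation branch_induced :: "(int \<Rightarrow> complex) \<Rightarrow> nat \<Rightarrow> nat list \<Rightarrow> (hyperoct, hyperoct \<times> (tabloid \<times> unit)) rep"
  where "branch_induced D k \<nu> \<equiv> induced_rep (B (k + 1)) (B k \<times>\<times> B 1) (block_emb k 1)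
    (outer_tensor (wreath_rep D k (specht \<nu>)) (wreath_rep D 1 trivial_rep))"

lemma block_emb_B: "block_emb a b \<in> hom (B a \<times>\<times> B b) (B (a + b))"
  unfolding B_def by (rule block_emb_hom)

lemma block_perm_one:
  assumes "\<sigma> permutes {1..k}" "\<tau> permutes {1..1}"
  shows "block_perm k 1 \<sigma> \<tau> = \<sigma>"
proof -
  have "\<tau> 1 = 1" using permutes_cases(2)[OF assms(2), of 1] by simp
  moreover have "\<sigma> (k + 1) = k + 1" using permutes_not_in[OF assms(1)] by simp
  moreover have "\<sigma> i = i" if "i > k" for i using permutes_cases(3)[OF assms(1) that] .
  ultimately show ?thesis
    by (intro ext) (auto simp: block_perm_def le_Suc_eq)
qed

lemma outer_wreath_act:
  "act (outer_tensor (wreath_rep D k E) (wreath_rep D' 1 trivial_rep)) ((f, \<sigma>), (f', \<tau>)) w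
    = (\<lambda>(x, _). D' (f' 1) * ((\<Prod>i=1..k. D (f i)) * act E \<sigma> (\<lambda>x. w (x, ())) x))"
  by (auto simp: outer_tensor_simps map_left_def map_right_def wreath_rep_simps trivial_rep_def fun_eq_iff)

lemma group_rep_branch_induced:
  assumes "Z2_char D" "\<nu> \<in> partitions k"
  shows "group_rep (B (k + 1)) (branch_induced D k \<nu>)"
  using assms
  by (intro group_rep_induced group_rep_outer_tensor group_rep_wreath group_rep_specht group_rep_trivial
      block_emb_B sym_group_is_group) auto

text \<open>An equivariant function is determined by its values on coset representatives.\<close>

lemma dim_branch_induced:
  assumes D: "Z2_char D" and \<nu>: "\<nu> \<in> partitions k"
  shows "cfun.dim (vs (branch_induced D k \<nu>)) \<le> (k + 1) * sdim \<nu>"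
proof -
  let ?W = "branch_induced D k \<nu>"
  \<comment> \<open>Representatives of the k + 1 cosets: transpositions with the last point, with
    trivial base part.\<close>
  let ?g = "\<lambda>i. (\<lambda>j\<in>{1..k + 1}. 0 :: int, transpose i (k + 1))"
  let ?V = "fam {1..k + 1} (\<lambda>_. vs (specht \<nu>))"
  define F where "F u = (\<lambda>(i, T). if i \<in> {1..k + 1} then u (?g i, (T, ())) else 0)"
    for u :: "hyperoct \<times> (tabloid \<times> unit) \<Rightarrow> complex"
  have g: "?g i \<in> carrier (B (k + 1))" if "i \<in> {1..k + 1}" for i
    using that by (auto simp: B_simps intro: permutes_swap_id)
  have W: "fin_dim (vs ?W)" using group_repD(2)[OF group_rep_branch_induced[OF D \<nu>]] .
  have ten: "vs (outer_tensor (wreath_rep D k (specht \<nu>)) (wreath_rep D 1 trivial_rep))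
      = tensor (vs (specht \<nu>)) UNIV"
    by (simp add: outer_tensor_simps wreath_rep_simps trivial_rep_def)
  have lin: "linear_between (vs ?W) ?V F"
  proof (rule linear_betweenI)
    show "F u \<in> ?V" if u: "u \<in> vs ?W" for u
      using induced_repD(1)[OF u g] unfolding ten tensor_UNIV_unit[OF fin_dimD[OF fin_dim_specht]]
      by (auto simp: fam_def F_def)
  qed (auto simp: F_def)
  have "inj_on F (vs ?W)"
  proof (rule linear_between_inj_onI[OF lin fin_dimD[OF W]])
    fix u assume u: "u \<in> vs ?W" and 0: "F u = (\<lambda>x. 0)"
    have zero: "(\<lambda>z. u (?g i, z)) = (\<lambda>z. 0)" if "i \<in> {1..k + 1}" for i
    proof
      fix z :: "tabloid \<times> unit"
      show "u (?g i, z) = 0" using fun_cong[OF 0, of "(i, fst z)"] that by (cases z) (simp add: F_def)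
    qed
    show "u = (\<lambda>x. 0)"
    proof
      fix y :: "hyperoct \<times> (tabloid \<times> unit)"
      obtain f \<sigma> z where y: "y = ((f, \<sigma>), z)" by (metis prod.collapse)
      show "u y = 0"
      proof (cases "(f, \<sigma>) \<in> carrier (B (k + 1))")
        case False
        then show ?thesis using induced_repD(2)[OF u] y by simp
      next
        case True
        have f: "f \<in> (\<Pi>\<^sub>E i\<in>{1..k + 1}. {0, 1})" and \<sigma>: "\<sigma> permutes {1..k + 1}"
          using True by (auto simp: B_simps)
        \<comment> \<open>With this choice \<sigma> followed after the transposition of i and k + 1
          fixes k + 1, so it lies in S_k.\<close>
        define i where "i = inv' \<sigma> (k + 1)"
        have i: "i \<in> {1..k + 1}" unfolding i_def by (rule permutes_le[OF permutes_inv[OF \<sigma>]]) simp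
        let ?\<rho> = "transpose i (k + 1)"
        have \<rho>: "?\<rho> permutes {1..k + 1}" using i by (intro permutes_swap_id) auto
        define \<sigma>' where "\<sigma>' = \<sigma> \<circ> ?\<rho>"
        have "\<sigma>' permutes {1..k + 1}" unfolding \<sigma>'_def by (rule permutes_compose[OF \<rho> \<sigma>])
        moreover have "\<sigma>' (k + 1) = k + 1" by (simp add: \<sigma>'_def i_def permutes_inverses[OF \<sigma>])
        ultimately have \<sigma>': "\<sigma>' permutes {1..k}" using permutes_remove_last by blast
        \<comment> \<open>The whole base part goes into the subgroup: the last coordinate of
          \<open>f\<close> becomes the component in B_1.\<close>
        let ?h = "((\<lambda>i\<in>{1..k}. f i, \<sigma>'), (\<lambda>i\<in>{1..1}. f (k + 1), id))"
        have h: "?h \<in> carrier (B k \<times>\<times> B 1)"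
          using f \<sigma>' by (auto simp: B_simps permutes_id PiE_iff)
        have "block_emb k 1 ?h \<otimes>\<^bsub>B (k + 1)\<^esub> ?g i = (f, \<sigma>)"
        proof -
          have "fst (block_emb k 1 ?h \<otimes>\<^bsub>B (k + 1)\<^esub> ?g i) j = f j" for j
          proof (cases "j \<in> {1..k + 1}")
            case True
            have "inv' \<sigma>' j \<in> {1..k + 1}"
              by (rule permutes_le[OF permutes_inv[OF \<open>\<sigma>' permutes {1..k + 1}\<close>] True])
            moreover have "f j \<in> {0, 1}" using PiE_mem[OF f True] .
            moreover have "j \<le> k \<or> j = k + 1" using True by auto
            ultimately show ?thesis
              using True block_perm_one[OF \<sigma>' permutes_id[of "{1..1}"]]
              by (auto simp: block_emb_eq B_def wreath_simps mult_integer_mod_group)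
          next
            case False
            then show ?thesis using PiE_arb[OF f False] by (auto simp: block_emb_eq B_def wreath_simps)
          qed
          moreover have "snd (block_emb k 1 ?h \<otimes>\<^bsub>B (k + 1)\<^esub> ?g i) = \<sigma>"
            using block_perm_one[OF \<sigma>' permutes_id[of "{1..1}"]]
            by (simp add: block_emb_eq B_def wreath_simps \<sigma>'_def o_assoc[symmetric])
          ultimately show ?thesis by (simp add: prod_eq_iff fun_eq_iff)
        qed
        then have "(\<lambda>x. u ((f, \<sigma>), x)) = act (outer_tensor (wreath_rep D k (specht \<nu>)) (wreath_rep D 1 trivial_rep)) ?h (\<lambda>z. u (?g i, z))"
          using induced_repD(3)[OF u h g[OF i]] by simp
        also have "\<dots> = (\<lambda>z. 0)"
          unfolding zero[OF i] outer_wreath_act by (auto simp: specht_simps perm_act_def)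
        finally show ?thesis using y by (metis (no_types))
      qed
    qed
  qed
  from dim_le_inj(1)[OF lin this W fin_dim_fam[OF _ fin_dim_specht]]
  have "cfun.dim (vs ?W) \<le> cfun.dim ?V" by simp
  also have "\<dots> = (k + 1) * sdim \<nu>" by (subst dim_fam) (auto simp: fin_dim_specht sdim_def)
  finally show ?thesis .
qed

text \<open>Frobenius reciprocity: \<open>v\<close> becomes the function g \<mapsto> branch (g v),
  summed over \<tau>, where g = (f, \<sigma>) acts on the component at \<tau> through (D; S^\<tau>).
  The scalar from \<open>f\<close> is pulled out in front.\<close>

definition branch_map :: "(int \<Rightarrow> complex) \<Rightarrow> nat \<Rightarrow> nat list \<Rightarrow>
    (nat list \<times> tabloid \<Rightarrow> complex) \<Rightarrow> (hyperoct \<times> (tabloid \<times> unit) \<Rightarrow> complex)"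
  where "branch_map D k \<nu> v = (\<lambda>((f, \<sigma>), (T, _)). if (f, \<sigma>) \<in> carrier (B (k + 1))
    then (\<Prod>i=1..k + 1. D (f i)) * (\<Sum>\<tau>\<in>add_box \<nu>. branch \<nu> \<tau> (perm_act \<sigma> (\<lambda>T. v (\<tau>, T))) T) else 0)"

text \<open>Equivariance has two sources: \<open>branch\<close> commutes with S_k, and the product
  of the values of \<open>D\<close> is multiplicative, with the component in B_1 supplying the
  factor of coordinate k + 1.\<close>

lemma branch_map_in:
  assumes D: "Z2_char D" and \<nu>: "\<nu> \<in> partitions k"
  shows "branch_map D k \<nu> v \<in> vs (branch_induced D k \<nu>)"
proof (rule induced_repI)
  interpret Bk: group "B (k + 1)" by simp
  note k = partitionsD(1)[OF \<nu>]
  fix g assume g: "g \<in> carrier (B (k + 1))"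
  obtain f \<sigma> where fs: "g = (f, \<sigma>)" by force
  have "(\<lambda>T. (\<Prod>i=1..k + 1. D (f i)) * (\<Sum>\<tau>\<in>add_box \<nu>. branch \<nu> \<tau> (perm_act \<sigma> (\<lambda>T. v (\<tau>, T))) T)) \<in> vs (specht \<nu>)"
    by (intro subspace_scale subspace_sum fin_dimD[OF fin_dim_specht] linear_between_in[OF linear_branch]) simp
  then show "(\<lambda>x. branch_map D k \<nu> v (g, x)) \<in> vs (outer_tensor (wreath_rep D k (specht \<nu>)) (wreath_rep D 1 trivial_rep))"
    using g by (simp add: outer_tensor_simps wreath_rep_simps trivial_rep_def
        tensor_UNIV_unit[OF fin_dimD[OF fin_dim_specht]] branch_map_def fs)
  fix h assume h: "h \<in> carrier (B k \<times>\<times> B 1)"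
  obtain f1 \<sigma>1 f2 \<sigma>2 where hh: "h = ((f1, \<sigma>1), (f2, \<sigma>2))" by (metis prod.collapse)
  have s: "\<sigma>1 permutes {1..k}" "\<sigma>2 permutes {1..1}" using h by (auto simp: hh B_simps)
  define hf where "hf = fst (block_emb k 1 h)"
  have bl: "block_emb k 1 h = (hf, \<sigma>1)"
    unfolding hf_def hh block_emb_eq block_perm_one[OF s] by simp
  have blG: "block_emb k 1 h \<in> carrier (B (k + 1))"
    using block_emb_B[of k 1] h by (auto simp: hom_def)
  have Phf: "(\<Prod>i=1..k + 1. D (hf i)) = (\<Prod>i=1..k. D (f1 i)) * D (f2 1)"
    by (simp add: hf_def hh block_emb_eq)
  define a where "a = fst (block_emb k 1 h \<otimes>\<^bsub>B (k + 1)\<^esub> g)"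
  have m: "block_emb k 1 h \<otimes>\<^bsub>B (k + 1)\<^esub> g = (a, \<sigma>1 \<circ> \<sigma>)"
    unfolding a_def bl fs by (simp add: B_def wreath_simps)
  have c: "(a, \<sigma>1 \<circ> \<sigma>) \<in> carrier (B (k + 1))"
    using Bk.m_closed[OF blG g] unfolding m .
  have Pa: "(\<Prod>i=1..k + 1. D (a i)) = (\<Prod>i=1..k + 1. D (hf i)) * (\<Prod>i=1..k + 1. D (f i))"
    unfolding a_def bl fs by (rule Z2_char_mult[OF D blG[unfolded bl] g[unfolded fs]])
  have "\<sigma> permutes {1..k + 1}" using g by (auto simp: fs B_simps)
  then have b: "branch \<nu> \<tau> (perm_act (\<sigma>1 \<circ> \<sigma>) u) = perm_act \<sigma>1 (branch \<nu> \<tau> (perm_act \<sigma> u))" for \<tau> u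
    using s(1) k by (simp add: perm_act_comp permutes_bij branch_perm_act)
  have "branch_map D k \<nu> v ((a, \<sigma>1 \<circ> \<sigma>), (T, y)) = D (f2 1) * ((\<Prod>i=1..k. D (f1 i)) *
      perm_act \<sigma>1 (\<lambda>T. branch_map D k \<nu> v ((f, \<sigma>), (T, ()))) T)" for T y
    using c g unfolding branch_map_def prod.case Pa Phf b fs
    by (simp only: if_True perm_act_def mult_ac)
  then show "(\<lambda>x. branch_map D k \<nu> v (block_emb k 1 h \<otimes>\<^bsub>B (k + 1)\<^esub> g, x))
      = act (outer_tensor (wreath_rep D k (specht \<nu>)) (wreath_rep D 1 trivial_rep)) h (\<lambda>x. branch_map D k \<nu> v (g, x))"
    unfolding m unfolding hh fs outer_wreath_act specht_simps by (auto simp: fun_eq_iff)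
qed (auto simp: branch_map_def)

lemma
  assumes D: "Z2_char D" and \<nu>: "\<nu> \<in> partitions k"
  shows linear_branch_map: "linear_between (fam (add_box \<nu>) (\<lambda>\<tau>. vs (specht \<tau>))) (vs (branch_induced D k \<nu>)) (branch_map D k \<nu>)"
    and inj_branch_map: "inj_on (branch_map D k \<nu>) (fam (add_box \<nu>) (\<lambda>\<tau>. vs (specht \<tau>)))"
proof -
  let ?V = "fam (add_box \<nu>) (\<lambda>\<tau>. vs (specht \<tau>))"
  show lin: "linear_between ?V (vs (branch_induced D k \<nu>)) (branch_map D k \<nu>)"
  proof (rule linear_betweenI)
    have L: "linear_between UNIV UNIV (\<lambda>v T. \<Sum>\<tau>\<in>add_box \<nu>. branch \<nu> \<tau> (perm_act \<sigma> (\<lambda>T. v (\<tau>, T))) T)" for \<sigma>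
      by (rule linear_fun_sum[OF linear_between_comp[OF linear_perm_act linear_between_mono[OF linear_branch]]]) auto
    show "branch_map D k \<nu> (\<lambda>x. u x + v x) = (\<lambda>x. branch_map D k \<nu> u x + branch_map D k \<nu> v x)" for u v
      using linear_between_add[OF L, where u = u and v = v] by (auto simp: branch_map_def fun_eq_iff algebra_simps)
    show "branch_map D k \<nu> (\<lambda>x. c * u x) = (\<lambda>x. c * branch_map D k \<nu> u x)" for c u
      using linear_between_scale[OF L, where u = u and c = c] by (auto simp: branch_map_def fun_eq_iff)
  qed (rule branch_map_in[OF D \<nu>])
  show "inj_on (branch_map D k \<nu>) ?V"
  proof (rule linear_between_inj_onI[OF lin fin_dimD[OF fin_dim_fam[OF finite_add_box fin_dim_specht]]])
    fix v assume v: "v \<in> ?V" and 0: "branch_map D k \<nu> v = (\<lambda>x. 0)"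
    show "v = (\<lambda>x. 0)"
    proof (rule branch_injective[OF \<nu> v])
      fix \<sigma> T assume \<sigma>: "\<sigma> permutes {1..k + 1}"
      \<comment> \<open>Evaluation at elements with trivial base part is enough to see all \<sigma>,
        and there the character factor is 1.\<close>
      then have c: "(\<lambda>i\<in>{1..k + 1}. 0, \<sigma>) \<in> carrier (B (k + 1))" by (auto simp: B_simps)
      have "D 0 = 1" using D by (simp add: Z2_char_def)
      then show "(\<Sum>\<tau>\<in>add_box \<nu>. branch \<nu> \<tau> (perm_act \<sigma> (\<lambda>T. v (\<tau>, T))) T) = 0"
        using fun_cong[OF 0, of "((\<lambda>i\<in>{1..k + 1}. 0, \<sigma>), (T, ()))"] c
        by (simp add: branch_map_def del: prod.cl_ivl_Suc)
    qed
  qed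
qed

text \<open>The identity mentions no character, so the upper bound is taken from the branching map
  for \<open>triv_char\<close>. The result then serves every \<open>D\<close>.\<close>

lemma sum_sdim_add_box:
  assumes "\<nu> \<in> partitions k"
  shows "(\<Sum>\<tau>\<in>add_box \<nu>. sdim \<tau>) = (k + 1) * sdim \<nu>"
proof (rule sum_add_box_eq[OF sum_sdim_remove_box _ assms])
  fix k \<nu> assume \<nu>: "\<nu> \<in> partitions k"
  note D = Z2_char_triv
  have fd: "fin_dim (fam (add_box \<nu>) (\<lambda>\<tau>. vs (specht \<tau>)))" by (rule fin_dim_fam[OF finite_add_box fin_dim_specht])
  have "cfun.dim (fam (add_box \<nu>) (\<lambda>\<tau>. vs (specht \<tau>))) \<le> (k + 1) * sdim \<nu>"
    using dim_le_inj(1)[OF linear_branch_map[OF D \<nu>] inj_branch_map[OF D \<nu>] fd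
        group_repD(2)[OF group_rep_branch_induced[OF D \<nu>]]] dim_branch_induced[OF D \<nu>] by simp
  then show "(\<Sum>\<tau>\<in>add_box \<nu>. sdim \<tau>) \<le> (k + 1) * sdim \<nu>"
    by (simp add: dim_fam[OF finite_add_box fin_dim_specht] sdim_def)
qed

text \<open>The branching map is injective, and the space induced from \<nu> has dimension at most
  (k + 1) dim S^\<nu>, which equals that of the sum over \<open>add_box \<nu>\<close>; hence it is
  bijective. Equivariance is the multiplicativity of the character together with the action on each
  component.\<close>

lemma rep_iso_branch:
  assumes D: "Z2_char D" and \<nu>: "\<nu> \<in> partitions k"
  shows "rep_iso (B (k + 1)) (direct_sum (add_box \<nu>) (\<lambda>\<tau>. wreath_rep D (k + 1) (specht \<tau>))) (branch_induced D k \<nu>)"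
proof (rule rep_isoI[where T = "branch_map D k \<nu>"])
  let ?V = "fam (add_box \<nu>) (\<lambda>\<tau>. vs (specht \<tau>))"
  let ?R = "direct_sum (add_box \<nu>) (\<lambda>\<tau>. wreath_rep D (k + 1) (specht \<tau>))"
  interpret Bk: group "B (k + 1)" by simp
  have vs: "vs ?R = ?V" by (simp add: direct_sum_simps wreath_rep_simps)
  show "group_rep (B (k + 1)) ?R"
    by (intro group_rep_direct_sum group_rep_wreath[OF D] group_rep_specht add_box_partitions[OF \<nu>]) auto
  show "linear_between (vs ?R) (vs (branch_induced D k \<nu>)) (branch_map D k \<nu>)"
    unfolding vs by (rule linear_branch_map[OF D \<nu>])
  have fd: "fin_dim ?V" by (rule fin_dim_fam[OF finite_add_box fin_dim_specht])
  have "cfun.dim (vs (branch_induced D k \<nu>)) \<le> cfun.dim ?V"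
    using dim_branch_induced[OF D \<nu>] sum_sdim_add_box[OF \<nu>]
    by (simp add: dim_fam[OF finite_add_box fin_dim_specht] sdim_def)
  then have "branch_map D k \<nu> ` ?V = vs (branch_induced D k \<nu>)"
    by (rule dim_le_inj(2)[OF linear_branch_map[OF D \<nu>] inj_branch_map[OF D \<nu>] fd
        group_repD(2)[OF group_rep_branch_induced[OF D \<nu>]]])
  then show "bij_betw (branch_map D k \<nu>) (vs ?R) (vs (branch_induced D k \<nu>))"
    unfolding vs bij_betw_def using inj_branch_map[OF D \<nu>] by blast
  fix g v assume g: "g \<in> carrier (B (k + 1))" and v: "v \<in> vs ?R"
  obtain f \<sigma> where fs: "g = (f, \<sigma>)" by force
  have \<sigma>: "\<sigma> permutes {1..k + 1}" using g by (auto simp: fs B_simps)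
  show "branch_map D k \<nu> (act ?R g v) = act (branch_induced D k \<nu>) g (branch_map D k \<nu> v)"
  proof
    fix y :: "hyperoct \<times> (tabloid \<times> unit)"
    obtain f' \<sigma>' T where y: "y = ((f', \<sigma>'), (T, ()))" by (metis prod.collapse unit.exhaust)
    show "branch_map D k \<nu> (act ?R g v) y = act (branch_induced D k \<nu>) g (branch_map D k \<nu> v) y"
    proof (cases "(f', \<sigma>') \<in> carrier (B (k + 1))")
      case False
      then show ?thesis by (simp add: y branch_map_def induced_rep_act)
    next
      case True
      let ?P = "\<lambda>f. \<Prod>i=1..k + 1. D (f i)"
      have \<sigma>': "\<sigma>' permutes {1..k + 1}" using True by (auto simp: B_simps)
      define a where "a = fst ((f', \<sigma>') \<otimes>\<^bsub>B (k + 1)\<^esub> g)"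
      have m: "(f', \<sigma>') \<otimes>\<^bsub>B (k + 1)\<^esub> g = (a, \<sigma>' \<circ> \<sigma>)"
        by (simp add: a_def fs B_def wreath_simps)
      have c: "(a, \<sigma>' \<circ> \<sigma>) \<in> carrier (B (k + 1))"
        using Bk.m_closed[OF True g] unfolding m .
      have Pa: "?P a = ?P f' * ?P f"
        unfolding a_def fs by (rule Z2_char_mult[OF D True g[unfolded fs]])
      have b: "branch \<nu> \<tau> (perm_act \<sigma>' (\<lambda>T. act ?R g v (\<tau>, T))) T
          = ?P f * branch \<nu> \<tau> (perm_act (\<sigma>' \<circ> \<sigma>) (\<lambda>T. v (\<tau>, T))) T" if "\<tau> \<in> add_box \<nu>" for \<tau>
      proof -
        have "(\<lambda>T. act ?R g v (\<tau>, T)) = (\<lambda>T. ?P f * perm_act \<sigma> (\<lambda>T. v (\<tau>, T)) T)"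
          using that by (simp add: direct_sum_simps fs wreath_rep_simps specht_simps)
        then show ?thesis
          using linear_between_scale[OF linear_perm_act, of "perm_act \<sigma> (\<lambda>T. v (\<tau>, T))" \<sigma>' "?P f"]
            linear_between_scale[OF linear_branch, of "perm_act \<sigma>' (perm_act \<sigma> (\<lambda>T. v (\<tau>, T)))" \<nu> \<tau> "?P f"]
            perm_act_comp[OF permutes_bij[OF \<sigma>'] permutes_bij[OF \<sigma>]]
          by (simp del: prod.cl_ivl_Suc)
      qed
      have "branch_map D k \<nu> (act ?R g v) y
          = ?P f' * (?P f * (\<Sum>\<tau>\<in>add_box \<nu>. branch \<nu> \<tau> (perm_act (\<sigma>' \<circ> \<sigma>) (\<lambda>T. v (\<tau>, T))) T))"
        using True b by (simp add: y branch_map_def sum_distrib_left del: prod.cl_ivl_Suc)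
      also have "\<dots> = branch_map D k \<nu> v ((f', \<sigma>') \<otimes>\<^bsub>B (k + 1)\<^esub> g, (T, ()))"
        unfolding m branch_map_def prod.case Pa using c by (simp only: if_True mult.assoc)
      also have "\<dots> = act (branch_induced D k \<nu>) g (branch_map D k \<nu> v) y"
        using True by (simp add: y induced_rep_act)
      finally show ?thesis .
    qed
  qed
qed

section \<open>Induction from \<open>B\<^sub>n\<^sub>-\<^sub>1 \<times> B\<^sub>1\<close>\<close>

text \<open>The factor \<open>U\<close> is one-dimensional and acts by a scalar, so moving it past
  \<open>C\<close> uses only that \<open>C\<close> acts linearly.\<close>

lemma rep_iso_along_right_comm:
  fixes A :: "('g, 'x) rep" and C :: "('h, 'y) rep" and U :: "('k, unit) rep"
  assumes A: "group_rep G A" and C: "group_rep H C" and U: "group_rep K U" and UV: "vs U = UNIV"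
  shows "rep_iso_along ((G \<times>\<times> H) \<times>\<times> K) ((G \<times>\<times> K) \<times>\<times> H) (\<lambda>((a, b), c). ((a, c), b))
    (outer_tensor (outer_tensor A C) U) (outer_tensor (outer_tensor A U) C)"
proof -
  note A' = group_repD[OF A] and C' = group_repD[OF C] and U' = group_repD[OF U]
  let ?R = "outer_tensor (outer_tensor A C) U" and ?S = "outer_tensor (outer_tensor A U) C"
  have AC: "group_rep (G \<times>\<times> H) (outer_tensor A C)" by (rule group_rep_outer_tensor[OF A C])
  have AU: "group_rep (G \<times>\<times> K) (outer_tensor A U)" by (rule group_rep_outer_tensor[OF A U])
  define F where "F w = (\<lambda>((x, z), y). w ((x, y), z))" for w :: "('x \<times> 'y) \<times> unit \<Rightarrow> complex"
  define F' where "F' w = (\<lambda>((x, y), z). w ((x, z), y))" for w :: "('x \<times> unit) \<times> 'y \<Rightarrow> complex"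
  have R: "w \<in> vs ?R \<longleftrightarrow> (\<lambda>y. w (y, ())) \<in> tensor (vs A) (vs C)" for w
    unfolding outer_tensor_simps UV by (rule tensor_UNIV_unit[OF subspace_tensor])
  have S: "w \<in> vs ?S \<longleftrightarrow> (\<lambda>(x, y). w ((x, ()), y)) \<in> tensor (vs A) (vs C)" for w
    unfolding outer_tensor_simps UV
    using tensor_iff[OF group_repD(2)[OF AU] C'(3)]
    by (simp add: outer_tensor_simps UV tensor_UNIV_unit[OF A'(3)] tensor_iff[OF A'(2) C'(3)]) 
  have FR: "F w \<in> vs ?S" if "w \<in> vs ?R" for w
    using that unfolding R S by (simp add: F_def case_prod_unfold)
  have F'S: "F' w \<in> vs ?R" if "w \<in> vs ?S" for w
    using that unfolding R S by (simp add: F'_def case_prod_unfold)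
  have eq: "F (act ?R ((a, b), c) w) = act ?S ((a, c), b) (F w)"
    if a: "a \<in> carrier G" and b: "b \<in> carrier H" and c: "c \<in> carrier K" and w: "w \<in> vs ?R" for a b c w
  proof -
    define \<chi> where "\<chi> = act U c (\<lambda>_. 1) ()"
    have \<chi>: "act U c f () = \<chi> * f ()" for f
    proof -
      have "f = (\<lambda>z. f () * 1)" by auto
      then have "act U c f = (\<lambda>z. f () * act U c (\<lambda>_. 1) z)"
        using linear_between_scale[OF U'(4)[OF c], of "\<lambda>_. 1" "f ()"] UV by simp
      then show ?thesis by (simp add: \<chi>_def)
    qed
    have "map_left (act A a) (\<lambda>y. w (y, ())) \<in> tensor (vs A) (vs C)"
      using linear_between_in[OF map_left_linear[OF A'(4)[OF a] A'(3) C'(3)]] w unfolding R by blast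
    from tensor_slices(2)[OF this A'(3) C'(3)]
    have sl: "(\<lambda>y. act A a (\<lambda>x. w ((x, y), ())) x) \<in> vs C" for x by (simp add: map_left_def)
    show ?thesis
      using linear_between_scale[OF C'(4)[OF b] sl]
      by (auto simp: F_def outer_tensor_simps map_left_def map_right_def \<chi> fun_eq_iff)
  qed
  have "bij_betw F (vs ?R) (vs ?S)"
    by (rule bij_betw_byWitness[where f' = F']) (use FR F'S in \<open>auto simp: F_def F'_def\<close>)
  moreover have "linear_between (vs ?R) (vs ?S) F"
    by (rule linear_betweenI) (rule FR, assumption, auto simp: F_def)
  ultimately show ?thesis
    unfolding rep_iso_along_def
    using group_rep_outer_tensor[OF AC U] group_rep_outer_tensor[OF AU C] eq
    by (auto intro!: exI[of _ F] simp: image_iff) 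
qed

lemma group_rep_wreath_specht:
  "Z2_char D \<Longrightarrow> \<nu> \<in> partitions k \<Longrightarrow> group_rep (B k) (wreath_rep D k (specht \<nu>))"
  by (rule group_rep_wreath[OF _ group_rep_specht])

lemma group_rep_unit: "Z2_char D \<Longrightarrow> group_rep (B m) (wreath_rep D m trivial_rep)"
  by (rule group_rep_wreath[OF _ group_rep_trivial[OF sym_group_is_group]])

lemma vs_unit: "vs (wreath_rep D m trivial_rep) = UNIV"
  by (simp add: wreath_rep_simps trivial_rep_def)

text \<open>The representation \<open>S\<^sup>\<lambda>\<^sup>,\<^sup>\<mu>\<close>, with arbitrary characters in place of the trivial and sign ones.\<close>

abbreviation bispecht :: "(int \<Rightarrow> complex) \<Rightarrow> (int \<Rightarrow> complex) \<Rightarrow> nat \<Rightarrow> nat \<Rightarrow> nat list \<Rightarrow> nat list \<Rightarrow>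
    (hyperoct, hyperoct \<times> tabloid \<times> tabloid) rep"
  where "bispecht D D' k l \<nu> \<mu> \<equiv> induced_rep (B (k + l)) (B k \<times>\<times> B l) (block_emb k l)
    (outer_tensor (wreath_rep D k (specht \<nu>)) (wreath_rep D' l (specht \<mu>)))"

text \<open>Conjugation by the block swap. It restores the order of the blocks after a box has been
  added with the block of \<mu> in front.\<close>

lemma rep_iso_bispecht_swap:
  assumes D: "Z2_char D" "Z2_char D'" and \<nu>: "\<nu> \<in> partitions k" and \<mu>: "\<mu> \<in> partitions l"
  shows "rep_iso (B (k + l)) (bispecht D D' k l \<nu> \<mu>) (bispecht D' D l k \<mu> \<nu>)"
  unfolding add.commute[of l k]
proof (rule rep_iso_induced_conj[where s = "block_swap Z2 k l"])
  show "rep_iso_along (B k \<times>\<times> B l) (B l \<times>\<times> B k) (\<lambda>(g, h). (h, g))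
      (outer_tensor (wreath_rep D k (specht \<nu>)) (wreath_rep D' l (specht \<mu>)))
      (outer_tensor (wreath_rep D' l (specht \<mu>)) (wreath_rep D k (specht \<nu>)))"
    by (intro rep_iso_along_flip group_rep_wreath_specht assms)
  show "block_emb k l \<in> hom (B k \<times>\<times> B l) (B (k + l))" by (rule block_emb_B)
  show "block_swap Z2 k l \<in> carrier (B (k + l))" by (simp add: B_def block_swap_in)
  show "block_emb l k ((\<lambda>(g, h). (h, g)) h) \<otimes>\<^bsub>B (k + l)\<^esub> block_swap Z2 k l
      = block_swap Z2 k l \<otimes>\<^bsub>B (k + l)\<^esub> block_emb k l h" if "h \<in> carrier (B k \<times>\<times> B l)" for h
    using that block_emb_swap[of Z2 _ k _ l] by (auto simp: B_def)
  show "block_emb l k h \<in> carrier (B (k + l))" if "h \<in> carrier (B l \<times>\<times> B k)" for h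
    using hom_in_carrier[OF block_emb_B that] by (simp add: add.commute)
qed simp_all

lemma case_prod_Pair: "(\<lambda>(a, b). (a, b)) = (\<lambda>x. x)"
  by auto

text \<open>The branching rule inside one factor of a larger induction, with the direct sum pulled
  out. It applies to the factor in front, so the block that receives the box must be moved
  there.\<close>

lemma rep_iso_branch_step:
  assumes D: "Z2_char D" and \<nu>: "\<nu> \<in> partitions k" and \<phi>: "\<phi> \<in> hom (B (k + 1) \<times>\<times> C) (B m)"
    and S: "group_rep C S"
  shows "rep_iso (B m) (induced_rep (B m) (B (k + 1) \<times>\<times> C) \<phi> (outer_tensor (branch_induced D k \<nu>) S))
    (direct_sum (add_box \<nu>)
      (\<lambda>\<tau>. induced_rep (B m) (B (k + 1) \<times>\<times> C) \<phi> (outer_tensor (wreath_rep D (k + 1) (specht \<tau>)) S)))"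
proof -
  let ?A = "\<lambda>\<tau>. wreath_rep D (k + 1) (specht \<tau>)"
  have A: "group_rep (B (k + 1)) (?A \<tau>)" if "\<tau> \<in> add_box \<nu>" for \<tau>
    by (rule group_rep_wreath_specht[OF D add_box_partitions[OF \<nu> that]])
  have "rep_iso_along (B (k + 1) \<times>\<times> C) (B (k + 1) \<times>\<times> C) (\<lambda>(g, c). (g, c))
      (outer_tensor (branch_induced D k \<nu>) S) (outer_tensor (direct_sum (add_box \<nu>) ?A) S)"
    using rep_iso_along_outer_left[OF rep_iso_sym[OF rep_iso_branch[OF D \<nu>], unfolded rep_iso_eq_along] S] .
  then have "rep_iso (B (k + 1) \<times>\<times> C) (outer_tensor (branch_induced D k \<nu>) S) (outer_tensor (direct_sum (add_box \<nu>) ?A) S)"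
    by (simp only: rep_iso_eq_along case_prod_Pair)
  from rep_iso_induced[OF _ _ \<phi> this]
  have "rep_iso (B m) (induced_rep (B m) (B (k + 1) \<times>\<times> C) \<phi> (outer_tensor (branch_induced D k \<nu>) S))
      (induced_rep (B m) (B (k + 1) \<times>\<times> C) \<phi> (outer_tensor (direct_sum (add_box \<nu>) ?A) S))"
    by simp
  also have "rep_iso (B m) \<dots> (direct_sum (add_box \<nu>) (\<lambda>\<tau>. induced_rep (B m) (B (k + 1) \<times>\<times> C) \<phi> (outer_tensor (?A \<tau>) S)))"
    by (rule rep_iso_induced_direct_sum[OF _ _ _ \<phi> finite_add_box A S]) simp_all
  finally show ?thesis .
qed

lemma block_emb_carrier:
  "x \<in> carrier (B a) \<Longrightarrow> y \<in> carrier (B b) \<Longrightarrow> block_emb a b (x, y) \<in> carrier (B (a + b))"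
  using hom_in_carrier[OF block_emb_B, of "(x, y)" a b] by simp

lemma block_emb_mult:
  assumes "x \<in> carrier (B a)" "y \<in> carrier (B b)" "x' \<in> carrier (B a)" "y' \<in> carrier (B b)"
  shows "block_emb a b (x, y) \<otimes>\<^bsub>B (a + b)\<^esub> block_emb a b (x', y')
    = block_emb a b (x \<otimes>\<^bsub>B a\<^esub> x', y \<otimes>\<^bsub>B b\<^esub> y')"
  using hom_mult[OF block_emb_B, of "(x, y)" a b "(x', y')"] assms by simp

lemma hom_stages:
  assumes "\<phi> \<in> hom (H \<times>\<times> C) G" "\<psi> \<in> hom K H"
  shows "(\<lambda>(k, c). \<phi> (\<psi> k, c)) \<in> hom (K \<times>\<times> C) G"
proof (rule homI)
  fix x assume x: "x \<in> carrier (K \<times>\<times> C)"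
  then obtain k c where k: "x = (k, c)" "k \<in> carrier K" "c \<in> carrier C" by auto
  have h: "\<psi> k \<in> carrier H" using hom_in_carrier[OF assms(2) k(2)] .
  show "(\<lambda>(k, c). \<phi> (\<psi> k, c)) x \<in> carrier G" using hom_in_carrier[OF assms(1), of "(\<psi> k, c)"] k h by simp
  fix y assume "y \<in> carrier (K \<times>\<times> C)"
  then obtain k' c' where k': "y = (k', c')" "k' \<in> carrier K" "c' \<in> carrier C" by auto
  have h': "\<psi> k' \<in> carrier H" using hom_in_carrier[OF assms(2) k'(2)] .
  show "(\<lambda>(k, c). \<phi> (\<psi> k, c)) (x \<otimes>\<^bsub>K \<times>\<times> C\<^esub> y)
      = (\<lambda>(k, c). \<phi> (\<psi> k, c)) x \<otimes>\<^bsub>G\<^esub> (\<lambda>(k, c). \<phi> (\<psi> k, c)) y"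
    using hom_mult[OF assms(1), of "(\<psi> k, c)" "(\<psi> k', c')"] hom_mult[OF assms(2) k(2) k'(2)] h h' k k'
    by simp
qed

text \<open>
  Both parts transport the induction to the block in which the box is added; they differ only in
  the permutation of the three blocks.
\<close>

lemma
  fixes k l :: nat
  assumes D: "Z2_char D" "Z2_char D'" and \<nu>: "\<nu> \<in> partitions k" and \<mu>: "\<mu> \<in> partitions l"
  shows rep_iso_induced_left: "rep_iso (B (k + l + 1))
      (induced_rep (B (k + l + 1)) (B (k + l) \<times>\<times> B 1) (block_emb (k + l) 1)
        (outer_tensor (bispecht D D' k l \<nu> \<mu>) (wreath_rep D 1 trivial_rep)))
      (direct_sum (add_box \<nu>) (\<lambda>\<tau>. bispecht D D' (k + 1) l \<tau> \<mu>))"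
    and rep_iso_induced_right: "rep_iso (B (k + l + 1))
      (induced_rep (B (k + l + 1)) (B (k + l) \<times>\<times> B 1) (block_emb (k + l) 1)
        (outer_tensor (bispecht D D' k l \<nu> \<mu>) (wreath_rep D' 1 trivial_rep)))
      (direct_sum (add_box \<mu>) (\<lambda>\<rho>. bispecht D D' k (l + 1) \<nu> \<rho>))"
proof -
  let ?G = "B (k + l + 1)"
  let ?A = "wreath_rep D k (specht \<nu>)" and ?C = "wreath_rep D' l (specht \<mu>)"
  let ?U = "\<lambda>D. wreath_rep D 1 trivial_rep"
  let ?\<phi> = "\<lambda>(kl, c). block_emb (k + l) 1 (block_emb k l kl, c)"
  have A: "group_rep (B k) ?A" and C: "group_rep (B l) ?C" by (intro group_rep_wreath_specht assms)+
  have U: "group_rep (B 1) (?U D)" if "Z2_char D" for D by (rule group_rep_unit[OF that])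
  have \<phi>: "?\<phi> \<in> hom ((B k \<times>\<times> B l) \<times>\<times> B 1) ?G" by (rule hom_stages[OF block_emb_B block_emb_B])
  \<comment> \<open>Induction in stages: both parts start from the representation induced from three
    blocks of sizes k, l and 1.\<close>
  have stage: "rep_iso ?G
      (induced_rep ?G (B (k + l) \<times>\<times> B 1) (block_emb (k + l) 1) (outer_tensor (bispecht D D' k l \<nu> \<mu>) (?U E)))
      (induced_rep ?G ((B k \<times>\<times> B l) \<times>\<times> B 1) ?\<phi> (outer_tensor (outer_tensor ?A ?C) (?U E)))"
    if "Z2_char E" for E
    by (rule rep_iso_induced_trans[OF _ _ _ _ block_emb_B block_emb_B group_rep_outer_tensor[OF A C] U[OF that]]) simp_all
  have assoc: "?\<phi> ((a, b), c) = block_emb k (l + 1) (a, block_emb l 1 (b, c))" if "a \<in> carrier (B k)" for a b c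
    using that block_emb_assoc[of a Z2 k l 1 b c] by (simp add: B_def)

  \<comment> \<open>For part one, the block of size 1 is moved past the block of size l;
    \<open>?s\<close> does this while acting trivially on the first k coordinates.\<close>
  let ?sw = "block_swap Z2 l 1"
  let ?s = "block_emb k (l + 1) (\<one>\<^bsub>B k\<^esub>, ?sw)"
  let ?\<psi> = "\<lambda>(ac, b). block_emb (k + 1) l (block_emb k 1 ac, b)"
  have e1: "k + 1 + l = k + l + 1" "k + (l + 1) = k + l + 1" "1 + l = l + 1" by simp_all
  have one: "\<one>\<^bsub>B k\<^esub> \<in> carrier (B k)" by (simp add: group.is_monoid)
  have sw: "?sw \<in> carrier (B (l + 1))" unfolding B_def by (rule block_swap_in) simp
  have blk: "block_emb (k + 1) l \<in> hom (B (k + 1) \<times>\<times> B l) ?G"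
    using block_emb_B[of "k + 1" l] unfolding e1 .
  have \<psi>: "?\<psi> \<in> hom ((B k \<times>\<times> B 1) \<times>\<times> B l) ?G"
    by (rule hom_stages[OF blk block_emb_B])
  have s: "?s \<in> carrier ?G" using block_emb_carrier[OF one sw] unfolding e1 .
  have conj: "rep_iso ?G (induced_rep ?G ((B k \<times>\<times> B l) \<times>\<times> B 1) ?\<phi> (outer_tensor (outer_tensor ?A ?C) (?U D)))
      (induced_rep ?G ((B k \<times>\<times> B 1) \<times>\<times> B l) ?\<psi> (outer_tensor (outer_tensor ?A (?U D)) ?C))"
  proof (rule rep_iso_induced_conj[OF _ _ \<phi> rep_iso_along_right_comm[OF A C U[OF D(1)] vs_unit] s])
    fix h assume "h \<in> carrier ((B k \<times>\<times> B l) \<times>\<times> B 1)"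
    then obtain a b c where h: "h = ((a, b), c)" and abc: "a \<in> carrier (B k)" "b \<in> carrier (B l)" "c \<in> carrier (B 1)"
      by auto
    have cb: "block_emb 1 l (c, b) \<in> carrier (B (l + 1))" using block_emb_carrier[OF abc(3,2)] unfolding e1 .
    have bc: "block_emb l 1 (b, c) \<in> carrier (B (l + 1))" by (rule block_emb_carrier[OF abc(2,3)])
    have "?\<psi> ((a, c), b) = block_emb k (l + 1) (a, block_emb 1 l (c, b))"
      using abc(1) block_emb_assoc[of a Z2 k 1 l c b] by (simp add: B_def)
    then have "?\<psi> ((a, c), b) \<otimes>\<^bsub>?G\<^esub> ?s = block_emb k (l + 1) (a \<otimes>\<^bsub>B k\<^esub> \<one>\<^bsub>B k\<^esub>, block_emb 1 l (c, b) \<otimes>\<^bsub>B (l + 1)\<^esub> ?sw)"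
      using block_emb_mult[OF abc(1) cb one sw] unfolding e1 by simp
    also have "\<dots> = block_emb k (l + 1) (\<one>\<^bsub>B k\<^esub> \<otimes>\<^bsub>B k\<^esub> a, ?sw \<otimes>\<^bsub>B (l + 1)\<^esub> block_emb l 1 (b, c))"
      using block_emb_swap[of Z2 b l c 1] abc by (simp add: B_def[symmetric] group.is_monoid)
    also have "\<dots> = ?s \<otimes>\<^bsub>?G\<^esub> ?\<phi> ((a, b), c)"
      using block_emb_mult[OF one sw abc(1) bc] unfolding e1 assoc[OF abc(1)] by simp
    finally show "?\<psi> ((\<lambda>((a, b), c). ((a, c), b)) h) \<otimes>\<^bsub>?G\<^esub> ?s = ?s \<otimes>\<^bsub>?G\<^esub> ?\<phi> h"
      by (simp add: h)
  next
    show "?\<psi> h \<in> carrier ?G" if "h \<in> carrier ((B k \<times>\<times> B 1) \<times>\<times> B l)" for h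
      by (rule hom_in_carrier[OF \<psi> that])
  qed simp_all
  note stage[OF D(1)]
  also note conj
  \<comment> \<open>Stages in reverse: the blocks of sizes k and 1 are now adjacent and carry the
    same character, so they form the representation to which branching applies.\<close>
  also have "rep_iso ?G (induced_rep ?G ((B k \<times>\<times> B 1) \<times>\<times> B l) ?\<psi> (outer_tensor (outer_tensor ?A (?U D)) ?C))
      (induced_rep ?G (B (k + 1) \<times>\<times> B l) (block_emb (k + 1) l) (outer_tensor (branch_induced D k \<nu>) ?C))"
    by (rule rep_iso_sym, rule rep_iso_induced_trans[OF _ _ _ _ blk block_emb_B group_rep_outer_tensor[OF A U[OF D(1)]] C]) simp_all
  also note rep_iso_branch_step[OF D(1) \<nu> blk C]
  finally show "rep_iso ?G
      (induced_rep ?G (B (k + l) \<times>\<times> B 1) (block_emb (k + l) 1) (outer_tensor (bispecht D D' k l \<nu> \<mu>) (?U D)))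
      (direct_sum (add_box \<nu>) (\<lambda>\<tau>. bispecht D D' (k + 1) l \<tau> \<mu>))"
    unfolding e1 .

  \<comment> \<open>For part two, the blocks of sizes l and 1 are adjacent already; the first block
    is moved behind them as a whole.\<close>
  let ?t = "block_swap Z2 k (l + 1)"
  let ?\<eta> = "\<lambda>(bc, a). block_emb (l + 1) k (block_emb l 1 bc, a)"
  have e2: "l + 1 + k = k + l + 1" "k + (l + 1) = k + l + 1" by simp_all
  have blk': "block_emb (l + 1) k \<in> hom (B (l + 1) \<times>\<times> B k) ?G"
    using block_emb_B[of "l + 1" k] unfolding e2 .
  have \<eta>: "?\<eta> \<in> hom ((B l \<times>\<times> B 1) \<times>\<times> B k) ?G" by (rule hom_stages[OF blk' block_emb_B])
  have t: "?t \<in> carrier ?G" using block_swap_in[of Z2 k "l + 1"] unfolding e2 B_def by simp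
  have along: "rep_iso_along ((B k \<times>\<times> B l) \<times>\<times> B 1) ((B l \<times>\<times> B 1) \<times>\<times> B k) (\<lambda>((a, b), c). ((b, c), a))
      (outer_tensor (outer_tensor ?A ?C) (?U D')) (outer_tensor (outer_tensor ?C (?U D')) ?A)"
  proof -
    have eq: "(\<lambda>g. (\<lambda>((a, b), c). ((a, c), b)) ((\<lambda>(g, c). ((\<lambda>(g, h). (h, g)) g, c)) g))
        = (\<lambda>((a, b), c). ((b, c), a))" by (auto simp: fun_eq_iff)
    show ?thesis
      using rep_iso_along_trans[OF rep_iso_along_outer_left[OF rep_iso_along_flip[OF A C] U[OF D(2)]]
          rep_iso_along_right_comm[OF C A U[OF D(2)] vs_unit]] by (simp only: eq)
  qed
  have conj': "rep_iso ?G (induced_rep ?G ((B k \<times>\<times> B l) \<times>\<times> B 1) ?\<phi> (outer_tensor (outer_tensor ?A ?C) (?U D')))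
      (induced_rep ?G ((B l \<times>\<times> B 1) \<times>\<times> B k) ?\<eta> (outer_tensor (outer_tensor ?C (?U D')) ?A))"
  proof (rule rep_iso_induced_conj[OF _ _ \<phi> along t])
    fix h assume "h \<in> carrier ((B k \<times>\<times> B l) \<times>\<times> B 1)"
    then obtain a b c where h: "h = ((a, b), c)" and abc: "a \<in> carrier (B k)" "b \<in> carrier (B l)" "c \<in> carrier (B 1)"
      by auto
    have bc: "block_emb l 1 (b, c) \<in> carrier (B (l + 1))" by (rule block_emb_carrier[OF abc(2,3)])
    show "?\<eta> ((\<lambda>((a, b), c). ((b, c), a)) h) \<otimes>\<^bsub>?G\<^esub> ?t = ?t \<otimes>\<^bsub>?G\<^esub> ?\<phi> h"
      using block_emb_swap[of Z2 a k "block_emb l 1 (b, c)" "l + 1"] abc(1) bc assoc[OF abc(1), of b c]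
      unfolding h e2 B_def[symmetric] by simp
  next
    show "?\<eta> h \<in> carrier ?G" if "h \<in> carrier ((B l \<times>\<times> B 1) \<times>\<times> B k)" for h
      by (rule hom_in_carrier[OF \<eta> that])
  qed simp_all
  note stage[OF D(2)]
  also note conj'
  also have "rep_iso ?G (induced_rep ?G ((B l \<times>\<times> B 1) \<times>\<times> B k) ?\<eta> (outer_tensor (outer_tensor ?C (?U D')) ?A))
      (induced_rep ?G (B (l + 1) \<times>\<times> B k) (block_emb (l + 1) k) (outer_tensor (branch_induced D' l \<mu>) ?A))"
    by (rule rep_iso_sym, rule rep_iso_induced_trans[OF _ _ _ _ blk' block_emb_B group_rep_outer_tensor[OF C U[OF D(2)]] A]) simp_all
  also note rep_iso_branch_step[OF D(2) \<mu> blk' A]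
  \<comment> \<open>Branching has produced the block of \<rho> in front of that of \<nu>; each
    summand is swapped back.\<close>
  also have "rep_iso ?G (direct_sum (add_box \<mu>) (\<lambda>\<rho>. induced_rep ?G (B (l + 1) \<times>\<times> B k) (block_emb (l + 1) k)
        (outer_tensor (wreath_rep D' (l + 1) (specht \<rho>)) ?A)))
      (direct_sum (add_box \<mu>) (\<lambda>\<rho>. bispecht D D' k (l + 1) \<nu> \<rho>))"
    using rep_iso_bispecht_swap[OF D(2,1) add_box_partitions[OF \<mu>] \<nu>] unfolding e2
    by (intro rep_iso_direct_sum) simp_all
  finally show "rep_iso ?G
      (induced_rep ?G (B (k + l) \<times>\<times> B 1) (block_emb (k + l) 1) (outer_tensor (bispecht D D' k l \<nu> \<mu>) (?U D')))
      (direct_sum (add_box \<mu>) (\<lambda>\<rho>. bispecht D D' k (l + 1) \<nu> \<rho>))" .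
qed


section \<open>Induction from a product with the trivial group S_1 in place of B_1\<close>

lemma outer_unit_simps:
  assumes "cfun.subspace (vs R)"
  shows "w \<in> vs (outer_tensor R (wreath_rep D m trivial_rep)) \<longleftrightarrow> (\<lambda>x. w (x, ())) \<in> vs R"
    "w \<in> vs (outer_tensor R trivial_rep) \<longleftrightarrow> (\<lambda>x. w (x, ())) \<in> vs R"
    "act (outer_tensor R (wreath_rep D m trivial_rep)) (h, (f, \<sigma>)) w
      = (\<lambda>(x, _). (\<Prod>i=1..m. D (f i)) * act R h (\<lambda>x. w (x, ())) x)"
    "act (outer_tensor R trivial_rep) (h, s) w = (\<lambda>(x, _). act R h (\<lambda>x. w (x, ())) x)"
  using tensor_UNIV_unit[OF assms]
  by (auto simp: outer_tensor_simps wreath_rep_simps trivial_rep_def map_left_def map_right_def)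

text \<open>
  Left translation by the generator of the central factor \<open>B\<^sub>1\<close> is an involution of the space induced
  from \<open>H \<times> S\<^sub>1\<close>; its eigenspaces are the representations induced from \<open>H \<times> B\<^sub>1\<close>.
\<close>

lemma rep_iso_induced_plus:
  fixes G :: "('g, 'b) monoid_scheme" and R :: "('h, 'x) rep"
  assumes G: "group G" "finite (carrier G)" and \<phi>: "\<phi> \<in> hom (H \<times>\<times> B 1) G" and R: "group_rep H R"
  shows "rep_iso G
    (induced_rep G (H \<times>\<times> sym_group 1) (\<lambda>(x, s). \<phi> (x, (\<one>\<^bsub>product_group {1..1} (\<lambda>_. Z2)\<^esub>, s)))
      (outer_tensor R trivial_rep))
    (rep_plus (induced_rep G (H \<times>\<times> B 1) \<phi> (outer_tensor R (wreath_rep triv_char 1 trivial_rep)))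
      (induced_rep G (H \<times>\<times> B 1) \<phi> (outer_tensor R (wreath_rep sign_char 1 trivial_rep))))"
proof -
  interpret G: group G by (rule G)
  note R = R group_repD[OF R]
  interpret H: group H by (rule R(2))
  let ?o = "\<one>\<^bsub>product_group {1..1} (\<lambda>_. Z2)\<^esub> :: nat \<Rightarrow> int"
  let ?\<psi> = "\<lambda>(x, s). \<phi> (x, (?o, s))"
  let ?I = "induced_rep G (H \<times>\<times> sym_group 1) ?\<psi> (outer_tensor R trivial_rep)"
  let ?J = "\<lambda>D. induced_rep G (H \<times>\<times> B 1) \<phi> (outer_tensor R (wreath_rep D 1 trivial_rep))"
  \<comment> \<open>The two elements of B_1. The unit is written with the unit of the product group
    because the embedding of S_1 in the claim produces this term.\<close>
  define e where "e = (?o, id :: nat \<Rightarrow> nat)"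
  define c where "c = (\<lambda>i\<in>{1..1 :: nat}. 1 :: int, id :: nat \<Rightarrow> nat)"
  have o1: "?o = (\<lambda>i\<in>{1..1}. 0)" by (simp add: one_integer_mod_group)
  have e_eq: "e = (\<lambda>i\<in>{1..1}. 0, id)" by (simp only: e_def o1)
  have perm1: "\<sigma> permutes {1..1 :: nat} \<longleftrightarrow> \<sigma> = id" for \<sigma>
    by (simp add: permutes_sing)
  have carrier: "y \<in> carrier (B 1) \<longleftrightarrow> y = e \<or> y = c" for y
  proof -
    have "f \<in> (\<Pi>\<^sub>E i\<in>{1..1}. {0, 1}) \<longleftrightarrow> f = (\<lambda>i\<in>{1..1}. 0) \<or> f = (\<lambda>i\<in>{1..1}. 1)" for f :: "nat \<Rightarrow> int"
      by (auto simp: PiE_iff extensional_def fun_eq_iff)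
    then show ?thesis by (cases y) (auto simp: B_simps perm1 e_eq c_def)
  qed
  have e: "e \<in> carrier (B 1)" and c: "c \<in> carrier (B 1)" using carrier by auto
  have e_one: "e = \<one>\<^bsub>B 1\<^esub>" by (simp add: e_eq B_simps)
  interpret B1: group "B 1" by simp
  have cc: "c \<otimes>\<^bsub>B 1\<^esub> c = e"
    by (auto simp: e_eq c_def B_def wreath_simps mult_integer_mod_group)
  have \<phi>G: "\<phi> (h, y) \<in> carrier G" if "h \<in> carrier H" "y \<in> carrier (B 1)" for h y
    using hom_in_carrier[OF \<phi>, of "(h, y)"] that by simp
  have \<phi>m: "\<phi> (h, y) \<otimes>\<^bsub>G\<^esub> \<phi> (h', y') = \<phi> (h \<otimes>\<^bsub>H\<^esub> h', y \<otimes>\<^bsub>B 1\<^esub> y')"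
    if "h \<in> carrier H" "y \<in> carrier (B 1)" "h' \<in> carrier H" "y' \<in> carrier (B 1)" for h y h' y'
    using hom_mult[OF \<phi>, of "(h, y)" "(h', y')"] that by simp
  have \<phi>1: "\<phi> (\<one>\<^bsub>H\<^esub>, e) = \<one>\<^bsub>G\<^esub>"
    using hom_one[OF \<phi> DirProd_group[OF R(2) group_B] G(1)] by (simp add: e_one)
  \<comment> \<open>The generator of B_1 inside \<open>G\<close>. It squares to one and commutes
    with the image of \<open>H\<close>, so left translation by it preserves equivariance under
    \<open>H\<close>.\<close>
  define z where "z = \<phi> (\<one>\<^bsub>H\<^esub>, c)"
  have z: "z \<in> carrier G" unfolding z_def by (rule \<phi>G[OF H.one_closed c])
  have zz: "z \<otimes>\<^bsub>G\<^esub> z = \<one>\<^bsub>G\<^esub>" using \<phi>m[OF H.one_closed c H.one_closed c] unfolding z_def cc by (simp add: \<phi>1)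
  have ze: "z \<otimes>\<^bsub>G\<^esub> \<phi> (h, e) = \<phi> (h, c)" "\<phi> (h, e) \<otimes>\<^bsub>G\<^esub> z = \<phi> (h, c)" if "h \<in> carrier H" for h
    using \<phi>m[OF H.one_closed c that e] \<phi>m[OF that e H.one_closed c] that
    unfolding z_def e_one B1.r_one[OF c] B1.l_one[OF c] by simp_all
  have zg: "z \<otimes>\<^bsub>G\<^esub> (z \<otimes>\<^bsub>G\<^esub> g) = g" if "g \<in> carrier G" for g
    using that z by (simp add: G.m_assoc[symmetric] zz)
  note os = outer_unit_simps[OF R(4)]
  have hom\<psi>: "?\<psi> \<in> hom (H \<times>\<times> sym_group 1) G"
  proof (rule homI)
    fix x assume "x \<in> carrier (H \<times>\<times> sym_group 1)"
    then obtain h where h: "x = (h, id)" "h \<in> carrier H" by (auto simp: sym_group_carrier perm1)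
    show "?\<psi> x \<in> carrier G" using \<phi>G[OF h(2) e] by (simp add: h(1) e_def)
    fix y assume "y \<in> carrier (H \<times>\<times> sym_group 1)"
    then obtain h' where h': "y = (h', id)" "h' \<in> carrier H" by (auto simp: sym_group_carrier perm1)
    have "\<phi> (h, e) \<otimes>\<^bsub>G\<^esub> \<phi> (h', e) = \<phi> (h \<otimes>\<^bsub>H\<^esub> h', e)"
      using \<phi>m[OF h(2) e h'(2) e] unfolding e_one B1.l_one[OF B1.one_closed] .
    then show "?\<psi> (x \<otimes>\<^bsub>H \<times>\<times> sym_group 1\<^esub> y) = ?\<psi> x \<otimes>\<^bsub>G\<^esub> ?\<psi> y"
      by (simp add: h h' e_def sym_group_mult)
  qed
  have I: "u \<in> vs ?I \<longleftrightarrow> (\<forall>g\<in>carrier G. (\<lambda>x. u (g, (x, ()))) \<in> vs R) \<and> (\<forall>g x. g \<notin> carrier G \<longrightarrow> u (g, x) = 0) \<and>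
      (\<forall>h\<in>carrier H. \<forall>g\<in>carrier G. \<forall>x. u (\<phi> (h, e) \<otimes>\<^bsub>G\<^esub> g, (x, ())) = act R h (\<lambda>x. u (g, (x, ()))) x)" for u
  proof -
    have "carrier (sym_group 1) = {id}"
      unfolding set_eq_iff sym_group_carrier perm1 by blast
    then show ?thesis
      unfolding induced_rep_def by (auto simp: os e_def fun_eq_iff simp del: one_product_group)
  qed
  have J: "u \<in> vs (?J D) \<longleftrightarrow> (\<forall>g\<in>carrier G. (\<lambda>x. u (g, (x, ()))) \<in> vs R) \<and> (\<forall>g x. g \<notin> carrier G \<longrightarrow> u (g, x) = 0) \<and>
      (\<forall>h\<in>carrier H. \<forall>g\<in>carrier G. \<forall>x. u (\<phi> (h, e) \<otimes>\<^bsub>G\<^esub> g, (x, ())) = act R h (\<lambda>x. u (g, (x, ()))) x) \<and>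
      (\<forall>h\<in>carrier H. \<forall>g\<in>carrier G. \<forall>x. u (\<phi> (h, c) \<otimes>\<^bsub>G\<^esub> g, (x, ())) = D 1 * act R h (\<lambda>x. u (g, (x, ()))) x)"
    if "D 0 = 1" for D u
  proof -
    have E: "act (outer_tensor R (wreath_rep D 1 trivial_rep)) (h, e) w = (\<lambda>(x, _). act R h (\<lambda>x. w (x, ())) x)"
      "act (outer_tensor R (wreath_rep D 1 trivial_rep)) (h, c) w = (\<lambda>(x, _). D 1 * act R h (\<lambda>x. w (x, ())) x)" for h w
      using that unfolding e_eq c_def os by simp_all
    have "carrier (B 1) = {e, c}" using carrier by blast
    then show ?thesis using E unfolding induced_rep_def by (auto simp: os(1) fun_eq_iff)
  qed
  have char: "triv_char 0 = 1" "triv_char 1 = 1" "sign_char 0 = 1" "sign_char 1 = -1"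
    by (simp_all add: triv_char_def sign_char_def)
  \<comment> \<open>The projection onto the eigenspace of left translation by \<open>z\<close> for
    the eigenvalue \<epsilon>, used for \<epsilon> = 1 and \<epsilon> = -1.\<close>
  define P where "P \<epsilon> u = (\<lambda>(g, x). if g \<in> carrier G then (u (g, x) + \<epsilon> * u (z \<otimes>\<^bsub>G\<^esub> g, x)) / 2 else 0)"
    for \<epsilon> and u :: "'g \<times> ('x \<times> unit) \<Rightarrow> complex"
  have P: "P (D 1) u \<in> vs (?J D)" if u: "u \<in> vs ?I" and D: "D 0 = 1" "D 1 * D 1 = 1" for D u
  proof -
    have ug: "(\<lambda>x. u (g, (x, ()))) \<in> vs R" if "g \<in> carrier G" for g using u that unfolding I by blast
    have ue: "u (\<phi> (h, e) \<otimes>\<^bsub>G\<^esub> g, (x, ())) = act R h (\<lambda>x. u (g, (x, ()))) x"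
      if "h \<in> carrier H" "g \<in> carrier G" for h g x using u that unfolding I by blast
    have Pg: "(\<lambda>x. P (D 1) u (g, (x, ()))) = (\<lambda>x. (1 / 2) * (u (g, (x, ())) + D 1 * u (z \<otimes>\<^bsub>G\<^esub> g, (x, ()))))"
      if "g \<in> carrier G" for g using that by (simp add: P_def)
    have lin: "act R h (\<lambda>x. P (D 1) u (g, (x, ()))) x
        = (act R h (\<lambda>x. u (g, (x, ()))) x + D 1 * act R h (\<lambda>x. u (z \<otimes>\<^bsub>G\<^esub> g, (x, ()))) x) / 2"
      if "h \<in> carrier H" "g \<in> carrier G" for h g x
    proof -
      note lb = R(5)[OF that(1)]
      have zgG: "z \<otimes>\<^bsub>G\<^esub> g \<in> carrier G" using z that by simp
      have s: "(\<lambda>x. D 1 * u (z \<otimes>\<^bsub>G\<^esub> g, (x, ()))) \<in> vs R" by (rule subspace_scale[OF R(4) ug[OF zgG]])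
      show ?thesis
        unfolding Pg[OF that(2)] linear_between_scale[OF lb subspace_add[OF R(4) ug[OF that(2)] s]]
          linear_between_add[OF lb ug[OF that(2)] s] linear_between_scale[OF lb ug[OF zgG]] by simp
    qed
    show ?thesis
      unfolding J[where D = D, OF D(1)]
    proof (intro conjI ballI allI impI)
      show "(\<lambda>x. P (D 1) u (g, (x, ()))) \<in> vs R" if g: "g \<in> carrier G" for g
        unfolding Pg[OF g] using z g
        by (intro subspace_scale subspace_add R(4) ug) simp_all
      show "P (D 1) u (g, x) = 0" if "g \<notin> carrier G" for g x using that by (simp add: P_def)
      fix h g x assume h: "h \<in> carrier H" and g: "g \<in> carrier G"
      have zgG: "z \<otimes>\<^bsub>G\<^esub> g \<in> carrier G" using z g by simp
      note hG = \<phi>G[OF h e] \<phi>G[OF h c]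
      \<comment> \<open>These identities move \<open>z\<close> past \<phi>(h, e) and rewrite
        \<phi>(h, c), so that every value reduces to the equivariance of \<open>u\<close> under
        \<open>H\<close>.\<close>
      have m1: "z \<otimes>\<^bsub>G\<^esub> (\<phi> (h, e) \<otimes>\<^bsub>G\<^esub> g) = \<phi> (h, e) \<otimes>\<^bsub>G\<^esub> (z \<otimes>\<^bsub>G\<^esub> g)"
        using ze[OF h] z g hG by (simp add: G.m_assoc[symmetric])
      have m2: "\<phi> (h, c) \<otimes>\<^bsub>G\<^esub> g = \<phi> (h, e) \<otimes>\<^bsub>G\<^esub> (z \<otimes>\<^bsub>G\<^esub> g)"
        using ze(2)[OF h] z g hG by (simp add: G.m_assoc[symmetric])
      have m3: "z \<otimes>\<^bsub>G\<^esub> (\<phi> (h, c) \<otimes>\<^bsub>G\<^esub> g) = \<phi> (h, e) \<otimes>\<^bsub>G\<^esub> g"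
        unfolding m2 m1[symmetric] using zg hG g by simp
      show "P (D 1) u (\<phi> (h, e) \<otimes>\<^bsub>G\<^esub> g, (x, ())) = act R h (\<lambda>x. P (D 1) u (g, (x, ()))) x"
        unfolding lin[OF h g] using hG g by (simp add: P_def m1 ue h zgG)
      show "P (D 1) u (\<phi> (h, c) \<otimes>\<^bsub>G\<^esub> g, (x, ())) = D 1 * act R h (\<lambda>x. P (D 1) u (g, (x, ()))) x"
      proof -
        have "P (D 1) u (\<phi> (h, c) \<otimes>\<^bsub>G\<^esub> g, (x, ())) = (act R h (\<lambda>x. u (z \<otimes>\<^bsub>G\<^esub> g, (x, ()))) x + D 1 * act R h (\<lambda>x. u (g, (x, ()))) x) / 2"
          using hG g by (simp add: P_def m3) (simp add: m2 ue h g zgG)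
        then show ?thesis
          unfolding lin[OF h g] using D(2) by (simp add: distrib_left mult.assoc[symmetric])
      qed
    qed
  qed
  \<comment> \<open>A vector is split into its two eigencomponents; \<open>F'\<close> adds them up
    again.\<close>
  define F where "F u = case_sum (P 1 u) (P (-1) u)" for u
  define F' where "F' w = (\<lambda>x. w (Inl x) + w (Inr x))" for w :: "('g \<times> ('x \<times> unit)) + ('g \<times> ('x \<times> unit)) \<Rightarrow> complex"
  have F: "F u \<in> vs (rep_plus (?J triv_char) (?J sign_char))" if "u \<in> vs ?I" for u
    using P[OF that, of triv_char] P[OF that, of sign_char] by (simp add: rep_plus_simps F_def char)
  \<comment> \<open>Equivariance under the generator of B_1, read at the unit of \<open>H\<close>:
    left translation by \<open>z\<close> is the scalar \<open>D 1\<close>.\<close>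
  have zJ: "w (z \<otimes>\<^bsub>G\<^esub> g, x) = D 1 * w (g, x)" if w: "w \<in> vs (?J D)" and "D 0 = 1" "g \<in> carrier G" for D w g x
  proof (cases x)
    case (Pair y u)
    have "w (\<phi> (\<one>\<^bsub>H\<^esub>, c) \<otimes>\<^bsub>G\<^esub> g, (y, ())) = D 1 * act R \<one>\<^bsub>H\<^esub> (\<lambda>x. w (g, (x, ()))) y"
      using w that(3) unfolding J[where D = D, OF that(2)] by blast
    moreover have "(\<lambda>x. w (g, (x, ()))) \<in> vs R" using w that(3) unfolding J[where D = D, OF that(2)] by blast
    ultimately show ?thesis using R(6) by (simp add: z_def Pair)
  qed
  have F': "F' w \<in> vs ?I" if "w \<in> vs (rep_plus (?J triv_char) (?J sign_char))" for w
  proof -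
    have w: "w \<circ> Inl \<in> vs (?J triv_char)" "w \<circ> Inr \<in> vs (?J sign_char)" using that by (auto simp: rep_plus_simps)
    note w1 = w(1)[unfolded J[where D = triv_char, OF char(1)]] and w2 = w(2)[unfolded J[where D = sign_char, OF char(3)]]
    show ?thesis
      unfolding I
    proof (intro conjI ballI allI impI)
      show "(\<lambda>x. F' w (g, (x, ()))) \<in> vs R" if "g \<in> carrier G" for g
        unfolding F'_def using w1 w2 that by (intro subspace_add[OF R(4)]) auto
      show "F' w (g, x) = 0" if "g \<notin> carrier G" for g x
        using w1 w2 that by (cases x) (simp add: F'_def)
      fix h g x assume h: "h \<in> carrier H" and g: "g \<in> carrier G"
      have "(\<lambda>x. w (Inl (g, (x, ())))) \<in> vs R" "(\<lambda>x. w (Inr (g, (x, ())))) \<in> vs R"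
        using w1 w2 g by auto
      then show "F' w (\<phi> (h, e) \<otimes>\<^bsub>G\<^esub> g, (x, ())) = act R h (\<lambda>x. F' w (g, (x, ()))) x"
        using w1 w2 h g by (simp add: F'_def linear_between_add[OF R(5)[OF h]])
    qed
  qed
  show ?thesis
  proof (rule rep_isoI[where T = F])
    show "group_rep G ?I"
      by (rule group_rep_induced[OF G hom\<psi> group_rep_outer_tensor[OF R(1) group_rep_trivial[OF sym_group_is_group]]])
    show "linear_between (vs ?I) (vs (rep_plus (?J triv_char) (?J sign_char))) F"
      by (rule linear_betweenI)
        (rule F, assumption, auto simp: F_def P_def fun_eq_iff field_simps split: sum.split)
    show "bij_betw F (vs ?I) (vs (rep_plus (?J triv_char) (?J sign_char)))"
    proof (rule bij_betw_byWitness[where f' = F'])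
      have "F' (F u) (g, x) = u (g, x)" if "u \<in> vs ?I" for u g x
        using that unfolding I by (cases x; cases "g \<in> carrier G") (simp_all add: F_def F'_def P_def field_simps)
      then show "\<forall>u\<in>vs ?I. F' (F u) = u" by (auto simp: fun_eq_iff)
      show "\<forall>w\<in>vs (rep_plus (?J triv_char) (?J sign_char)). F (F' w) = w"
      proof
        fix w assume "w \<in> vs (rep_plus (?J triv_char) (?J sign_char))"
        then have w: "w \<circ> Inl \<in> vs (?J triv_char)" "w \<circ> Inr \<in> vs (?J sign_char)" by (auto simp: rep_plus_simps)
        have "F (F' w) (Inl (g, x)) = w (Inl (g, x)) \<and> F (F' w) (Inr (g, x)) = w (Inr (g, x))" for g x
        proof (cases "g \<in> carrier G")
          case True
          then show ?thesis
            using zJ[OF w(1) char(1) True] zJ[OF w(2) char(3) True]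
            by (simp add: F_def F'_def P_def char)
        next
          case False
          then show ?thesis
            using induced_repD(2)[OF w(1) False] induced_repD(2)[OF w(2) False]
            by (simp add: F_def P_def)
        qed
        then have "F (F' w) y = w y" for y by (cases y) auto
        then show "F (F' w) = w" by blast
      qed
    qed (use F F' in auto)
    show "F (act ?I a u) = act (rep_plus (?J triv_char) (?J sign_char)) a (F u)" if "a \<in> carrier G" for a u
      using that z by (auto simp: F_def P_def rep_plus_simps induced_rep_act G.m_assoc fun_eq_iff split: sum.split)
  qed
qed

text \<open>\<open>specht2\<close> reads the block sizes off its lists; carrying them as parameters
  lets them change by one when a box is added.\<close>

lemma specht2_eq_bispecht:
  "\<nu> \<in> partitions k \<Longrightarrow> \<mu> \<in> partitions l \<Longrightarrow> specht2 \<nu> \<mu> = bispecht triv_char sign_char k l \<nu> \<mu>"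
  by (simp add: specht2_def partitions_def)

theorem lemma7p2:
  fixes n k l :: nat and lam \<mu> :: "nat list"
  assumes "n \<ge> 2"
    and "lam \<in> partitions k" and "\<mu> \<in> partitions l" and "k + l = n - 1"
  shows "rep_iso (B n)
           (induced_rep (B n) (B (n - 1) \<times>\<times> B 1) (block_emb (n - 1) 1)
              (outer_tensor (specht2 lam \<mu>) (wreath_rep triv_char 1 trivial_rep)))
           (direct_sum (add_box lam) (\<lambda>\<tau>. specht2 \<tau> \<mu>))
       \<and> rep_iso (B n)
           (induced_rep (B n) (B (n - 1) \<times>\<times> B 1) (block_emb (n - 1) 1)
              (outer_tensor (specht2 lam \<mu>) (wreath_rep sign_char 1 trivial_rep)))
           (direct_sum (add_box \<mu>) (\<lambda>\<rho>. specht2 lam \<rho>))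
       \<and> rep_iso (B n)
           (induced_rep (B n) (B (n - 1) \<times>\<times> sym_group 1)
              (\<lambda>(x, s). block_emb (n - 1) 1 (x, (\<one>\<^bsub>product_group {1..1} (\<lambda>_. Z2)\<^esub>, s)))
              (outer_tensor (specht2 lam \<mu>) trivial_rep))
           (rep_plus
              (direct_sum (add_box lam) (\<lambda>\<tau>. specht2 \<tau> \<mu>))
              (direct_sum (add_box \<mu>) (\<lambda>\<rho>. specht2 lam \<rho>)))"
proof -
  note lam = assms(2) and \<mu> = assms(3)
  note D = Z2_char_triv Z2_char_sign
  have n: "n = k + l + 1" "n - 1 = k + l" using assms(1,4) by auto
  have G: "group (B n)" "finite (carrier (B n))" by simp_all
  have S: "specht2 lam \<mu> = bispecht triv_char sign_char k l lam \<mu>"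
    by (rule specht2_eq_bispecht[OF lam \<mu>])
  \<comment> \<open>\<open>specht2\<close> and \<open>bispecht\<close> agree only for partitions of
    the right sizes, that is, on the index set of the direct sum.\<close>
  have iso: "rep_iso (B n) (direct_sum I R) (direct_sum I R')"
    if "rep_iso (B n) Q (direct_sum I R)" "\<And>i. i \<in> I \<Longrightarrow> R i = R' i" "finite I"
      "\<And>i. i \<in> I \<Longrightarrow> group_rep (B n) (R i)" for Q :: "(hyperoct, 'q) rep" and I and R R' :: "nat list \<Rightarrow> (hyperoct, hyperoct \<times> tabloid \<times> tabloid) rep"
    using that G by (intro rep_iso_direct_sum) (auto intro: rep_iso_refl)
  have bi: "group_rep (B (a + b)) (bispecht triv_char sign_char a b \<nu> \<rho>)"
    if "\<nu> \<in> partitions a" "\<rho> \<in> partitions b" for a b \<nu> \<rho>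
    by (intro group_rep_induced group_rep_outer_tensor group_rep_wreath_specht block_emb_B D that) simp_all
  have 1: "rep_iso (B n) (induced_rep (B n) (B (n - 1) \<times>\<times> B 1) (block_emb (n - 1) 1)
              (outer_tensor (specht2 lam \<mu>) (wreath_rep triv_char 1 trivial_rep)))
           (direct_sum (add_box lam) (\<lambda>\<tau>. specht2 \<tau> \<mu>))"
  proof (rule rep_iso_trans)
    show i: "rep_iso (B n) (induced_rep (B n) (B (n - 1) \<times>\<times> B 1) (block_emb (n - 1) 1)
              (outer_tensor (specht2 lam \<mu>) (wreath_rep triv_char 1 trivial_rep)))
        (direct_sum (add_box lam) (\<lambda>\<tau>. bispecht triv_char sign_char (k + 1) l \<tau> \<mu>))"
      unfolding S n(2) by (rule rep_iso_induced_left[OF D lam \<mu>, unfolded n(1)[symmetric]])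
    show "rep_iso (B n) (direct_sum (add_box lam) (\<lambda>\<tau>. bispecht triv_char sign_char (k + 1) l \<tau> \<mu>))
        (direct_sum (add_box lam) (\<lambda>\<tau>. specht2 \<tau> \<mu>))"
    proof (rule iso[OF i])
      fix \<tau> assume "\<tau> \<in> add_box lam"
      then have t: "\<tau> \<in> partitions (k + 1)" by (rule add_box_partitions[OF lam])
      show "bispecht triv_char sign_char (k + 1) l \<tau> \<mu> = specht2 \<tau> \<mu>"
        by (rule specht2_eq_bispecht[OF t \<mu>, symmetric])
      have "k + 1 + l = n" using n by simp
      then show "group_rep (B n) (bispecht triv_char sign_char (k + 1) l \<tau> \<mu>)" using bi[OF t \<mu>] by simp
    qed simp
  qed
  have 2: "rep_iso (B n) (induced_rep (B n) (B (n - 1) \<times>\<times> B 1) (block_emb (n - 1) 1)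
              (outer_tensor (specht2 lam \<mu>) (wreath_rep sign_char 1 trivial_rep)))
           (direct_sum (add_box \<mu>) (\<lambda>\<rho>. specht2 lam \<rho>))"
  proof (rule rep_iso_trans)
    show i: "rep_iso (B n) (induced_rep (B n) (B (n - 1) \<times>\<times> B 1) (block_emb (n - 1) 1)
              (outer_tensor (specht2 lam \<mu>) (wreath_rep sign_char 1 trivial_rep)))
        (direct_sum (add_box \<mu>) (\<lambda>\<rho>. bispecht triv_char sign_char k (l + 1) lam \<rho>))"
      unfolding S n(2) by (rule rep_iso_induced_right[OF D lam \<mu>, unfolded n(1)[symmetric]])
    show "rep_iso (B n) (direct_sum (add_box \<mu>) (\<lambda>\<rho>. bispecht triv_char sign_char k (l + 1) lam \<rho>))
        (direct_sum (add_box \<mu>) (\<lambda>\<rho>. specht2 lam \<rho>))"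
    proof (rule iso[OF i])
      fix \<rho> assume "\<rho> \<in> add_box \<mu>"
      then have t: "\<rho> \<in> partitions (l + 1)" by (rule add_box_partitions[OF \<mu>])
      show "bispecht triv_char sign_char k (l + 1) lam \<rho> = specht2 lam \<rho>"
        by (rule specht2_eq_bispecht[OF lam t, symmetric])
      have "k + (l + 1) = n" using n by simp
      then show "group_rep (B n) (bispecht triv_char sign_char k (l + 1) lam \<rho>)" using bi[OF lam t] by simp
    qed simp
  qed
  have \<phi>: "block_emb (n - 1) 1 \<in> hom (B (n - 1) \<times>\<times> B 1) (B n)"
    using block_emb_B[of "n - 1" 1] assms(1) by simp
  have R: "group_rep (B (n - 1)) (specht2 lam \<mu>)" unfolding S n(2) by (rule bi[OF lam \<mu>])
  note 3 = rep_iso_induced_plus[OF G \<phi> R]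
  \<comment> \<open>The splitting by the two characters of B_1 reduces the third claim to the other
    two; it also shows that the intermediate sum is a representation, as \<open>rep_iso_plus\<close>
    demands.\<close>
  from rep_iso_trans[OF 3 rep_iso_plus[OF _ 1 2]] 3
  show ?thesis using 1 2 by (simp add: rep_iso_def)
qed

end
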